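(* Let $R$ be a nonzero semiprime alternative algebra with $\mathrm{Ann}_l N(P(R))=\{0\}$. Then $Q(P(R))=O(Q(P(R)))$ is a right algebra of quotients of $O(P(R))$, and $Q(P(R))_B$ is a right algebra of quotients of $O(P(R))_B$ for any ultrafilter $B$ in $B(R)$.
   Context: $F$ is an associative commutative ring with $1$; algebras are linear $F$-algebras. $(x,y,z)=(xy)z-x(yz)$, $[x,y]=xy-yx$. For an alternative algebra $R$: $N(R)=\{x\in R\mid(x,R,R)=(R,x,R)=(R,R,x)=\{0\}\}$ is the associative center; $\mathrm{Ann}_lX=\{x\in R\mid xX=\{0\}\}$ for $X\subseteq R$; $R^1=F\oplus R$ is $R$ with $1$ adjoined. $M(R)$ is the associative algebra generated by the operators $l_x:y\mapsto xy$, $r_x:y\mapsto yx$; $M(R)'=F\,\mathrm{Id}_R+M(R)$, acting on the right. $R$ is semiprime if $I^2\ne\{0\}$ for all nonzero ideals $I$. Right quotients. An alternative algebra $Q$ is a right algebra of quotients of an alternative algebra $R$ if $R$ is a subalgebra of $Q$, $N(R)\subseteq N(Q)$, and for any $x,y\in Q$, $x\ne0$, there is $z\in N(R)$ with $xz\ne0$, $yz\in R$. $\mathcal D_{nr}(R)$ is the set of right ideals $J$ of $N(R)$ such that for any $0\ne x\in R$, $y\in N(R)$ there is $z\in N(R)$ with $xz\ne0$, $yz\in J$. For $J\in\mathcal D_{nr}(R)$ and $I=JR^1$ (a right ideal of $R$), $\mathrm{Hom}^*(I,R)_{N(R)}$ is the set of right $N(R)$-module homomorphisms $\phi:I\to R$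 with $\phi(yx)=(\phi y)x$ and $\phi[y,z]\in N(R)$ for all $x\in R$, $y,z\in N(I)=I\cap N(R)$. If $R$ is semiprime and $\mathrm{Ann}_lN(R)=\{0\}$, the maximal right algebra of quotients $Q(R)$, into which all right algebras of quotients of $R$ embed identically on $R$, exists and is determined up to an isomorphism identical on $R$ by: (1) $R$ is a subalgebra of $Q(R)$; (2) for any $x\in Q(R)$ there is $J\in\mathcal D_{nr}(R)$ with $xJ\subseteq R$; (3) if $x\in Q(R)$, $J\in\mathcal D_{nr}(R)$, $xJ=\{0\}$, then $x=0$; (4) for any $J\in\mathcal D_{nr}(R)$, $\phi\in\mathrm{Hom}^*(JR^1,R)_{N(R)}$ there is $q\in Q(R)$ with $l_q|_{JR^1}=\phi$. Central closure and orthogonal completion. For nonzero semiprime $R$: $I(R)$ is an injective hull of the right $M(R)'$-module $R$; $P(R)=\mathrm{End}(I(R))_{M(R)'}R$; $\mathrm{CM}(R)=\mathrm{End}(P(R))_{M(R)'}$ (commutative, von Neumann regular). $P(R)=\mathrm{CM}(R)R$ is a $\mathrm{CM}(R)$-algebra, multiplication extended from $R$ by $\mathrm{CM}(R)$-linearity; $I(P(R))$ is an injective hull of $P(R)$ as a right module over $M(P(R))'=\mathrm{CM}(R)\mathrm{Id}+M(P(R))$. $B(R)$ is the set of idempotents of $\mathrm{CM}(R)$, a Boolean ring with multiplication of $\mathrm{CM}(R)$, addition $\alpha\oplus\beta=(\alpha-\beta)^2$, order $\alpha\le\beta$ iff $\alpha\beta=\alpha$. A subset of $B(R)$ is dense if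 its annihilator in $B(R)$ is zero, orthogonal if distinct elements have zero product. A set $S$ in $I(P(R))$ (or in the $\mathrm{CM}(R)$-algebra $Q(P(R))$) is orthogonally complete if for every dense orthogonal $\{\xi_a\}_{a\in I}\subseteq B(R)$ and $\{x_a\}_{a\in I}\subseteq S$ there is $x\in S$ (unique, denoted $\sum^\perp\xi_ax_a$) with $\xi_ax=\xi_ax_a$ for all $a$; $O(S)$ is the smallest orthogonally complete set containing $S$, i.e. the set of all $\sum^\perp\xi_ax_a$, $x_a\in S$. $Q(P(R))=O(Q(P(R)))$ means that $Q(P(R))$ is orthogonally complete. $O(P(R))$ is an algebra with $\sum^\perp\xi_ax_a\star\sum^\perp\chi_by_b=\sum^\perp\xi_a\chi_b(x_a\star y_b)$, $\star=+,\cdot$, and is identified with the orthogonal completion of $P(R)$ in $Q(P(R))$ via $\sum^\perp\xi_ax_a\mapsto\sum^\perp\xi_ax_a$. An ultrafilter in $B(R)$ is $B\subseteq B(R)\setminus\{0\}$ closed under products, upward closed for $\le$, and such that for each $\alpha\in B(R)$ either $\alpha\in B$ or $\mathrm{Id}-\alpha\in B$. With $P=B(R)\setminus B$, $PS=\{\alpha x\mid\alpha\in P,x\in S\}$, $S_B=S/(S\cap PS)$. *)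

theory Defs
  imports "HOL-Algebra.Module" "HOL-Algebra.QuotRing" "HOL-Algebra.Generated_Groups"
begin

section \<open>Nonassociative and alternative algebras\<close>

text \<open>
  Algebras are records of type \<open>('f, 'a) module\<close> over a commutative base ring. They need not be
  unital: the field \<open>one\<close> of the record is never used.
\<close>

locale nonassoc_algebra = module K A for K (structure) and A (structure) +
  assumes mult_closed: "\<lbrakk>x \<in> carrier A; y \<in> carrier A\<rbrakk> \<Longrightarrow> x \<otimes>\<^bsub>A\<^esub> y \<in> carrier A"
    and mult_l_distr: "\<lbrakk>x \<in> carrier A; y \<in> carrier A; z \<in> carrier A\<rbrakk>
      \<Longrightarrow> (x \<oplus>\<^bsub>A\<^esub> y) \<otimes>\<^bsub>A\<^esub> z = x \<otimes>\<^bsub>A\<^esub> z \<oplus>\<^bsub>A\<^esub> y \<otimes>\<^bsub>A\<^esub> z"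
    and mult_r_distr: "\<lbrakk>x \<in> carrier A; y \<in> carrier A; z \<in> carrier A\<rbrakk>
      \<Longrightarrow> z \<otimes>\<^bsub>A\<^esub> (x \<oplus>\<^bsub>A\<^esub> y) = z \<otimes>\<^bsub>A\<^esub> x \<oplus>\<^bsub>A\<^esub> z \<otimes>\<^bsub>A\<^esub> y"
    and smult_mult_l: "\<lbrakk>c \<in> carrier K; x \<in> carrier A; y \<in> carrier A\<rbrakk>
      \<Longrightarrow> (c \<odot>\<^bsub>A\<^esub> x) \<otimes>\<^bsub>A\<^esub> y = c \<odot>\<^bsub>A\<^esub> (x \<otimes>\<^bsub>A\<^esub> y)"
    and smult_mult_r: "\<lbrakk>c \<in> carrier K; x \<in> carrier A; y \<in> carrier A\<rbrakk>
      \<Longrightarrow> x \<otimes>\<^bsub>A\<^esub> (c \<odot>\<^bsub>A\<^esub> y) = c \<odot>\<^bsub>A\<^esub> (x \<otimes>\<^bsub>A\<^esub> y)"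

definition associator :: "('f, 'a, 'm) module_scheme \<Rightarrow> 'a \<Rightarrow> 'a \<Rightarrow> 'a \<Rightarrow> 'a" where
  "associator A x y z = (x \<otimes>\<^bsub>A\<^esub> y) \<otimes>\<^bsub>A\<^esub> z \<ominus>\<^bsub>A\<^esub> x \<otimes>\<^bsub>A\<^esub> (y \<otimes>\<^bsub>A\<^esub> z)"

definition commutator :: "('f, 'a, 'm) module_scheme \<Rightarrow> 'a \<Rightarrow> 'a \<Rightarrow> 'a" where
  "commutator A x y = x \<otimes>\<^bsub>A\<^esub> y \<ominus>\<^bsub>A\<^esub> y \<otimes>\<^bsub>A\<^esub> x"

locale alternative_algebra = nonassoc_algebra +
  assumes left_alternative: "\<lbrakk>x \<in> carrier A; y \<in> carrier A\<rbrakk> \<Longrightarrow> associator A x x y = \<zero>\<^bsub>A\<^esub>"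
    and right_alternative: "\<lbrakk>x \<in> carrier A; y \<in> carrier A\<rbrakk> \<Longrightarrow> associator A y x x = \<zero>\<^bsub>A\<^esub>"

definition nucleus :: "('f, 'a) module \<Rightarrow> 'a set" where
  "nucleus A = {x \<in> carrier A. \<forall>y\<in>carrier A. \<forall>z\<in>carrier A.
     associator A x y z = \<zero>\<^bsub>A\<^esub> \<and> associator A y x z = \<zero>\<^bsub>A\<^esub> \<and> associator A y z x = \<zero>\<^bsub>A\<^esub>}"

definition left_annihilator :: "('f, 'a) module \<Rightarrow> 'a set \<Rightarrow> 'a set" where
  "left_annihilator A Y = {x \<in> carrier A. \<forall>y\<in>Y. x \<otimes>\<^bsub>A\<^esub> y = \<zero>\<^bsub>A\<^esub>}"

definition algebra_ideal :: "('f, 'k) ring_scheme \<Rightarrow> ('f, 'a) module \<Rightarrow> 'a set \<Rightarrow> bool" where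
  "algebra_ideal K A I \<longleftrightarrow> submodule I K A \<and>
     (\<forall>x\<in>carrier A. \<forall>y\<in>I. x \<otimes>\<^bsub>A\<^esub> y \<in> I \<and> y \<otimes>\<^bsub>A\<^esub> x \<in> I)"

definition semiprime_algebra :: "('f, 'k) ring_scheme \<Rightarrow> ('f, 'a) module \<Rightarrow> bool" where
  "semiprime_algebra K A \<longleftrightarrow>
     (\<forall>I. algebra_ideal K A I \<and> I \<noteq> {\<zero>\<^bsub>A\<^esub>} \<longrightarrow> generate (add_monoid A) (I <#>\<^bsub>A\<^esub> I) \<noteq> {\<zero>\<^bsub>A\<^esub>})"

definition subalgebra_of ::
  "('f, 'k) ring_scheme \<Rightarrow> ('f, 'a) module \<Rightarrow> ('f, 'a) module \<Rightarrow> bool" where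
  "subalgebra_of K A Q \<longleftrightarrow> nonassoc_algebra K A \<and> nonassoc_algebra K Q \<and>
     carrier A \<subseteq> carrier Q \<and> \<zero>\<^bsub>A\<^esub> = \<zero>\<^bsub>Q\<^esub> \<and>
     (\<forall>x\<in>carrier A. \<forall>y\<in>carrier A. x \<oplus>\<^bsub>A\<^esub> y = x \<oplus>\<^bsub>Q\<^esub> y \<and> x \<otimes>\<^bsub>A\<^esub> y = x \<otimes>\<^bsub>Q\<^esub> y) \<and>
     (\<forall>c\<in>carrier K. \<forall>x\<in>carrier A. c \<odot>\<^bsub>A\<^esub> x = c \<odot>\<^bsub>Q\<^esub> x)"

definition algebra_embedding ::
  "('f, 'k) ring_scheme \<Rightarrow> ('f, 'a) module \<Rightarrow> ('f, 'b) module \<Rightarrow> ('a \<Rightarrow> 'b) \<Rightarrow> bool" where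
  "algebra_embedding K A Q h \<longleftrightarrow> nonassoc_algebra K A \<and> nonassoc_algebra K Q \<and>
     h \<in> carrier A \<rightarrow> carrier Q \<and> inj_on h (carrier A) \<and>
     (\<forall>x\<in>carrier A. \<forall>y\<in>carrier A.
        h (x \<oplus>\<^bsub>A\<^esub> y) = h x \<oplus>\<^bsub>Q\<^esub> h y \<and> h (x \<otimes>\<^bsub>A\<^esub> y) = h x \<otimes>\<^bsub>Q\<^esub> h y) \<and>
     (\<forall>c\<in>carrier K. \<forall>x\<in>carrier A. h (c \<odot>\<^bsub>A\<^esub> x) = c \<odot>\<^bsub>Q\<^esub> h x)"

definition quotient_algebra :: "('f, 'a) module \<Rightarrow> 'a set \<Rightarrow> ('f, 'a set) module" where
  "quotient_algebra A I =
     \<lparr>carrier = carrier (A Quot I), monoid.mult = monoid.mult (A Quot I), one = one (A Quot I),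
      zero = zero (A Quot I), add = add (A Quot I),
      smult = (\<lambda>c Y. \<Union>x\<in>Y. I +>\<^bsub>A\<^esub> (c \<odot>\<^bsub>A\<^esub> x))\<rparr>"


section \<open>Right algebras of quotients\<close>

definition right_quotient_algebra ::
  "('f, 'k) ring_scheme \<Rightarrow> ('f, 'a) module \<Rightarrow> ('f, 'a) module \<Rightarrow> bool" where
  "right_quotient_algebra K A Q \<longleftrightarrow>
     alternative_algebra K A \<and> alternative_algebra K Q \<and> subalgebra_of K A Q \<and>
     nucleus A \<subseteq> nucleus Q \<and>
     (\<forall>x\<in>carrier Q. \<forall>y\<in>carrier Q. x \<noteq> \<zero>\<^bsub>Q\<^esub> \<longrightarrow>
        (\<exists>z\<in>nucleus A. x \<otimes>\<^bsub>Q\<^esub> z \<noteq> \<zero>\<^bsub>Q\<^esub> \<and> y \<otimes>\<^bsub>Q\<^esub> z \<in> carrier A))"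

definition dense_right_ideals :: "('f, 'k) ring_scheme \<Rightarrow> ('f, 'a) module \<Rightarrow> 'a set set" where
  "dense_right_ideals K A =
     {J. submodule J K A \<and> J \<subseteq> nucleus A \<and>
         (\<forall>x\<in>J. \<forall>y\<in>nucleus A. x \<otimes>\<^bsub>A\<^esub> y \<in> J) \<and>
         (\<forall>x\<in>carrier A - {\<zero>\<^bsub>A\<^esub>}. \<forall>y\<in>nucleus A.
            \<exists>z\<in>nucleus A. x \<otimes>\<^bsub>A\<^esub> z \<noteq> \<zero>\<^bsub>A\<^esub> \<and> y \<otimes>\<^bsub>A\<^esub> z \<in> J)}"

text \<open>\<open>J R\<^sup>1\<close>, where \<open>R\<^sup>1\<close> is \<open>R\<close> with a unit adjoined; for a submodule \<open>J\<close> this is \<open>J + J R\<close>.\<close>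

definition unital_right_span :: "('f, 'a) module \<Rightarrow> 'a set \<Rightarrow> 'a set" where
  "unital_right_span A J = generate (add_monoid A) (J \<union> (J <#>\<^bsub>A\<^esub> carrier A))"

definition Hom_star :: "('f, 'a) module \<Rightarrow> 'a set \<Rightarrow> ('a \<Rightarrow> 'a) set" where
  "Hom_star A I = {\<phi> \<in> I \<rightarrow> carrier A.
     (\<forall>u\<in>I. \<forall>v\<in>I. \<phi> (u \<oplus>\<^bsub>A\<^esub> v) = \<phi> u \<oplus>\<^bsub>A\<^esub> \<phi> v) \<and>
     (\<forall>u\<in>I. \<forall>n\<in>nucleus A. \<phi> (u \<otimes>\<^bsub>A\<^esub> n) = \<phi> u \<otimes>\<^bsub>A\<^esub> n) \<and>
     (\<forall>y\<in>I \<inter> nucleus A. \<forall>x\<in>carrier A. \<phi> (y \<otimes>\<^bsub>A\<^esub> x) = \<phi> y \<otimes>\<^bsub>A\<^esub> x) \<and>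
     (\<forall>y\<in>I \<inter> nucleus A. \<forall>z\<in>I \<inter> nucleus A. \<phi> (commutator A y z) \<in> nucleus A)}"

definition maximal_right_quotient_algebra ::
  "('f, 'k) ring_scheme \<Rightarrow> ('f, 'a) module \<Rightarrow> ('f, 'a) module \<Rightarrow> bool" where
  "maximal_right_quotient_algebra K A Q \<longleftrightarrow>
     right_quotient_algebra K A Q \<and>
     (\<forall>x\<in>carrier Q. \<exists>J\<in>dense_right_ideals K A. \<forall>y\<in>J. x \<otimes>\<^bsub>Q\<^esub> y \<in> carrier A) \<and>
     (\<forall>x\<in>carrier Q. \<forall>J\<in>dense_right_ideals K A.
        (\<forall>y\<in>J. x \<otimes>\<^bsub>Q\<^esub> y = \<zero>\<^bsub>Q\<^esub>) \<longrightarrow> x = \<zero>\<^bsub>Q\<^esub>) \<and>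
     (\<forall>J\<in>dense_right_ideals K A. \<forall>\<phi>\<in>Hom_star A (unital_right_span A J).
        \<exists>q\<in>carrier Q. \<forall>u\<in>unital_right_span A J. q \<otimes>\<^bsub>Q\<^esub> u = \<phi> u)"


section \<open>Right modules and injective hulls\<close>

text \<open>\<open>s \<odot>\<^bsub>M\<^esub> x\<close> stands for the right action \<open>x \<cdot> s\<close>; see the order of factors in \<open>act_mult\<close>.\<close>

locale right_module = S?: ring S + M?: abelian_group M for S (structure) and M (structure) +
  assumes act_closed: "\<lbrakk>s \<in> carrier S; x \<in> carrier M\<rbrakk> \<Longrightarrow> s \<odot>\<^bsub>M\<^esub> x \<in> carrier M"
    and act_add_ring: "\<lbrakk>s \<in> carrier S; t \<in> carrier S; x \<in> carrier M\<rbrakk>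
      \<Longrightarrow> (s \<oplus>\<^bsub>S\<^esub> t) \<odot>\<^bsub>M\<^esub> x = s \<odot>\<^bsub>M\<^esub> x \<oplus>\<^bsub>M\<^esub> t \<odot>\<^bsub>M\<^esub> x"
    and act_add: "\<lbrakk>s \<in> carrier S; x \<in> carrier M; y \<in> carrier M\<rbrakk>
      \<Longrightarrow> s \<odot>\<^bsub>M\<^esub> (x \<oplus>\<^bsub>M\<^esub> y) = s \<odot>\<^bsub>M\<^esub> x \<oplus>\<^bsub>M\<^esub> s \<odot>\<^bsub>M\<^esub> y"
    and act_mult: "\<lbrakk>s \<in> carrier S; t \<in> carrier S; x \<in> carrier M\<rbrakk>
      \<Longrightarrow> (s \<otimes>\<^bsub>S\<^esub> t) \<odot>\<^bsub>M\<^esub> x = t \<odot>\<^bsub>M\<^esub> (s \<odot>\<^bsub>M\<^esub> x)"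
    and act_one: "x \<in> carrier M \<Longrightarrow> \<one>\<^bsub>S\<^esub> \<odot>\<^bsub>M\<^esub> x = x"

definition right_module_hom ::
  "('s, 'k) ring_scheme \<Rightarrow> ('s, 'b) module \<Rightarrow> ('s, 'c) module \<Rightarrow> ('b \<Rightarrow> 'c) set" where
  "right_module_hom S M N = {f \<in> carrier M \<rightarrow> carrier N.
     (\<forall>x\<in>carrier M. \<forall>y\<in>carrier M. f (x \<oplus>\<^bsub>M\<^esub> y) = f x \<oplus>\<^bsub>N\<^esub> f y) \<and>
     (\<forall>s\<in>carrier S. \<forall>x\<in>carrier M. f (s \<odot>\<^bsub>M\<^esub> x) = s \<odot>\<^bsub>N\<^esub> f x)}"

text \<open>
  Injectivity is the extension property for homomorphisms from submodules \<open>U\<close> of right modules \<open>N\<close>.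
  HOL cannot quantify over all types inside a predicate, so \<open>N\<close> ranges over the modules whose
  elements are taken from the element type \<open>'s\<close> of the ring. This includes the regular module of
  \<open>S\<close> with its right ideals, so by Baer's criterion no generality is lost.
\<close>

definition injective_right_module :: "('s, 'k) ring_scheme \<Rightarrow> ('s, 'b) module \<Rightarrow> bool" where
  "injective_right_module S E \<longleftrightarrow> right_module S E \<and>
     (\<forall>(N :: ('s, 's) module) U f.
        right_module S N \<and> submodule U S N \<and> f \<in> right_module_hom S (N\<lparr>carrier := U\<rparr>) E \<longrightarrow>
        (\<exists>g \<in> right_module_hom S N E. \<forall>u\<in>U. g u = f u))"

definition injective_hull ::
  "('s, 'k) ring_scheme \<Rightarrow> ('s, 'b) module \<Rightarrow> ('s, 'b) module \<Rightarrow> bool" where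
  "injective_hull S M E \<longleftrightarrow> right_module S M \<and> injective_right_module S E \<and>
     submodule (carrier M) S E \<and> \<zero>\<^bsub>M\<^esub> = \<zero>\<^bsub>E\<^esub> \<and>
     (\<forall>x\<in>carrier M. \<forall>y\<in>carrier M. x \<oplus>\<^bsub>M\<^esub> y = x \<oplus>\<^bsub>E\<^esub> y) \<and>
     (\<forall>s\<in>carrier S. \<forall>x\<in>carrier M. s \<odot>\<^bsub>M\<^esub> x = s \<odot>\<^bsub>E\<^esub> x) \<and>
     (\<forall>U. submodule U S E \<and> U \<noteq> {\<zero>\<^bsub>E\<^esub>} \<longrightarrow> U \<inter> carrier M \<noteq> {\<zero>\<^bsub>E\<^esub>})"

text \<open>Endomorphisms act on the left; they are made extensional so that equality is equality of maps.\<close>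

definition endomorphism_ring :: "('s, 'k) ring_scheme \<Rightarrow> ('s, 'b) module \<Rightarrow> ('b \<Rightarrow> 'b) ring" where
  "endomorphism_ring S M =
     \<lparr>carrier = right_module_hom S M M \<inter> extensional (carrier M),
      monoid.mult = (\<lambda>f g. \<lambda>x\<in>carrier M. f (g x)), one = (\<lambda>x\<in>carrier M. x),
      zero = (\<lambda>x\<in>carrier M. \<zero>\<^bsub>M\<^esub>), add = (\<lambda>f g. \<lambda>x\<in>carrier M. f x \<oplus>\<^bsub>M\<^esub> g x)\<rparr>"


section \<open>Multiplication algebra, central closure and extended centroid\<close>

inductive_set multiplication_algebra ::
  "('f, 'k) ring_scheme \<Rightarrow> ('f, 'a) module \<Rightarrow> ('a \<Rightarrow> 'a) set" for K A where
  left_mult: "x \<in> carrier A \<Longrightarrow> (\<lambda>y\<in>carrier A. x \<otimes>\<^bsub>A\<^esub> y) \<in> multiplication_algebra K A"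
| right_mult: "x \<in> carrier A \<Longrightarrow> (\<lambda>y\<in>carrier A. y \<otimes>\<^bsub>A\<^esub> x) \<in> multiplication_algebra K A"
| add: "\<lbrakk>s \<in> multiplication_algebra K A; t \<in> multiplication_algebra K A\<rbrakk>
    \<Longrightarrow> (\<lambda>y\<in>carrier A. s y \<oplus>\<^bsub>A\<^esub> t y) \<in> multiplication_algebra K A"
| smult: "\<lbrakk>c \<in> carrier K; s \<in> multiplication_algebra K A\<rbrakk>
    \<Longrightarrow> (\<lambda>y\<in>carrier A. c \<odot>\<^bsub>A\<^esub> s y) \<in> multiplication_algebra K A"
| comp: "\<lbrakk>s \<in> multiplication_algebra K A; t \<in> multiplication_algebra K A\<rbrakk>
    \<Longrightarrow> (\<lambda>y\<in>carrier A. t (s y)) \<in> multiplication_algebra K A"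

text \<open>\<open>M(A)' = K Id + M(A)\<close>; as it acts on the right, \<open>s \<otimes> t\<close> means first \<open>s\<close>, then \<open>t\<close>.\<close>

definition multiplication_ring ::
  "('f, 'k) ring_scheme \<Rightarrow> ('f, 'a) module \<Rightarrow> ('a \<Rightarrow> 'a) ring" where
  "multiplication_ring K A =
     \<lparr>carrier = {\<lambda>y\<in>carrier A. c \<odot>\<^bsub>A\<^esub> y \<oplus>\<^bsub>A\<^esub> s y | c s.
        c \<in> carrier K \<and> s \<in> multiplication_algebra K A},
      monoid.mult = (\<lambda>s t. \<lambda>y\<in>carrier A. t (s y)), one = (\<lambda>y\<in>carrier A. y),
      zero = (\<lambda>y\<in>carrier A. \<zero>\<^bsub>A\<^esub>), add = (\<lambda>s t. \<lambda>y\<in>carrier A. s y \<oplus>\<^bsub>A\<^esub> t y)\<rparr>"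

definition multiplication_module :: "('f, 'a) module \<Rightarrow> ('a \<Rightarrow> 'a, 'a) module" where
  "multiplication_module A =
     \<lparr>carrier = carrier A, monoid.mult = monoid.mult A, one = one A, zero = zero A, add = add A,
      smult = (\<lambda>s x. s x)\<rparr>"

text \<open>Below, \<open>E\<close> is an injective hull \<open>I(R)\<close> of the right \<open>M(R)'\<close>-module \<open>R\<close>.\<close>

definition closure_carrier ::
  "('f, 'k) ring_scheme \<Rightarrow> ('f, 'a) module \<Rightarrow> ('a \<Rightarrow> 'a, 'a) module \<Rightarrow> 'a set" where
  "closure_carrier F R E = generate (add_monoid E)
     {\<alpha> x | \<alpha> x. \<alpha> \<in> carrier (endomorphism_ring (multiplication_ring F R) E) \<and> x \<in> carrier R}"

definition CM ::
  "('f, 'k) ring_scheme \<Rightarrow> ('f, 'a) module \<Rightarrow> ('a \<Rightarrow> 'a, 'a) module \<Rightarrow> ('a \<Rightarrow> 'a) ring" where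
  "CM F R E =
     endomorphism_ring (multiplication_ring F R) (E\<lparr>carrier := closure_carrier F R E\<rparr>)"

text \<open>
  \<open>P(R)\<close> with its \<open>CM(R)\<close>-algebra structure: the addition and the scalar action come from \<open>I(R)\<close>, and
  the multiplication is the \<open>CM(R)\<close>-bilinear extension of that of \<open>R\<close>, which is unique because \<open>R\<close>
  spans \<open>P(R)\<close> over \<open>CM(R)\<close>.
\<close>

definition is_central_closure ::
  "('f, 'k) ring_scheme \<Rightarrow> ('f, 'a) module \<Rightarrow> ('a \<Rightarrow> 'a, 'a) module \<Rightarrow> ('a \<Rightarrow> 'a, 'a) module \<Rightarrow> bool"
where
  "is_central_closure F R E P \<longleftrightarrow> nonassoc_algebra (CM F R E) P \<and>
     carrier P = closure_carrier F R E \<and> \<zero>\<^bsub>P\<^esub> = \<zero>\<^bsub>E\<^esub> \<and>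
     (\<forall>x\<in>carrier P. \<forall>y\<in>carrier P. x \<oplus>\<^bsub>P\<^esub> y = x \<oplus>\<^bsub>E\<^esub> y) \<and>
     (\<forall>\<alpha>\<in>carrier (CM F R E). \<forall>x\<in>carrier P. \<alpha> \<odot>\<^bsub>P\<^esub> x = \<alpha> x) \<and>
     (\<forall>x\<in>carrier R. \<forall>y\<in>carrier R. x \<otimes>\<^bsub>P\<^esub> y = x \<otimes>\<^bsub>R\<^esub> y)"


section \<open>Orthogonal completeness and ultrafilters\<close>

text \<open>In this section \<open>C\<close> is a commutative ring, later \<open>CM(R)\<close>.\<close>

definition idempotents :: "('c, 'k) ring_scheme \<Rightarrow> 'c set" where
  "idempotents C = {\<alpha> \<in> carrier C. \<alpha> \<otimes>\<^bsub>C\<^esub> \<alpha> = \<alpha>}"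

definition dense_orthogonal :: "('c, 'k) ring_scheme \<Rightarrow> 'c set \<Rightarrow> bool" where
  "dense_orthogonal C D \<longleftrightarrow> D \<subseteq> idempotents C \<and>
     (\<forall>\<xi>\<in>D. \<forall>\<chi>\<in>D. \<xi> \<noteq> \<chi> \<longrightarrow> \<xi> \<otimes>\<^bsub>C\<^esub> \<chi> = \<zero>\<^bsub>C\<^esub>) \<and>
     (\<forall>\<beta>\<in>idempotents C. (\<forall>\<xi>\<in>D. \<beta> \<otimes>\<^bsub>C\<^esub> \<xi> = \<zero>\<^bsub>C\<^esub>) \<longrightarrow> \<beta> = \<zero>\<^bsub>C\<^esub>)"

text \<open>
  A family of pairwise orthogonal idempotents is indexed by the set of its members: only the zero
  idempotent could be repeated, and it imposes no condition.
\<close>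

definition orthogonally_complete ::
  "('c, 'k) ring_scheme \<Rightarrow> ('c, 'a) module \<Rightarrow> 'a set \<Rightarrow> bool" where
  "orthogonally_complete C M S \<longleftrightarrow> S \<subseteq> carrier M \<and>
     (\<forall>D u. dense_orthogonal C D \<and> u \<in> D \<rightarrow> S \<longrightarrow>
        (\<exists>!x. x \<in> S \<and> (\<forall>\<xi>\<in>D. \<xi> \<odot>\<^bsub>M\<^esub> x = \<xi> \<odot>\<^bsub>M\<^esub> u \<xi>)))"

definition orthogonal_completion ::
  "('c, 'k) ring_scheme \<Rightarrow> ('c, 'a) module \<Rightarrow> 'a set \<Rightarrow> 'a set" where
  "orthogonal_completion C M S = \<Inter>{T. S \<subseteq> T \<and> orthogonally_complete C M T}"

definition boolean_ultrafilter :: "('c, 'k) ring_scheme \<Rightarrow> 'c set \<Rightarrow> bool" where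
  "boolean_ultrafilter C B \<longleftrightarrow> B \<subseteq> idempotents C - {\<zero>\<^bsub>C\<^esub>} \<and>
     (\<forall>\<alpha>\<in>B. \<forall>\<beta>\<in>B. \<alpha> \<otimes>\<^bsub>C\<^esub> \<beta> \<in> B) \<and>
     (\<forall>\<alpha>\<in>B. \<forall>\<beta>\<in>idempotents C. \<alpha> \<otimes>\<^bsub>C\<^esub> \<beta> = \<alpha> \<longrightarrow> \<beta> \<in> B) \<and>
     (\<forall>\<alpha>\<in>idempotents C. \<alpha> \<in> B \<or> \<one>\<^bsub>C\<^esub> \<ominus>\<^bsub>C\<^esub> \<alpha> \<in> B)"

text \<open>The set \<open>S \<inter> PS\<close> for the carrier \<open>S\<close> of \<open>A\<close> and \<open>P = B(R) - B\<close>.\<close>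

definition ultra_ideal :: "('c, 'k) ring_scheme \<Rightarrow> ('c, 'a) module \<Rightarrow> 'c set \<Rightarrow> 'a set" where
  "ultra_ideal C A B =
     carrier A \<inter> {\<alpha> \<odot>\<^bsub>A\<^esub> x | \<alpha> x. \<alpha> \<in> idempotents C - B \<and> x \<in> carrier A}"

definition ultra_quotient ::
  "('c, 'k) ring_scheme \<Rightarrow> ('c, 'a) module \<Rightarrow> 'c set \<Rightarrow> ('c, 'a set) module" where
  "ultra_quotient C A B = quotient_algebra A (ultra_ideal C A B)"

text \<open>
  For a subalgebra \<open>A\<close> of \<open>Q\<close>, the natural map from \<open>A\<^sub>B\<close> to \<open>Q\<^sub>B\<close> sends the coset of \<open>x\<close> to the
  (larger) coset of \<open>x\<close>.
\<close>

definition ultra_map ::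
  "('c, 'k) ring_scheme \<Rightarrow> ('c, 'a) module \<Rightarrow> 'c set \<Rightarrow> 'a set \<Rightarrow> 'a set" where
  "ultra_map C Q B Y = (\<Union>x\<in>Y. ultra_ideal C Q B +>\<^bsub>Q\<^esub> x)"

end

theory Submission
  imports Defs
begin

text \<open>
  Every \<open>x \<noteq> 0\<close> in \<open>P(R)\<close> has a support: an idempotent \<open>e\<close> of \<open>CM(R)\<close> with \<open>e x = x\<close> such that
  \<open>c x = 0\<close> implies \<open>c e = 0\<close>. It is the restriction of an endomorphism of the injective hull which
  projects an essential submodule onto \<open>x M(R)'\<close>. Elements of \<open>Q(P(R))\<close> inherit nonzero idempotents
  of this kind from their right multiples in \<open>P(R)\<close>, so elements of \<open>Q(P(R))\<close> are determined by
  their components along a dense orthogonal set. Given components \<open>u d\<close>, the elements \<open>v\<close> of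
  \<open>N(P(R))\<close> for which some \<open>w\<close> in \<open>P(R)\<close> has the components \<open>d u(d) v\<close> form a dense right ideal,
  and the element of \<open>Q(P(R))\<close> inducing \<open>v \<mapsto> w\<close> has the components \<open>d u(d)\<close>.

  Modulo an ultrafilter \<open>B\<close>, an element vanishes iff some member of \<open>B\<close> kills it. If a set closed
  under gluing vanishes elementwise modulo \<open>B\<close>, then gluing elements of locally maximal support
  gives one \<open>b \<in> B\<close> killing the whole set. For the associators \<open>(n, x, y)\<close> this lifts nuclear
  elements modulo \<open>B\<close> to nuclear elements; gluing denominators in the same way handles the density
  condition.
\<close>

section \<open>Nonassociative and alternative algebras\<close>

text \<open>Only maps in \<open>Hom_star\<close> are represented by elements of \<open>Q\<close>, so
  the glued map must send commutators of nuclear elements to nuclear elements. This rests on the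
  skew symmetry of associators: u [m, n] is nuclear for every u and all nuclear m, n, so every
  component of the image of a commutator is nuclear.

  The obstacle at an ultrafilter \<open>B\<close> is that it is closed under finite products only. A
  coset being nuclear in O(P)_B means that each associator (n, x, y) is killed by a member of
  \<open>B\<close> that depends on x and y, and infinitely many members of \<open>B\<close> need not
  have a lower bound in \<open>B\<close>. Gluing replaces this infinite meet. Denominators meet the
  same obstacle: from x z \<noteq> 0 in \<open>Q\<close> it does not follow that x z \<noteq> 0
  modulo \<open>B\<close>.

  Semiprimeness enters through one fact: an element of CM(R) that vanishes on an essential submodule
  is 0. An extension of a projection to the hull is known only where the projection was defined, and
  this fact makes its restriction idempotent and gives the cancellation property.\<close>

lemma (in abelian_group) minus_eq_zero_iff:
  "\<lbrakk>x \<in> carrier G; y \<in> carrier G\<rbrakk> \<Longrightarrow> x \<ominus> y = \<zero> \<longleftrightarrow> x = y"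
  by (metis a_minus_def add.inv_closed add.inv_inv minus_equality r_neg)

context nonassoc_algebra
begin

lemma M_minus_zero: "\<ominus>\<^bsub>A\<^esub> \<zero>\<^bsub>A\<^esub> = \<zero>\<^bsub>A\<^esub>"
  by (rule M.minus_equality) simp_all

lemma mult_zero_left: "x \<in> carrier A \<Longrightarrow> \<zero>\<^bsub>A\<^esub> \<otimes>\<^bsub>A\<^esub> x = \<zero>\<^bsub>A\<^esub>"
  by (metis M.zero_closed R.zero_closed mult_closed smult_l_null smult_mult_l)

lemma mult_zero_right: "x \<in> carrier A \<Longrightarrow> x \<otimes>\<^bsub>A\<^esub> \<zero>\<^bsub>A\<^esub> = \<zero>\<^bsub>A\<^esub>"
  by (metis M.zero_closed R.zero_closed mult_closed smult_l_null smult_mult_r)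

lemma mult_neg_left:
  "\<lbrakk>x \<in> carrier A; y \<in> carrier A\<rbrakk> \<Longrightarrow> (\<ominus>\<^bsub>A\<^esub> x) \<otimes>\<^bsub>A\<^esub> y = \<ominus>\<^bsub>A\<^esub> (x \<otimes>\<^bsub>A\<^esub> y)"
  by (metis M.add.inv_closed M.l_neg M.minus_equality mult_closed mult_l_distr mult_zero_left)

lemma mult_neg_right:
  "\<lbrakk>x \<in> carrier A; y \<in> carrier A\<rbrakk> \<Longrightarrow> x \<otimes>\<^bsub>A\<^esub> (\<ominus>\<^bsub>A\<^esub> y) = \<ominus>\<^bsub>A\<^esub> (x \<otimes>\<^bsub>A\<^esub> y)"
  by (metis M.add.inv_closed M.l_neg M.minus_equality mult_closed mult_r_distr mult_zero_right)

lemma associator_closed: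
  "\<lbrakk>x \<in> carrier A; y \<in> carrier A; z \<in> carrier A\<rbrakk> \<Longrightarrow> associator A x y z \<in> carrier A"
  by (simp add: associator_def mult_closed)

lemma associator_eq_zero_iff:
  "\<lbrakk>x \<in> carrier A; y \<in> carrier A; z \<in> carrier A\<rbrakk>
    \<Longrightarrow> associator A x y z = \<zero>\<^bsub>A\<^esub> \<longleftrightarrow> (x \<otimes>\<^bsub>A\<^esub> y) \<otimes>\<^bsub>A\<^esub> z = x \<otimes>\<^bsub>A\<^esub> (y \<otimes>\<^bsub>A\<^esub> z)"
  by (simp add: associator_def mult_closed M.minus_eq_zero_iff)

lemma associator_add:
  assumes "x \<in> carrier A" "y \<in> carrier A" "z \<in> carrier A" "w \<in> carrier A"
  shows associator_add_1: "associator A (x \<oplus>\<^bsub>A\<^esub> w) y z = associator A x y z \<oplus>\<^bsub>A\<^esub> associator A w y z"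
    and associator_add_2: "associator A x (y \<oplus>\<^bsub>A\<^esub> w) z = associator A x y z \<oplus>\<^bsub>A\<^esub> associator A x w z"
    and associator_add_3: "associator A x y (z \<oplus>\<^bsub>A\<^esub> w) = associator A x y z \<oplus>\<^bsub>A\<^esub> associator A x y w"
  using assms
  by (simp_all add: associator_def mult_closed mult_l_distr mult_r_distr a_minus_def M.minus_add M.a_ac)

lemma associator_smult:
  assumes "c \<in> carrier K" "x \<in> carrier A" "y \<in> carrier A" "z \<in> carrier A"
  shows associator_smult_1: "associator A (c \<odot>\<^bsub>A\<^esub> x) y z = c \<odot>\<^bsub>A\<^esub> associator A x y z"
    and associator_smult_2: "associator A x (c \<odot>\<^bsub>A\<^esub> y) z = c \<odot>\<^bsub>A\<^esub> associator A x y z"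
    and associator_smult_3: "associator A x y (c \<odot>\<^bsub>A\<^esub> z) = c \<odot>\<^bsub>A\<^esub> associator A x y z"
  using assms
  by (simp_all add: associator_def mult_closed smult_mult_l smult_mult_r a_minus_def
      smult_r_distr smult_r_minus)

end


text \<open>\<open>nucleus\<close> and the notions built on it are only defined for records without extension fields.\<close>

locale plain_algebra = nonassoc_algebra K A
  for K :: "('f, 'k) ring_scheme" (structure) and A :: "('f, 'a) module" (structure)
begin

lemma nucleus_closed: "n \<in> nucleus A \<Longrightarrow> n \<in> carrier A"
  by (simp add: nucleus_def)

lemma nucleus_iff:
  "n \<in> nucleus A \<longleftrightarrow> n \<in> carrier A \<and> (\<forall>y\<in>carrier A. \<forall>z\<in>carrier A.
     (n \<otimes>\<^bsub>A\<^esub> y) \<otimes>\<^bsub>A\<^esub> z = n \<otimes>\<^bsub>A\<^esub> (y \<otimes>\<^bsub>A\<^esub> z) \<and>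
     (y \<otimes>\<^bsub>A\<^esub> n) \<otimes>\<^bsub>A\<^esub> z = y \<otimes>\<^bsub>A\<^esub> (n \<otimes>\<^bsub>A\<^esub> z) \<and>
     (y \<otimes>\<^bsub>A\<^esub> z) \<otimes>\<^bsub>A\<^esub> n = y \<otimes>\<^bsub>A\<^esub> (z \<otimes>\<^bsub>A\<^esub> n))"
  unfolding nucleus_def by (auto simp: associator_eq_zero_iff)

lemma nucleus_assoc:
  assumes "n \<in> nucleus A" "y \<in> carrier A" "z \<in> carrier A"
  shows nucleus_assoc_1: "(n \<otimes>\<^bsub>A\<^esub> y) \<otimes>\<^bsub>A\<^esub> z = n \<otimes>\<^bsub>A\<^esub> (y \<otimes>\<^bsub>A\<^esub> z)"
    and nucleus_assoc_2: "(y \<otimes>\<^bsub>A\<^esub> n) \<otimes>\<^bsub>A\<^esub> z = y \<otimes>\<^bsub>A\<^esub> (n \<otimes>\<^bsub>A\<^esub> z)"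
    and nucleus_assoc_3: "(y \<otimes>\<^bsub>A\<^esub> z) \<otimes>\<^bsub>A\<^esub> n = y \<otimes>\<^bsub>A\<^esub> (z \<otimes>\<^bsub>A\<^esub> n)"
  using assms nucleus_iff by auto

lemma nucleus_zero: "\<zero>\<^bsub>A\<^esub> \<in> nucleus A"
  by (simp add: nucleus_iff mult_zero_left mult_zero_right mult_closed)

lemma nucleus_add: "\<lbrakk>m \<in> nucleus A; n \<in> nucleus A\<rbrakk> \<Longrightarrow> m \<oplus>\<^bsub>A\<^esub> n \<in> nucleus A"
  by (simp add: nucleus_def associator_add)

lemma nucleus_smult: "\<lbrakk>c \<in> carrier K; n \<in> nucleus A\<rbrakk> \<Longrightarrow> c \<odot>\<^bsub>A\<^esub> n \<in> nucleus A"
  by (simp add: nucleus_def associator_smult)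

lemma nucleus_neg: "n \<in> nucleus A \<Longrightarrow> \<ominus>\<^bsub>A\<^esub> n \<in> nucleus A"
  by (metis R.add.inv_closed R.one_closed nucleus_closed nucleus_smult smult_l_minus smult_one)

text \<open>Two of the three positions are spelled out as chains because they begin by splitting m
  n, against the direction in which the nuclear laws rewrite.\<close>

lemma nucleus_mult: "\<lbrakk>m \<in> nucleus A; n \<in> nucleus A\<rbrakk> \<Longrightarrow> m \<otimes>\<^bsub>A\<^esub> n \<in> nucleus A"
proof -
  assume mn: "m \<in> nucleus A" "n \<in> nucleus A"
  note c = nucleus_closed[OF mn(1)] nucleus_closed[OF mn(2)]
  have "(y \<otimes>\<^bsub>A\<^esub> (m \<otimes>\<^bsub>A\<^esub> n)) \<otimes>\<^bsub>A\<^esub> z = y \<otimes>\<^bsub>A\<^esub> ((m \<otimes>\<^bsub>A\<^esub> n) \<otimes>\<^bsub>A\<^esub> z)"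
    "(y \<otimes>\<^bsub>A\<^esub> z) \<otimes>\<^bsub>A\<^esub> (m \<otimes>\<^bsub>A\<^esub> n) = y \<otimes>\<^bsub>A\<^esub> (z \<otimes>\<^bsub>A\<^esub> (m \<otimes>\<^bsub>A\<^esub> n))"
    if "y \<in> carrier A" "z \<in> carrier A" for y z
  proof -
    note m = mult_closed that c
    have "(y \<otimes>\<^bsub>A\<^esub> (m \<otimes>\<^bsub>A\<^esub> n)) \<otimes>\<^bsub>A\<^esub> z = ((y \<otimes>\<^bsub>A\<^esub> m) \<otimes>\<^bsub>A\<^esub> n) \<otimes>\<^bsub>A\<^esub> z"
      by (simp add: m nucleus_assoc_2[OF mn(1)])
    also have "\<dots> = (y \<otimes>\<^bsub>A\<^esub> m) \<otimes>\<^bsub>A\<^esub> (n \<otimes>\<^bsub>A\<^esub> z)"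
      using m by (intro nucleus_assoc_2[OF mn(2)])
    also have "\<dots> = y \<otimes>\<^bsub>A\<^esub> (m \<otimes>\<^bsub>A\<^esub> (n \<otimes>\<^bsub>A\<^esub> z))"
      using m by (intro nucleus_assoc_2[OF mn(1)])
    also have "\<dots> = y \<otimes>\<^bsub>A\<^esub> ((m \<otimes>\<^bsub>A\<^esub> n) \<otimes>\<^bsub>A\<^esub> z)"
      by (simp add: m nucleus_assoc_1[OF mn(1)])
    finally show "(y \<otimes>\<^bsub>A\<^esub> (m \<otimes>\<^bsub>A\<^esub> n)) \<otimes>\<^bsub>A\<^esub> z = y \<otimes>\<^bsub>A\<^esub> ((m \<otimes>\<^bsub>A\<^esub> n) \<otimes>\<^bsub>A\<^esub> z)" .
    have "(y \<otimes>\<^bsub>A\<^esub> z) \<otimes>\<^bsub>A\<^esub> (m \<otimes>\<^bsub>A\<^esub> n) = ((y \<otimes>\<^bsub>A\<^esub> z) \<otimes>\<^bsub>A\<^esub> m) \<otimes>\<^bsub>A\<^esub> n"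
      by (simp add: m nucleus_assoc_2[OF mn(1)])
    also have "\<dots> = (y \<otimes>\<^bsub>A\<^esub> (z \<otimes>\<^bsub>A\<^esub> m)) \<otimes>\<^bsub>A\<^esub> n"
      by (simp add: m nucleus_assoc_3[OF mn(1)])
    also have "\<dots> = y \<otimes>\<^bsub>A\<^esub> ((z \<otimes>\<^bsub>A\<^esub> m) \<otimes>\<^bsub>A\<^esub> n)"
      using m by (intro nucleus_assoc_3[OF mn(2)])
    also have "\<dots> = y \<otimes>\<^bsub>A\<^esub> (z \<otimes>\<^bsub>A\<^esub> (m \<otimes>\<^bsub>A\<^esub> n))"
      by (simp add: m nucleus_assoc_2[OF mn(1)])
    finally show "(y \<otimes>\<^bsub>A\<^esub> z) \<otimes>\<^bsub>A\<^esub> (m \<otimes>\<^bsub>A\<^esub> n) = y \<otimes>\<^bsub>A\<^esub> (z \<otimes>\<^bsub>A\<^esub> (m \<otimes>\<^bsub>A\<^esub> n))" .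
  qed
  moreover have "((m \<otimes>\<^bsub>A\<^esub> n) \<otimes>\<^bsub>A\<^esub> y) \<otimes>\<^bsub>A\<^esub> z = (m \<otimes>\<^bsub>A\<^esub> n) \<otimes>\<^bsub>A\<^esub> (y \<otimes>\<^bsub>A\<^esub> z)"
    if "y \<in> carrier A" "z \<in> carrier A" for y z
    by (simp add: mult_closed that c nucleus_assoc_1[OF mn(1)] nucleus_assoc_1[OF mn(2)])
  moreover have "m \<otimes>\<^bsub>A\<^esub> n \<in> carrier A"
    using c by (rule mult_closed)
  ultimately show ?thesis
    unfolding nucleus_iff by blast
qed

lemma nucleus_commutator: "\<lbrakk>m \<in> nucleus A; n \<in> nucleus A\<rbrakk> \<Longrightarrow> commutator A m n \<in> nucleus A"
  by (simp add: commutator_def a_minus_def nucleus_add nucleus_mult nucleus_neg)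

end

section \<open>Associators and nuclear elements in alternative algebras\<close>

locale plain_alternative_algebra = alternative_algebra K A + plain_algebra K A
  for K :: "('f, 'k) ring_scheme" (structure) and A :: "('f, 'a) module" (structure)
begin

text \<open>Linearization of the left alternative law: expand (x + y, x + y, z) = 0.\<close>

lemma associator_swap_1:
  assumes "x \<in> carrier A" "y \<in> carrier A" "z \<in> carrier A"
  shows "associator A y x z = \<ominus>\<^bsub>A\<^esub> associator A x y z"
proof -
  have "\<zero>\<^bsub>A\<^esub> = associator A (x \<oplus>\<^bsub>A\<^esub> y) (x \<oplus>\<^bsub>A\<^esub> y) z"
    using assms left_alternative by simp
  also have "\<dots> = associator A x (x \<oplus>\<^bsub>A\<^esub> y) z \<oplus>\<^bsub>A\<^esub> associator A y (x \<oplus>\<^bsub>A\<^esub> y) z"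
    using assms by (intro associator_add_1) simp_all
  also have "\<dots> = associator A y x z \<oplus>\<^bsub>A\<^esub> associator A x y z"
    using assms
    by (simp add: associator_add_2 associator_closed left_alternative M.a_comm)
  finally have "associator A y x z \<oplus>\<^bsub>A\<^esub> associator A x y z = \<zero>\<^bsub>A\<^esub>"
    by (rule sym)
  then show ?thesis
    using assms by (metis M.minus_equality associator_closed)
qed

text \<open>Linearization of the right alternative law: expand (x, y + z, y + z) = 0.\<close>

lemma associator_swap_2:
  assumes "x \<in> carrier A" "y \<in> carrier A" "z \<in> carrier A"
  shows "associator A x z y = \<ominus>\<^bsub>A\<^esub> associator A x y z"
proof -
  have "\<zero>\<^bsub>A\<^esub> = associator A x (y \<oplus>\<^bsub>A\<^esub> z) (y \<oplus>\<^bsub>A\<^esub> z)"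
    using assms right_alternative by simp
  also have "\<dots> = associator A x y (y \<oplus>\<^bsub>A\<^esub> z) \<oplus>\<^bsub>A\<^esub> associator A x z (y \<oplus>\<^bsub>A\<^esub> z)"
    using assms by (intro associator_add_2) simp_all
  also have "\<dots> = associator A x z y \<oplus>\<^bsub>A\<^esub> associator A x y z"
    using assms
    by (simp add: associator_add_3 associator_closed right_alternative M.a_comm)
  finally have "associator A x z y \<oplus>\<^bsub>A\<^esub> associator A x y z = \<zero>\<^bsub>A\<^esub>"
    by (rule sym)
  then show ?thesis
    using assms by (metis M.minus_equality associator_closed)
qed

lemma associator_cyclic:
  assumes "x \<in> carrier A" "y \<in> carrier A" "z \<in> carrier A"
  shows "associator A z x y = associator A x y z"
  using assms associator_swap_1[of x z y] associator_swap_2[of x y z] associator_closed by simp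

text \<open>By skew symmetry an associator with n in the second or third place is, up to sign, one
  with n in the first place.\<close>

lemma nucleusI:
  assumes "n \<in> carrier A"
    and "\<And>y z. \<lbrakk>y \<in> carrier A; z \<in> carrier A\<rbrakk> \<Longrightarrow> associator A n y z = \<zero>\<^bsub>A\<^esub>"
  shows "n \<in> nucleus A"
proof -
  have "associator A y n z = \<zero>\<^bsub>A\<^esub>" "associator A y z n = \<zero>\<^bsub>A\<^esub>"
    if "y \<in> carrier A" "z \<in> carrier A" for y z
    by (simp_all only: associator_swap_1[OF assms(1) that] associator_cyclic[OF that assms(1), symmetric]
        assms(2)[OF that] M_minus_zero)
  then show ?thesis
    using assms by (simp add: nucleus_def)
qed

lemma associator_mult_nucleus_left:
  assumes "n \<in> nucleus A" "x \<in> carrier A" "y \<in> carrier A" "z \<in> carrier A"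
  shows "associator A (n \<otimes>\<^bsub>A\<^esub> x) y z = n \<otimes>\<^bsub>A\<^esub> associator A x y z"
  using assms
  by (simp add: associator_def a_minus_def mult_closed nucleus_assoc nucleus_closed mult_r_distr
      mult_neg_right)

lemma associator_mult_nucleus_right:
  assumes "n \<in> nucleus A" "x \<in> carrier A" "y \<in> carrier A" "z \<in> carrier A"
  shows "associator A x y (z \<otimes>\<^bsub>A\<^esub> n) = associator A x y z \<otimes>\<^bsub>A\<^esub> n"
  using assms
  by (simp add: associator_def a_minus_def mult_closed nucleus_assoc_3[symmetric] nucleus_closed
      mult_l_distr mult_neg_left)

text \<open>Since n is nuclear, (x n, y, z) = (x, n y, z). Skew symmetry brings n y to the front,
  where n comes out on the left; swapping back cancels the sign.\<close>

lemma associator_mult_nucleus_middle: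
  assumes "n \<in> nucleus A" "x \<in> carrier A" "y \<in> carrier A" "z \<in> carrier A"
  shows "associator A (x \<otimes>\<^bsub>A\<^esub> n) y z = n \<otimes>\<^bsub>A\<^esub> associator A x y z"
proof -
  have n: "n \<in> carrier A"
    using assms nucleus_closed by blast
  have "associator A (x \<otimes>\<^bsub>A\<^esub> n) y z = associator A x (n \<otimes>\<^bsub>A\<^esub> y) z"
    using assms by (simp add: associator_def mult_closed nucleus_assoc nucleus_closed)
  also have "\<dots> = \<ominus>\<^bsub>A\<^esub> (n \<otimes>\<^bsub>A\<^esub> associator A y x z)"
    using assms n
    by (subst associator_swap_1) (simp_all add: mult_closed associator_mult_nucleus_left)
  also have "\<dots> = n \<otimes>\<^bsub>A\<^esub> associator A x y z"
    using assms n associator_swap_1[of x y z] by (simp add: mult_neg_right associator_closed mult_closed)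
  finally show ?thesis .
qed

text \<open>The element n leaves (x, y, z n) on the right; rotating the arguments to (z n, x, y)
  lets it leave on the left.\<close>

lemma associator_commute_nucleus:
  assumes "n \<in> nucleus A" "x \<in> carrier A" "y \<in> carrier A" "z \<in> carrier A"
  shows "associator A x y z \<otimes>\<^bsub>A\<^esub> n = n \<otimes>\<^bsub>A\<^esub> associator A x y z"
proof -
  have "associator A x y z \<otimes>\<^bsub>A\<^esub> n = associator A (z \<otimes>\<^bsub>A\<^esub> n) x y"
    using assms associator_cyclic[of x y "z \<otimes>\<^bsub>A\<^esub> n"]
    by (simp add: associator_mult_nucleus_right mult_closed nucleus_closed)
  also have "\<dots> = n \<otimes>\<^bsub>A\<^esub> associator A x y z"
    using assms associator_cyclic[of x y z] by (simp add: associator_mult_nucleus_middle)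
  finally show ?thesis .
qed

text \<open>
  \<open>(u n, y, z) = n (u, y, z)\<close> for nuclear \<open>n\<close>, and associators commute with nuclear elements, so
  commutators of nuclear elements annihilate associators.
\<close>

lemma mult_commutator_in_nucleus:
  assumes u: "u \<in> carrier A" and m: "m \<in> nucleus A" and n: "n \<in> nucleus A"
  shows "u \<otimes>\<^bsub>A\<^esub> commutator A m n \<in> nucleus A"
proof (rule nucleusI)
  note nc = nucleus_closed[OF m] nucleus_closed[OF n]
  have c: "commutator A m n \<in> nucleus A"
    using m n by (rule nucleus_commutator)
  then show "u \<otimes>\<^bsub>A\<^esub> commutator A m n \<in> carrier A"
    using u by (simp add: mult_closed nucleus_closed)
  fix y z assume yz: "y \<in> carrier A" "z \<in> carrier A"
  let ?a = "associator A u y z"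
  have a: "?a \<in> carrier A"
    using u yz by (rule associator_closed)
  have "(m \<otimes>\<^bsub>A\<^esub> n) \<otimes>\<^bsub>A\<^esub> ?a = m \<otimes>\<^bsub>A\<^esub> associator A (n \<otimes>\<^bsub>A\<^esub> u) y z"
    using a u yz m n nc by (simp add: associator_mult_nucleus_left nucleus_assoc)
  also have "\<dots> = (n \<otimes>\<^bsub>A\<^esub> ?a) \<otimes>\<^bsub>A\<^esub> m"
    using u yz m n nc associator_commute_nucleus[OF m, of "n \<otimes>\<^bsub>A\<^esub> u" y z]
    by (simp add: mult_closed associator_mult_nucleus_left)
  also have "\<dots> = (n \<otimes>\<^bsub>A\<^esub> m) \<otimes>\<^bsub>A\<^esub> ?a"
    using a u yz m n nc by (simp add: nucleus_assoc associator_commute_nucleus)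
  finally have "commutator A m n \<otimes>\<^bsub>A\<^esub> ?a = \<zero>\<^bsub>A\<^esub>"
    using a m n nc
    by (simp add: commutator_def a_minus_def mult_l_distr mult_neg_left mult_closed M.r_neg)
  then show "associator A (u \<otimes>\<^bsub>A\<^esub> commutator A m n) y z = \<zero>\<^bsub>A\<^esub>"
    using associator_mult_nucleus_middle[OF c u yz] by simp
qed

end

text \<open>Products instead of associators: products of cosets are computed directly, which makes
  this form convenient for quotient algebras.\<close>

lemma alternative_algebraI:
  fixes K (structure) and A (structure)
  assumes "nonassoc_algebra K A"
    and "\<And>x y. \<lbrakk>x \<in> carrier A; y \<in> carrier A\<rbrakk>
      \<Longrightarrow> (x \<otimes>\<^bsub>A\<^esub> x) \<otimes>\<^bsub>A\<^esub> y = x \<otimes>\<^bsub>A\<^esub> (x \<otimes>\<^bsub>A\<^esub> y)"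
    and "\<And>x y. \<lbrakk>x \<in> carrier A; y \<in> carrier A\<rbrakk>
      \<Longrightarrow> (y \<otimes>\<^bsub>A\<^esub> x) \<otimes>\<^bsub>A\<^esub> x = y \<otimes>\<^bsub>A\<^esub> (x \<otimes>\<^bsub>A\<^esub> x)"
  shows "alternative_algebra K A"
proof -
  interpret nonassoc_algebra K A by fact
  show ?thesis
    by unfold_locales (simp_all add: associator_eq_zero_iff assms)
qed

lemma (in alternative_algebra) alternative_laws:
  assumes "x \<in> carrier A" "y \<in> carrier A"
  shows "(x \<otimes>\<^bsub>A\<^esub> x) \<otimes>\<^bsub>A\<^esub> y = x \<otimes>\<^bsub>A\<^esub> (x \<otimes>\<^bsub>A\<^esub> y)"
    and "(y \<otimes>\<^bsub>A\<^esub> x) \<otimes>\<^bsub>A\<^esub> x = y \<otimes>\<^bsub>A\<^esub> (x \<otimes>\<^bsub>A\<^esub> x)"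
  using assms left_alternative right_alternative by (simp_all flip: associator_eq_zero_iff)

text \<open>\<open>subalgebra_of\<close> does not mention negatives; they agree because additive
  inverses are unique.\<close>

lemma subalgebra_of_minus:
  assumes "subalgebra_of K S A" "x \<in> carrier S" "y \<in> carrier S"
  shows "x \<ominus>\<^bsub>S\<^esub> y = x \<ominus>\<^bsub>A\<^esub> y"
proof -
  interpret S: nonassoc_algebra K S using assms by (simp add: subalgebra_of_def)
  interpret A: nonassoc_algebra K A using assms by (simp add: subalgebra_of_def)
  have "\<ominus>\<^bsub>S\<^esub> y \<oplus>\<^bsub>A\<^esub> y = \<ominus>\<^bsub>S\<^esub> y \<oplus>\<^bsub>S\<^esub> y"
    using assms by (simp add: subalgebra_of_def)
  also have "\<dots> = \<zero>\<^bsub>A\<^esub>"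
    using assms S.M.l_neg by (simp add: subalgebra_of_def)
  finally have "\<ominus>\<^bsub>A\<^esub> y = \<ominus>\<^bsub>S\<^esub> y"
    using assms by (intro A.M.minus_equality) (auto simp: subalgebra_of_def)
  then show ?thesis
    using assms by (simp add: a_minus_def subalgebra_of_def)
qed

lemma subalgebra_of_associator:
  assumes "subalgebra_of K S A" "x \<in> carrier S" "y \<in> carrier S" "z \<in> carrier S"
  shows "associator S x y z = associator A x y z"
proof -
  interpret S: nonassoc_algebra K S using assms by (simp add: subalgebra_of_def)
  have eq: "u \<otimes>\<^bsub>A\<^esub> v = u \<otimes>\<^bsub>S\<^esub> v" if "u \<in> carrier S" "v \<in> carrier S" for u v
    using assms that by (simp add: subalgebra_of_def)
  show ?thesis
    unfolding associator_def
    by (simp add: eq assms S.mult_closed subalgebra_of_minus[OF assms(1)])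
qed

lemma subalgebra_of_alternative:
  assumes "subalgebra_of K S A" "alternative_algebra K A"
  shows "alternative_algebra K S"
proof -
  interpret S: nonassoc_algebra K S using assms by (simp add: subalgebra_of_def)
  have sub: "carrier S \<subseteq> carrier A" and zero: "\<zero>\<^bsub>S\<^esub> = \<zero>\<^bsub>A\<^esub>"
    using assms(1) by (simp_all add: subalgebra_of_def)
  show ?thesis
  proof
    fix x y assume x: "x \<in> carrier S" and y: "y \<in> carrier S"
    then have "x \<in> carrier A" "y \<in> carrier A"
      using sub by auto
    then show "associator S x x y = \<zero>\<^bsub>S\<^esub>" "associator S y x x = \<zero>\<^bsub>S\<^esub>"
      unfolding zero
      using x y assms alternative_algebra.left_alternative[OF assms(2)]
        alternative_algebra.right_alternative[OF assms(2)]
      by (simp_all only: subalgebra_of_associator[OF assms(1)])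
  qed
qed

text \<open>In the subalgebra there are fewer associators to check. The converse, that nuclear
  elements of the subalgebra stay nuclear, is not automatic and is a separate clause of
  \<open>right_quotient_algebra\<close>.\<close>

lemma nucleus_subalgebra:
  assumes "subalgebra_of K S A" "n \<in> nucleus A" "n \<in> carrier S"
  shows "n \<in> nucleus S"
proof -
  have sub: "carrier S \<subseteq> carrier A" and zero: "\<zero>\<^bsub>S\<^esub> = \<zero>\<^bsub>A\<^esub>"
    using assms(1) by (simp_all add: subalgebra_of_def)
  then show ?thesis
    using assms(2,3) by (auto simp: nucleus_def subalgebra_of_associator[OF assms(1)] subset_iff)
qed

lemma (in plain_algebra) subalgebra_restrict:
  assumes "submodule S K A"
    and "\<And>x y. \<lbrakk>x \<in> S; y \<in> S\<rbrakk> \<Longrightarrow> x \<otimes>\<^bsub>A\<^esub> y \<in> S"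
  shows "subalgebra_of K (A\<lparr>carrier := S\<rparr>) A"
proof -
  interpret S: module K "A\<lparr>carrier := S\<rparr>"
    using assms(1) by (rule submodule.submodule_is_module) (rule module_axioms)
  have sub: "S \<subseteq> carrier A"
    using assms(1) by (rule submoduleE)
  have "nonassoc_algebra K (A\<lparr>carrier := S\<rparr>)"
    by unfold_locales
      (use sub in \<open>auto simp: assms(2) mult_l_distr mult_r_distr smult_mult_l smult_mult_r subset_iff\<close>)
  then show ?thesis
    using sub nonassoc_algebra_axioms by (auto simp: subalgebra_of_def)
qed

section \<open>Quotients of nonassociative algebras by ideals\<close>

locale algebra_quotient = plain_algebra +
  fixes I
  assumes ideal: "algebra_ideal K A I"
begin

text \<open>Coset arithmetic needs only the additive group. Products are treated separately below,
  because \<open>A\<close> need be neither associative nor unital.\<close>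

sublocale I: abelian_subgroup I A
  using ideal submodule.axioms(1) M.abelian_group_axioms
  by (intro abelian_subgroupI3 additive_subgroupI) (auto simp: algebra_ideal_def)

lemma ideal_subset: "I \<subseteq> carrier A"
  by (rule I.a_subset)

lemma ideal_mult_left: "\<lbrakk>x \<in> carrier A; y \<in> I\<rbrakk> \<Longrightarrow> x \<otimes>\<^bsub>A\<^esub> y \<in> I"
  and ideal_mult_right: "\<lbrakk>x \<in> carrier A; y \<in> I\<rbrakk> \<Longrightarrow> y \<otimes>\<^bsub>A\<^esub> x \<in> I"
  using ideal by (simp_all add: algebra_ideal_def)

lemma ideal_smult: "\<lbrakk>c \<in> carrier K; y \<in> I\<rbrakk> \<Longrightarrow> c \<odot>\<^bsub>A\<^esub> y \<in> I"
  using ideal submodule.smult_closed by (fastforce simp: algebra_ideal_def)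

lemma coset_eq_iff:
  "\<lbrakk>x \<in> carrier A; y \<in> carrier A\<rbrakk> \<Longrightarrow> I +>\<^bsub>A\<^esub> x = I +>\<^bsub>A\<^esub> y \<longleftrightarrow> x \<ominus>\<^bsub>A\<^esub> y \<in> I"
  using I.a_rcos_module[of y x] I.a_rcos_self[of x]
    M.a_repr_independence[OF _ _ I.a_subgroup, of x y]
  by (auto simp: a_minus_def)

end

context algebra_quotient
begin

lemma coset_add_absorb:
  "\<lbrakk>h \<in> I; x \<in> carrier A\<rbrakk> \<Longrightarrow> I +>\<^bsub>A\<^esub> (h \<oplus>\<^bsub>A\<^esub> x) = I +>\<^bsub>A\<^esub> x"
  using M.a_repr_independence[OF M.a_rcosI[OF _ ideal_subset] _ I.a_subgroup] by metis

lemma coset_memE: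
  assumes "y \<in> I +>\<^bsub>A\<^esub> x"
  obtains h where "h \<in> I" "y = h \<oplus>\<^bsub>A\<^esub> x"
  using assms by (auto simp: a_r_coset_def')

lemma coset_zero_iff: "x \<in> carrier A \<Longrightarrow> I +>\<^bsub>A\<^esub> x = I \<longleftrightarrow> x \<in> I"
  by (metis I.a_subgroup M.a_coset_join1 M.a_coset_join2)

lemma quotient_carrier: "carrier (quotient_algebra A I) = (\<lambda>x. I +>\<^bsub>A\<^esub> x) ` carrier A"
  by (auto simp: quotient_algebra_def FactRing_def A_RCOSETS_def')

lemma quotient_zero: "\<zero>\<^bsub>quotient_algebra A I\<^esub> = I"
  by (simp add: quotient_algebra_def FactRing_def)

lemma quotient_add:
  "\<lbrakk>x \<in> carrier A; y \<in> carrier A\<rbrakk>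
    \<Longrightarrow> (I +>\<^bsub>A\<^esub> x) \<oplus>\<^bsub>quotient_algebra A I\<^esub> (I +>\<^bsub>A\<^esub> y) = I +>\<^bsub>A\<^esub> (x \<oplus>\<^bsub>A\<^esub> y)"
  by (simp add: quotient_algebra_def FactRing_def I.a_rcos_sum)

text \<open>The coset product is a union over representatives a = h + x and b = k + y. It collapses
  because a b differs from x y by h b + x k, which lies in \<open>I\<close>.\<close>

lemma quotient_mult:
  assumes "x \<in> carrier A" "y \<in> carrier A"
  shows "(I +>\<^bsub>A\<^esub> x) \<otimes>\<^bsub>quotient_algebra A I\<^esub> (I +>\<^bsub>A\<^esub> y) = I +>\<^bsub>A\<^esub> (x \<otimes>\<^bsub>A\<^esub> y)"
proof -
  have "I +>\<^bsub>A\<^esub> (a \<otimes>\<^bsub>A\<^esub> b) = I +>\<^bsub>A\<^esub> (x \<otimes>\<^bsub>A\<^esub> y)"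
    if ab: "a \<in> I +>\<^bsub>A\<^esub> x" "b \<in> I +>\<^bsub>A\<^esub> y" for a b
  proof -
    obtain h where h: "h \<in> I" "a = h \<oplus>\<^bsub>A\<^esub> x" using ab(1) by (rule coset_memE)
    obtain k where k: "k \<in> I" "b = k \<oplus>\<^bsub>A\<^esub> y" using ab(2) by (rule coset_memE)
    have carr: "h \<in> carrier A" "k \<in> carrier A" using h k ideal_subset by auto
    have "a \<otimes>\<^bsub>A\<^esub> b = (h \<otimes>\<^bsub>A\<^esub> b \<oplus>\<^bsub>A\<^esub> x \<otimes>\<^bsub>A\<^esub> k) \<oplus>\<^bsub>A\<^esub> x \<otimes>\<^bsub>A\<^esub> y"
      using assms carr h k by (simp add: mult_l_distr mult_r_distr mult_closed M.a_ac)
    moreover have "h \<otimes>\<^bsub>A\<^esub> b \<oplus>\<^bsub>A\<^esub> x \<otimes>\<^bsub>A\<^esub> k \<in> I"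
      using assms carr h k by (simp add: ideal_mult_left ideal_mult_right)
    ultimately show ?thesis
      using assms by (simp add: coset_add_absorb mult_closed)
  qed
  then have "(\<Union>a\<in>I +>\<^bsub>A\<^esub> x. \<Union>b\<in>I +>\<^bsub>A\<^esub> y. I +>\<^bsub>A\<^esub> (a \<otimes>\<^bsub>A\<^esub> b))
      = (\<Union>a\<in>I +>\<^bsub>A\<^esub> x. \<Union>b\<in>I +>\<^bsub>A\<^esub> y. I +>\<^bsub>A\<^esub> (x \<otimes>\<^bsub>A\<^esub> y))"
    by (intro SUP_cong refl)
  also have "\<dots> = I +>\<^bsub>A\<^esub> (x \<otimes>\<^bsub>A\<^esub> y)"
    using I.a_rcos_self[OF assms(1)] I.a_rcos_self[OF assms(2)] by auto
  finally show ?thesis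
    by (simp add: quotient_algebra_def FactRing_def rcoset_mult_def)
qed

lemma quotient_smult:
  assumes "c \<in> carrier K" "x \<in> carrier A"
  shows "c \<odot>\<^bsub>quotient_algebra A I\<^esub> (I +>\<^bsub>A\<^esub> x) = I +>\<^bsub>A\<^esub> (c \<odot>\<^bsub>A\<^esub> x)"
proof -
  have "I +>\<^bsub>A\<^esub> (c \<odot>\<^bsub>A\<^esub> a) = I +>\<^bsub>A\<^esub> (c \<odot>\<^bsub>A\<^esub> x)" if a: "a \<in> I +>\<^bsub>A\<^esub> x" for a
  proof -
    obtain h where h: "h \<in> I" "a = h \<oplus>\<^bsub>A\<^esub> x" using a by (rule coset_memE)
    then show ?thesis
      using assms ideal_subset by (simp add: subset_iff smult_r_distr ideal_smult coset_add_absorb)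
  qed
  then have "(\<Union>a\<in>I +>\<^bsub>A\<^esub> x. I +>\<^bsub>A\<^esub> (c \<odot>\<^bsub>A\<^esub> a)) = (\<Union>a\<in>I +>\<^bsub>A\<^esub> x. I +>\<^bsub>A\<^esub> (c \<odot>\<^bsub>A\<^esub> x))"
    by (intro SUP_cong refl)
  also have "\<dots> = I +>\<^bsub>A\<^esub> (c \<odot>\<^bsub>A\<^esub> x)"
    using I.a_rcos_self[OF assms(2)] by auto
  finally show ?thesis
    by (simp add: quotient_algebra_def)
qed

lemmas quotient_ops = quotient_add quotient_mult quotient_smult

lemma quotient_nonassoc_algebra: "nonassoc_algebra K (quotient_algebra A I)"
proof -
  let ?B = "quotient_algebra A I"
  have zero: "\<zero>\<^bsub>?B\<^esub> = I +>\<^bsub>A\<^esub> \<zero>\<^bsub>A\<^esub>"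
    by (simp add: quotient_zero ideal_subset)
  have ab: "abelian_group ?B"
  proof (rule abelian_groupI)
    fix X assume "X \<in> carrier ?B"
    then obtain x where x: "x \<in> carrier A" "X = I +>\<^bsub>A\<^esub> x" by (auto simp: quotient_carrier)
    have "(I +>\<^bsub>A\<^esub> (\<ominus>\<^bsub>A\<^esub> x)) \<oplus>\<^bsub>?B\<^esub> X = \<zero>\<^bsub>?B\<^esub>"
      using x by (simp add: zero quotient_add M.l_neg)
    then show "\<exists>Y\<in>carrier ?B. Y \<oplus>\<^bsub>?B\<^esub> X = \<zero>\<^bsub>?B\<^esub>"
      using x(1) by (auto simp: quotient_carrier)
  qed (auto simp: quotient_carrier quotient_add zero M.a_ac)
  interpret B: abelian_group ?B by (rule ab)
  show ?thesis
    by unfold_locales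
      (auto simp: quotient_carrier quotient_ops mult_closed mult_l_distr mult_r_distr
        smult_mult_l smult_mult_r smult_l_distr smult_r_distr smult_assoc1)
qed

lemma quotient_alternative_algebra:
  assumes "alternative_algebra K A"
  shows "alternative_algebra K (quotient_algebra A I)"
proof (rule alternative_algebraI[OF quotient_nonassoc_algebra])
  fix X Y assume "X \<in> carrier (quotient_algebra A I)" "Y \<in> carrier (quotient_algebra A I)"
  then obtain x y where x: "x \<in> carrier A" and X: "X = I +>\<^bsub>A\<^esub> x"
    and y: "y \<in> carrier A" and Y: "Y = I +>\<^bsub>A\<^esub> y"
    unfolding quotient_carrier by blast
  note laws = alternative_algebra.alternative_laws[OF assms x y]
  show "(X \<otimes>\<^bsub>quotient_algebra A I\<^esub> X) \<otimes>\<^bsub>quotient_algebra A I\<^esub> Y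
      = X \<otimes>\<^bsub>quotient_algebra A I\<^esub> (X \<otimes>\<^bsub>quotient_algebra A I\<^esub> Y)"
    unfolding X Y using x y by (simp only: quotient_mult mult_closed laws)
  show "(Y \<otimes>\<^bsub>quotient_algebra A I\<^esub> X) \<otimes>\<^bsub>quotient_algebra A I\<^esub> X
      = Y \<otimes>\<^bsub>quotient_algebra A I\<^esub> (X \<otimes>\<^bsub>quotient_algebra A I\<^esub> X)"
    unfolding X Y using x y by (simp only: quotient_mult mult_closed laws)
qed

end

section \<open>Idempotents and dense orthogonal sets\<close>

context cring
begin

lemma idempotents_closed: "e \<in> idempotents R \<Longrightarrow> e \<in> carrier R"
  by (simp add: idempotents_def)

lemma idempotents_idem: "e \<in> idempotents R \<Longrightarrow> e \<otimes> e = e"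
  by (simp add: idempotents_def)

lemma idempotents_zero: "\<zero> \<in> idempotents R"
  by (simp add: idempotents_def)

lemma idempotents_one: "\<one> \<in> idempotents R"
  by (simp add: idempotents_def)

lemma idempotents_mult:
  assumes "e \<in> idempotents R" "f \<in> idempotents R"
  shows "e \<otimes> f \<in> idempotents R"
proof -
  note c = assms[THEN idempotents_closed]
  have "e \<otimes> f \<otimes> (e \<otimes> f) = (e \<otimes> e) \<otimes> (f \<otimes> f)"
    using c by (simp add: m_ac)
  then show ?thesis
    using c assms[THEN idempotents_idem] by (simp add: idempotents_def)
qed

lemma idempotents_complement:
  assumes "e \<in> idempotents R"
  shows "\<one> \<ominus> e \<in> idempotents R" "(\<one> \<ominus> e) \<otimes> e = \<zero>" "e \<otimes> (\<one> \<ominus> e) = \<zero>"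
proof -
  have e: "e \<in> carrier R" "e \<otimes> e = e"
    using assms by (simp_all add: idempotents_def)
  then show "(\<one> \<ominus> e) \<otimes> e = \<zero>" "e \<otimes> (\<one> \<ominus> e) = \<zero>"
    by (simp_all add: a_minus_def l_distr r_distr l_minus r_minus r_neg)
  then have "(\<one> \<ominus> e) \<otimes> (\<one> \<ominus> e) = \<one> \<ominus> e"
    using e by (simp add: a_minus_def[of R \<one> e] r_distr r_minus)
  then show "\<one> \<ominus> e \<in> idempotents R"
    using e by (simp add: idempotents_def)
qed

lemma complement_absorb:
  assumes "e \<in> carrier R" "b \<in> carrier R" "(\<one> \<ominus> b) \<otimes> e = \<zero>"
  shows "b \<otimes> e = e"
  using assms by (simp add: a_minus_def l_distr l_minus) (metis m_closed add.inv_closed minus_equality add.inv_inv)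

end

lemma (in cring) dense_orthogonal_one: "dense_orthogonal R {\<one>}"
  by (simp add: dense_orthogonal_def idempotents_one idempotents_closed)

text \<open>Distinct products differ in the first factor, or share it and differ in the second;
  either way a zero product appears. Density is used twice: if b kills all d e, then b d is
  orthogonal to \<open>E d\<close> and hence 0 for every d, so b = 0. The set \<open>E d\<close> may
  vary with d, as is needed to glue elements that come with their own dense sets.\<close>

lemma (in cring) dense_orthogonal_refine:
  assumes D: "dense_orthogonal R D" and E: "\<And>d. d \<in> D \<Longrightarrow> dense_orthogonal R (E d)"
  shows "dense_orthogonal R {d \<otimes> e | d e. d \<in> D \<and> e \<in> E d}"
  unfolding dense_orthogonal_def
proof (intro conjI ballI impI subsetI)
  have idD: "d \<in> idempotents R" if "d \<in> D" for d
    using D that by (auto simp: dense_orthogonal_def)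
  have idE: "e \<in> idempotents R" if "d \<in> D" "e \<in> E d" for d e
    using E[OF that(1)] that(2) by (auto simp: dense_orthogonal_def)
  note carr = idempotents_closed[OF idD] idempotents_closed[OF idE]
  show "x \<in> idempotents R" if "x \<in> {d \<otimes> e | d e. d \<in> D \<and> e \<in> E d}" for x
    using that by (auto intro: idempotents_mult idD idE)
  show "x \<otimes> y = \<zero>"
    if x: "x \<in> {d \<otimes> e | d e. d \<in> D \<and> e \<in> E d}" and y: "y \<in> {d \<otimes> e | d e. d \<in> D \<and> e \<in> E d}"
      and neq: "x \<noteq> y" for x y
  proof -
    obtain d e where de: "d \<in> D" "e \<in> E d" "x = d \<otimes> e" using x by blast
    obtain d' e' where de': "d' \<in> D" "e' \<in> E d'" "y = d' \<otimes> e'" using y by blast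
    have c: "d \<in> carrier R" "d' \<in> carrier R" "e \<in> carrier R" "e' \<in> carrier R"
      using carr de(1,2) de'(1,2) by auto
    then have xy: "x \<otimes> y = (d \<otimes> d') \<otimes> (e \<otimes> e')"
      using de de' by (simp add: m_ac)
    have "d \<otimes> d' = \<zero> \<or> e \<otimes> e' = \<zero>"
    proof (cases "d = d'")
      case True
      then have "e \<noteq> e'" using de de' neq by auto
      then show ?thesis using E[OF de(1)] True de de' by (auto simp: dense_orthogonal_def)
    next
      case False
      then show ?thesis using D de de' by (auto simp: dense_orthogonal_def)
    qed
    then show ?thesis using xy c by auto
  qed
  show "b = \<zero>"
    if b: "b \<in> idempotents R" and ann: "\<forall>x\<in>{d \<otimes> e | d e. d \<in> D \<and> e \<in> E d}. b \<otimes> x = \<zero>" for b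
  proof -
    have "b \<otimes> d = \<zero>" if d: "d \<in> D" for d
    proof -
      have "(b \<otimes> d) \<otimes> e = \<zero>" if e: "e \<in> E d" for e
      proof -
        have "b \<otimes> (d \<otimes> e) = \<zero>" using ann d e by blast
        then show ?thesis using b carr d e by (simp add: m_assoc idempotents_closed)
      qed
      moreover have "b \<otimes> d \<in> idempotents R" using b idD d by (simp add: idempotents_mult)
      ultimately show ?thesis using E[OF d] by (simp add: dense_orthogonal_def)
    qed
    then show ?thesis using D b by (simp add: dense_orthogonal_def)
  qed
qed

text \<open>A maximal orthogonal subset of \<open>T\<close> exists by Zorn. If b \<noteq> 0 were
  orthogonal to it, a nonzero d in \<open>T\<close> below b would be orthogonal to it too;
  maximality would put d into the subset, and then d = b d = 0.\<close>

lemma (in cring) obtain_dense_orthogonal: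
  assumes T: "T \<subseteq> idempotents R"
    and dense: "\<And>b. \<lbrakk>b \<in> idempotents R; b \<noteq> \<zero>\<rbrakk> \<Longrightarrow> \<exists>d\<in>T. d \<noteq> \<zero> \<and> b \<otimes> d = d"
  obtains D where "D \<subseteq> T" "dense_orthogonal R D"
proof -
  define \<A> where "\<A> = {D. D \<subseteq> T \<and> (\<forall>x\<in>D. \<forall>y\<in>D. x \<noteq> y \<longrightarrow> x \<otimes> y = \<zero>)}"
  have "\<exists>M\<in>\<A>. \<forall>X\<in>\<A>. M \<subseteq> X \<longrightarrow> X = M"
  proof (rule subset_Zorn')
    fix \<C> assume ch: "subset.chain \<A> \<C>"
    then have sub: "\<C> \<subseteq> \<A>" and tot: "\<And>X Y. \<lbrakk>X \<in> \<C>; Y \<in> \<C>\<rbrakk> \<Longrightarrow> X \<subseteq> Y \<or> Y \<subseteq> X"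
      by (auto simp: subset_chain_def)
    have "x \<otimes> y = \<zero>" if xy: "x \<in> \<Union>\<C>" "y \<in> \<Union>\<C>" and "x \<noteq> y" for x y
    proof -
      obtain X Y where XY: "X \<in> \<C>" "Y \<in> \<C>" "x \<in> X" "y \<in> Y" using xy by blast
      then obtain Z where "Z \<in> \<C>" "x \<in> Z" "y \<in> Z" using tot[of X Y] by blast
      then show ?thesis using sub \<open>x \<noteq> y\<close> by (auto simp: \<A>_def)
    qed
    then show "\<Union>\<C> \<in> \<A>" using sub by (auto simp: \<A>_def)
  qed
  then obtain D where D: "D \<in> \<A>" and max: "\<And>X. \<lbrakk>X \<in> \<A>; D \<subseteq> X\<rbrakk> \<Longrightarrow> X = D" by blast
  have "b = \<zero>" if b: "b \<in> idempotents R" and ann: "\<forall>x\<in>D. b \<otimes> x = \<zero>" for b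
  proof (rule ccontr)
    assume "b \<noteq> \<zero>"
    then obtain d where d: "d \<in> T" "d \<noteq> \<zero>" "b \<otimes> d = d" using dense b by blast
    have carr: "b \<in> carrier R" "d \<in> carrier R" "\<And>x. x \<in> D \<Longrightarrow> x \<in> carrier R"
      using b d T D by (auto simp: \<A>_def idempotents_closed)
    have "d \<otimes> x = \<zero> \<and> x \<otimes> d = \<zero>" if x: "x \<in> D" for x
    proof -
      have "d \<otimes> x = (b \<otimes> d) \<otimes> x" using d by simp
      also have "\<dots> = d \<otimes> (b \<otimes> x)" using carr x by (simp add: m_ac)
      also have "\<dots> = \<zero>" using ann carr x by simp
      finally show ?thesis using carr x by (simp add: m_comm)
    qed
    then have "insert d D \<in> \<A>" using D d by (auto simp: \<A>_def)
    then have "d \<in> D" using max[of "insert d D"] by blast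
    then show False using ann d by auto
  qed
  then have "dense_orthogonal R D"
    using D T by (auto simp: \<A>_def dense_orthogonal_def)
  then show ?thesis using D that by (auto simp: \<A>_def)
qed

lemma (in cring) boolean_ultrafilter_closed: "boolean_ultrafilter R B \<Longrightarrow> b \<in> B \<Longrightarrow> b \<in> idempotents R"
  by (auto simp: boolean_ultrafilter_def)

locale supported_module = module C M
  for C :: "('c, 'k) ring_scheme" (structure) and M :: "('c, 'a) module" (structure) +
  assumes support: "\<lbrakk>x \<in> carrier M; x \<noteq> \<zero>\<^bsub>M\<^esub>\<rbrakk> \<Longrightarrow>
    \<exists>e\<in>idempotents C. e \<noteq> \<zero> \<and> (\<forall>c\<in>idempotents C. (c \<otimes> e) \<odot>\<^bsub>M\<^esub> x = \<zero>\<^bsub>M\<^esub> \<longrightarrow> c \<otimes> e = \<zero>)"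
begin

lemma dense_orthogonal_closed: "\<lbrakk>dense_orthogonal C D; d \<in> D\<rbrakk> \<Longrightarrow> d \<in> carrier C"
  by (auto simp: dense_orthogonal_def idempotents_def)

text \<open>If x \<noteq> 0 has the support idempotent e, then each d e kills x and therefore
  vanishes, so e would be orthogonal to the dense set \<open>D\<close>.\<close>

lemma dense_orthogonal_cancel_zero:
  assumes D: "dense_orthogonal C D" and x: "x \<in> carrier M"
    and zero: "\<And>d. d \<in> D \<Longrightarrow> d \<odot>\<^bsub>M\<^esub> x = \<zero>\<^bsub>M\<^esub>"
  shows "x = \<zero>\<^bsub>M\<^esub>"
proof (rule ccontr)
  assume "x \<noteq> \<zero>\<^bsub>M\<^esub>"
  then obtain e where e: "e \<in> idempotents C" "e \<noteq> \<zero>"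
    and cancel: "\<And>c. \<lbrakk>c \<in> idempotents C; (c \<otimes> e) \<odot>\<^bsub>M\<^esub> x = \<zero>\<^bsub>M\<^esub>\<rbrakk> \<Longrightarrow> c \<otimes> e = \<zero>"
    using support x by blast
  have "e \<otimes> d = \<zero>" if d: "d \<in> D" for d
  proof -
    have c: "d \<in> idempotents C" "d \<in> carrier C" "e \<in> carrier C"
      using D d e by (auto simp: dense_orthogonal_def idempotents_def)
    then have "(d \<otimes> e) \<odot>\<^bsub>M\<^esub> x = e \<odot>\<^bsub>M\<^esub> (d \<odot>\<^bsub>M\<^esub> x)"
      using x by (simp add: m_comm[of d e] smult_assoc1)
    then have "(d \<otimes> e) \<odot>\<^bsub>M\<^esub> x = \<zero>\<^bsub>M\<^esub>"
      using zero[OF d] c by simp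
    then show ?thesis using cancel[of d] c m_comm by simp
  qed
  then show False using D e by (auto simp: dense_orthogonal_def)
qed

lemma dense_orthogonal_cancel:
  assumes D: "dense_orthogonal C D" and xy: "x \<in> carrier M" "y \<in> carrier M"
    and eq: "\<And>d. d \<in> D \<Longrightarrow> d \<odot>\<^bsub>M\<^esub> x = d \<odot>\<^bsub>M\<^esub> y"
  shows "x = y"
proof -
  have "d \<odot>\<^bsub>M\<^esub> (x \<ominus>\<^bsub>M\<^esub> y) = \<zero>\<^bsub>M\<^esub>" if "d \<in> D" for d
    using eq[OF that] xy dense_orthogonal_closed[OF D that]
    by (simp add: a_minus_def smult_r_distr smult_r_minus M.r_neg)
  then have "x \<ominus>\<^bsub>M\<^esub> y = \<zero>\<^bsub>M\<^esub>"
    by (rule dense_orthogonal_cancel_zero[OF D M.minus_closed[OF xy]])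
  then show ?thesis using xy by (simp add: M.minus_eq_zero_iff)
qed

text \<open>Uniqueness of glued elements is automatic by cancellation along \<open>D\<close>, so
  only existence has to be checked.\<close>

lemma orthogonally_completeI:
  assumes "S \<subseteq> carrier M"
    and "\<And>D u. \<lbrakk>dense_orthogonal C D; u \<in> D \<rightarrow> S\<rbrakk> \<Longrightarrow> \<exists>x\<in>S. \<forall>d\<in>D. d \<odot>\<^bsub>M\<^esub> x = d \<odot>\<^bsub>M\<^esub> u d"
  shows "orthogonally_complete C M S"
  unfolding orthogonally_complete_def
proof (intro conjI allI impI)
  fix D u assume Du: "dense_orthogonal C D \<and> u \<in> D \<rightarrow> S"
  then obtain x where x: "x \<in> S" "\<forall>d\<in>D. d \<odot>\<^bsub>M\<^esub> x = d \<odot>\<^bsub>M\<^esub> u d" using assms(2) by blast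
  show "\<exists>!x. x \<in> S \<and> (\<forall>d\<in>D. d \<odot>\<^bsub>M\<^esub> x = d \<odot>\<^bsub>M\<^esub> u d)"
  proof (rule ex1I)
    show "x \<in> S \<and> (\<forall>d\<in>D. d \<odot>\<^bsub>M\<^esub> x = d \<odot>\<^bsub>M\<^esub> u d)" using x by blast
    show "y = x" if "y \<in> S \<and> (\<forall>d\<in>D. d \<odot>\<^bsub>M\<^esub> y = d \<odot>\<^bsub>M\<^esub> u d)" for y
    proof (rule dense_orthogonal_cancel)
      show "dense_orthogonal C D" using Du by simp
      show "y \<in> carrier M" "x \<in> carrier M" using that x(1) assms(1) by auto
      show "d \<odot>\<^bsub>M\<^esub> y = d \<odot>\<^bsub>M\<^esub> x" if "d \<in> D" for d
        using \<open>y \<in> S \<and> _\<close> x(2) that by simp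
    qed
  qed
qed (rule assms(1))

lemma orthogonally_complete_obtain:
  assumes "orthogonally_complete C M S" "dense_orthogonal C D" "u \<in> D \<rightarrow> S"
  obtains x where "x \<in> S" "\<forall>d\<in>D. d \<odot>\<^bsub>M\<^esub> x = d \<odot>\<^bsub>M\<^esub> u d"
proof -
  have "\<exists>!x. x \<in> S \<and> (\<forall>d\<in>D. d \<odot>\<^bsub>M\<^esub> x = d \<odot>\<^bsub>M\<^esub> u d)"
    by (rule assms(1)[unfolded orthogonally_complete_def, THEN conjunct2, rule_format])
      (intro conjI assms)
  then obtain x where "x \<in> S \<and> (\<forall>d\<in>D. d \<odot>\<^bsub>M\<^esub> x = d \<odot>\<^bsub>M\<^esub> u d)"
    by (rule ex1E)
  then show ?thesis
    by (elim conjE) (rule that)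
qed

text \<open>The idempotent found for b x lies below b by itself: (1 - b) e kills b x and is
  therefore 0. Below b, killing x and killing b x are the same.\<close>

lemma support_below:
  assumes x: "x \<in> carrier M" and b: "b \<in> idempotents C" and nz: "b \<odot>\<^bsub>M\<^esub> x \<noteq> \<zero>\<^bsub>M\<^esub>"
  obtains e where "e \<in> idempotents C" "e \<noteq> \<zero>" "b \<otimes> e = e"
    "\<And>c. \<lbrakk>c \<in> idempotents C; (c \<otimes> e) \<odot>\<^bsub>M\<^esub> x = \<zero>\<^bsub>M\<^esub>\<rbrakk> \<Longrightarrow> c \<otimes> e = \<zero>"
proof -
  have bc: "b \<in> carrier C" using b by (rule idempotents_closed)
  obtain e where e: "e \<in> idempotents C" "e \<noteq> \<zero>"
    and cancel: "\<And>c. \<lbrakk>c \<in> idempotents C; (c \<otimes> e) \<odot>\<^bsub>M\<^esub> (b \<odot>\<^bsub>M\<^esub> x) = \<zero>\<^bsub>M\<^esub>\<rbrakk> \<Longrightarrow> c \<otimes> e = \<zero>"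
    using support[OF smult_closed[OF bc x] nz] by blast
  have ec: "e \<in> carrier C" using e(1) by (rule idempotents_closed)
  note comp = idempotents_complement[OF b]
  have cc: "\<one> \<ominus> b \<in> carrier C" using bc by simp
  have "((\<one> \<ominus> b) \<otimes> e) \<odot>\<^bsub>M\<^esub> (b \<odot>\<^bsub>M\<^esub> x) = (((\<one> \<ominus> b) \<otimes> b) \<otimes> e) \<odot>\<^bsub>M\<^esub> x"
    using x bc ec cc by (simp add: m_ac flip: smult_assoc1)
  also have "\<dots> = \<zero>\<^bsub>M\<^esub>" using x ec comp by simp
  finally have "(\<one> \<ominus> b) \<otimes> e = \<zero>" using cancel comp by blast
  then have be: "b \<otimes> e = e" using bc ec by (intro complement_absorb)
  have "c \<otimes> e = \<zero>" if c: "c \<in> idempotents C" "(c \<otimes> e) \<odot>\<^bsub>M\<^esub> x = \<zero>\<^bsub>M\<^esub>" for c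
  proof (rule cancel[OF c(1)])
    have "c \<in> carrier C" using c by (simp add: idempotents_closed)
    then show "(c \<otimes> e) \<odot>\<^bsub>M\<^esub> (b \<odot>\<^bsub>M\<^esub> x) = \<zero>\<^bsub>M\<^esub>"
      using c x bc ec be by (simp add: m_assoc m_comm[of e b] flip: smult_assoc1)
  qed
  then show ?thesis using e be that by blast
qed

text \<open>The intersection over all complete supersets becomes a concrete set. The right-hand side
  is complete because the dense set of the gluing can be refined by the dense sets of the pieces. It
  lies in every complete T containing S because x is the gluing of the elements d x of S.\<close>

lemma orthogonal_completion_eq:
  assumes complete: "orthogonally_complete C M (carrier M)" and S: "submodule S C M"
  shows "orthogonal_completion C M S
    = {x \<in> carrier M. \<exists>D. dense_orthogonal C D \<and> (\<forall>d\<in>D. d \<odot>\<^bsub>M\<^esub> x \<in> S)}" (is "_ = ?O")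
proof
  have SM: "S \<subseteq> carrier M" and smult: "\<And>c x. \<lbrakk>c \<in> carrier C; x \<in> S\<rbrakk> \<Longrightarrow> c \<odot>\<^bsub>M\<^esub> x \<in> S"
    using submoduleE[OF S] by blast+
  have "S \<subseteq> ?O"
    using SM smult dense_orthogonal_one by auto
  moreover have "orthogonally_complete C M ?O"
  proof (rule orthogonally_completeI)
    fix D u assume D: "dense_orthogonal C D" and u: "u \<in> D \<rightarrow> ?O"
    then have "u \<in> D \<rightarrow> carrier M" by auto
    then obtain x where x: "x \<in> carrier M" "\<forall>d\<in>D. d \<odot>\<^bsub>M\<^esub> x = d \<odot>\<^bsub>M\<^esub> u d"
      by (rule orthogonally_complete_obtain[OF complete D])
    have "\<forall>d\<in>D. \<exists>E. dense_orthogonal C E \<and> (\<forall>e\<in>E. e \<odot>\<^bsub>M\<^esub> u d \<in> S)" using u by blast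
    then obtain E where E: "\<And>d. d \<in> D \<Longrightarrow> dense_orthogonal C (E d)"
      and ES: "\<And>d e. \<lbrakk>d \<in> D; e \<in> E d\<rbrakk> \<Longrightarrow> e \<odot>\<^bsub>M\<^esub> u d \<in> S" by metis
    have "(d \<otimes> e) \<odot>\<^bsub>M\<^esub> x \<in> S" if d: "d \<in> D" and e: "e \<in> E d" for d e
    proof -
      have c: "d \<in> carrier C" "e \<in> carrier C" "u d \<in> carrier M"
        using dense_orthogonal_closed D E d e u by auto
      have "(d \<otimes> e) \<odot>\<^bsub>M\<^esub> x = e \<odot>\<^bsub>M\<^esub> (d \<odot>\<^bsub>M\<^esub> x)"
        using c x(1) by (simp add: m_comm[of d e] smult_assoc1)
      also have "\<dots> = e \<odot>\<^bsub>M\<^esub> (d \<odot>\<^bsub>M\<^esub> u d)" using x(2) d by simp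
      also have "\<dots> = d \<odot>\<^bsub>M\<^esub> (e \<odot>\<^bsub>M\<^esub> u d)" using c by (simp add: m_comm flip: smult_assoc1)
      finally show ?thesis using smult[OF c(1) ES[OF d e]] by simp
    qed
    moreover have "dense_orthogonal C {d \<otimes> e | d e. d \<in> D \<and> e \<in> E d}"
      using D E by (rule dense_orthogonal_refine)
    ultimately have "x \<in> ?O" using x(1) by blast
    then show "\<exists>x\<in>?O. \<forall>d\<in>D. d \<odot>\<^bsub>M\<^esub> x = d \<odot>\<^bsub>M\<^esub> u d" using x(2) by blast
  qed auto
  ultimately show "orthogonal_completion C M S \<subseteq> ?O"
    unfolding orthogonal_completion_def by blast
  show "?O \<subseteq> orthogonal_completion C M S"
    unfolding orthogonal_completion_def
  proof (intro Inter_greatest subsetI)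
    fix T x assume T: "T \<in> {T. S \<subseteq> T \<and> orthogonally_complete C M T}" and "x \<in> ?O"
    then obtain D where x: "x \<in> carrier M" and D: "dense_orthogonal C D" "\<forall>d\<in>D. d \<odot>\<^bsub>M\<^esub> x \<in> S" by blast
    have "(\<lambda>d. d \<odot>\<^bsub>M\<^esub> x) \<in> D \<rightarrow> T" using D T by blast
    then obtain y where y: "y \<in> T" "\<forall>d\<in>D. d \<odot>\<^bsub>M\<^esub> y = d \<odot>\<^bsub>M\<^esub> (d \<odot>\<^bsub>M\<^esub> x)"
      using T D(1) by (elim orthogonally_complete_obtain[rotated 2]) auto
    have yM: "y \<in> carrier M" using y T by (auto simp: orthogonally_complete_def)
    have "y = x"
    proof (rule dense_orthogonal_cancel[OF D(1) yM x])
      fix d assume d: "d \<in> D"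
      then have "d \<in> idempotents C" using D by (auto simp: dense_orthogonal_def)
      then have "d \<odot>\<^bsub>M\<^esub> (d \<odot>\<^bsub>M\<^esub> x) = d \<odot>\<^bsub>M\<^esub> x"
        using x by (simp add: idempotents_def flip: smult_assoc1)
      then show "d \<odot>\<^bsub>M\<^esub> y = d \<odot>\<^bsub>M\<^esub> x" using y(2) d by simp
    qed
    then show "x \<in> T" using y by simp
  qed
qed

text \<open>
  On the idempotents \<open>d\<close> in \<open>T\<close>, either \<open>G\<close> vanishes or some \<open>g \<in> G\<close> has full support; gluing such
  \<open>g\<close> along a dense orthogonal subset of \<open>T\<close> gives an element of \<open>G\<close> whose support is that of \<open>G\<close>.
\<close>

lemma uniform_vanishing:
  assumes complete: "orthogonally_complete C M (carrier M)" and B: "boolean_ultrafilter C B"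
    and G: "G \<subseteq> carrier M"
    and glue: "\<And>D u x. \<lbrakk>dense_orthogonal C D; u \<in> D \<rightarrow> G; x \<in> carrier M;
      \<And>d. d \<in> D \<Longrightarrow> d \<odot>\<^bsub>M\<^esub> x = d \<odot>\<^bsub>M\<^esub> u d\<rbrakk> \<Longrightarrow> x \<in> G"
    and vanish: "\<And>g. g \<in> G \<Longrightarrow> \<exists>b\<in>B. b \<odot>\<^bsub>M\<^esub> g = \<zero>\<^bsub>M\<^esub>"
    and "G \<noteq> {}"
  shows "\<exists>b\<in>B. \<forall>g\<in>G. b \<odot>\<^bsub>M\<^esub> g = \<zero>\<^bsub>M\<^esub>"
proof -
  \<comment> \<open>The meaning is that g has full support on d.\<close>
  define big where "big d g \<longleftrightarrow> (\<forall>c\<in>idempotents C. (c \<otimes> d) \<odot>\<^bsub>M\<^esub> g = \<zero>\<^bsub>M\<^esub> \<longrightarrow> c \<otimes> d = \<zero>)" for d g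
  define T where "T = {d \<in> idempotents C. (\<exists>g\<in>G. big d g) \<or> (\<forall>g\<in>G. d \<odot>\<^bsub>M\<^esub> g = \<zero>\<^bsub>M\<^esub>)}"
  have "\<exists>d\<in>T. d \<noteq> \<zero> \<and> b \<otimes> d = d" if b: "b \<in> idempotents C" "b \<noteq> \<zero>" for b
  proof (cases "\<forall>g\<in>G. b \<odot>\<^bsub>M\<^esub> g = \<zero>\<^bsub>M\<^esub>")
    case True
    then show ?thesis using b by (auto simp: T_def idempotents_idem)
  next
    case False
    then obtain g where g: "g \<in> G" "b \<odot>\<^bsub>M\<^esub> g \<noteq> \<zero>\<^bsub>M\<^esub>" by blast
    obtain e where "e \<in> idempotents C" "e \<noteq> \<zero>" "b \<otimes> e = e" "big e g"
    proof (rule support_below)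
      show "g \<in> carrier M" using g(1) G by blast
      show "b \<odot>\<^bsub>M\<^esub> g \<noteq> \<zero>\<^bsub>M\<^esub>" by (rule g(2))
      show "b \<in> idempotents C" by (rule b(1))
    qed (auto simp: big_def intro: that)
    then show ?thesis using g(1) by (auto simp: T_def)
  qed
  then obtain D where DT: "D \<subseteq> T" and D: "dense_orthogonal C D"
    using obtain_dense_orthogonal[of T] by (auto simp: T_def)
  \<comment> \<open>If no element of \<open>G\<close> is big on d, an arbitrary one is taken; by the
    choice of \<open>T\<close> all of \<open>G\<close> then vanishes on d, so the value does not
    matter.\<close>
  define u where "u d = (SOME g. g \<in> G \<and> ((\<exists>g\<in>G. big d g) \<longrightarrow> big d g))" for d
  have u: "u d \<in> G \<and> ((\<exists>g\<in>G. big d g) \<longrightarrow> big d (u d))" for d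
    unfolding u_def by (rule someI_ex) (use \<open>G \<noteq> {}\<close> in blast)
  obtain x where x: "x \<in> carrier M" "\<And>d. d \<in> D \<Longrightarrow> d \<odot>\<^bsub>M\<^esub> x = d \<odot>\<^bsub>M\<^esub> u d"
  proof -
    have "u \<in> D \<rightarrow> carrier M" using u G by blast
    then obtain x where "x \<in> carrier M" "\<forall>d\<in>D. d \<odot>\<^bsub>M\<^esub> x = d \<odot>\<^bsub>M\<^esub> u d"
      by (rule orthogonally_complete_obtain[OF complete D])
    then show ?thesis using that by blast
  qed
  have "x \<in> G" using u x by (intro glue[OF D]) auto
  then obtain b where b: "b \<in> B" "b \<odot>\<^bsub>M\<^esub> x = \<zero>\<^bsub>M\<^esub>" using vanish by blast
  have bi: "b \<in> idempotents C" using B b(1) by (rule boolean_ultrafilter_closed)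
  then have bc: "b \<in> carrier C" by (rule idempotents_closed)
  have "b \<odot>\<^bsub>M\<^esub> g = \<zero>\<^bsub>M\<^esub>" if g: "g \<in> G" for g
  proof (rule dense_orthogonal_cancel_zero[OF D])
    have gc: "g \<in> carrier M" using g G by blast
    then show "b \<odot>\<^bsub>M\<^esub> g \<in> carrier M" using bc by simp
    fix d assume d: "d \<in> D"
    have dc: "d \<in> carrier C" using D d by (rule dense_orthogonal_closed)
    have uc: "u d \<in> carrier M" using u G by blast
    show "d \<odot>\<^bsub>M\<^esub> (b \<odot>\<^bsub>M\<^esub> g) = \<zero>\<^bsub>M\<^esub>"
    \<comment> \<open>Either b d kills the big element \<open>u d\<close>, so that b d = 0, or d
      itself kills g.\<close>
    proof (cases "\<exists>g\<in>G. big d g")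
      case True
      then have big: "big d (u d)" using u by blast
      have "(b \<otimes> d) \<odot>\<^bsub>M\<^esub> u d = d \<odot>\<^bsub>M\<^esub> (b \<odot>\<^bsub>M\<^esub> x)"
        using x(1) x(2)[OF d] bc dc uc by (simp add: smult_assoc1) (metis m_comm smult_assoc1)
      then have "b \<otimes> d = \<zero>" using big bi dc b(2) by (simp add: big_def)
      then have "d \<otimes> b = \<zero>" using bc dc by (simp add: m_comm)
      then show ?thesis using bc dc gc by (simp flip: smult_assoc1)
    next
      case False
      then have "d \<odot>\<^bsub>M\<^esub> g = \<zero>\<^bsub>M\<^esub>" using DT d g by (auto simp: T_def)
      then have "b \<odot>\<^bsub>M\<^esub> (d \<odot>\<^bsub>M\<^esub> g) = \<zero>\<^bsub>M\<^esub>" using bc by simp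
      then show ?thesis using bc dc gc by (metis m_comm smult_assoc1)
    qed
  qed
  then show ?thesis using b by blast
qed

end

section \<open>Orthogonal completeness of the maximal algebra of quotients\<close>

text \<open>Negatives are multiples by -1.\<close>

lemma (in module) submoduleI_smult:
  assumes "H \<subseteq> carrier M" "\<zero>\<^bsub>M\<^esub> \<in> H"
    and "\<And>a b. \<lbrakk>a \<in> H; b \<in> H\<rbrakk> \<Longrightarrow> a \<oplus>\<^bsub>M\<^esub> b \<in> H"
    and "\<And>c a. \<lbrakk>c \<in> carrier R; a \<in> H\<rbrakk> \<Longrightarrow> c \<odot>\<^bsub>M\<^esub> a \<in> H"
  shows "submodule H R M"
proof (rule submoduleI)
  fix a assume "a \<in> H"
  then have "(\<ominus> \<one>) \<odot>\<^bsub>M\<^esub> a \<in> H" and "a \<in> carrier M"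
    using assms by auto
  then show "\<ominus>\<^bsub>M\<^esub> a \<in> H"
    by (simp add: smult_l_minus)
qed (use assms in auto)

text \<open>Supports are the interface to the central closure: the study of \<open>Q\<close>, of its
  completion subalgebra and of the quotients at ultrafilters takes place over an arbitrary
  \<open>C\<close> whose idempotents supply \<open>support_P\<close>.\<close>

locale supported_max_quotient =
  fixes C :: "('c, 'k) ring_scheme" (structure) and P Q :: "('c, 'a) module"
  assumes max: "maximal_right_quotient_algebra C P Q"
    and support_P: "\<lbrakk>p \<in> carrier P; p \<noteq> \<zero>\<^bsub>P\<^esub>\<rbrakk> \<Longrightarrow>
      \<exists>e\<in>idempotents C. e \<noteq> \<zero> \<and> (\<forall>c\<in>idempotents C. (c \<otimes> e) \<odot>\<^bsub>P\<^esub> p = \<zero>\<^bsub>P\<^esub> \<longrightarrow> c \<otimes> e = \<zero>)"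
begin

lemma quotient: "right_quotient_algebra C P Q"
  using max by (simp add: maximal_right_quotient_algebra_def)

lemma subalgebra: "subalgebra_of C P Q"
  using quotient by (simp add: right_quotient_algebra_def)

sublocale P: alternative_algebra C P
  using quotient by (simp add: right_quotient_algebra_def)

sublocale P: plain_alternative_algebra C P ..

sublocale Q: alternative_algebra C Q
  using quotient by (simp add: right_quotient_algebra_def)

sublocale Q: plain_alternative_algebra C Q ..

lemma P_subset: "x \<in> carrier P \<Longrightarrow> x \<in> carrier Q"
  using subalgebra by (auto simp: subalgebra_of_def)

lemma P_zero: "\<zero>\<^bsub>P\<^esub> = \<zero>\<^bsub>Q\<^esub>"
  using subalgebra by (simp add: subalgebra_of_def)

lemma P_add: "\<lbrakk>x \<in> carrier P; y \<in> carrier P\<rbrakk> \<Longrightarrow> x \<oplus>\<^bsub>P\<^esub> y = x \<oplus>\<^bsub>Q\<^esub> y"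
  using subalgebra by (simp add: subalgebra_of_def)

lemma P_mult: "\<lbrakk>x \<in> carrier P; y \<in> carrier P\<rbrakk> \<Longrightarrow> x \<otimes>\<^bsub>P\<^esub> y = x \<otimes>\<^bsub>Q\<^esub> y"
  using subalgebra by (simp add: subalgebra_of_def)

lemma P_smult: "\<lbrakk>c \<in> carrier C; x \<in> carrier P\<rbrakk> \<Longrightarrow> c \<odot>\<^bsub>P\<^esub> x = c \<odot>\<^bsub>Q\<^esub> x"
  using subalgebra by (simp add: subalgebra_of_def)

lemma P_closed:
  shows P_add_closed: "\<lbrakk>x \<in> carrier P; y \<in> carrier P\<rbrakk> \<Longrightarrow> x \<oplus>\<^bsub>Q\<^esub> y \<in> carrier P"
    and P_mult_closed: "\<lbrakk>x \<in> carrier P; y \<in> carrier P\<rbrakk> \<Longrightarrow> x \<otimes>\<^bsub>Q\<^esub> y \<in> carrier P"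
    and P_smult_closed: "\<lbrakk>c \<in> carrier C; x \<in> carrier P\<rbrakk> \<Longrightarrow> c \<odot>\<^bsub>Q\<^esub> x \<in> carrier P"
    and P_zero_closed: "\<zero>\<^bsub>Q\<^esub> \<in> carrier P"
  using P.M.a_closed P.mult_closed P.smult_closed P.M.zero_closed
  by (simp_all add: P_zero P_add P_mult P_smult)

lemma P_submodule: "submodule (carrier P) C Q"
  by (rule Q.submoduleI_smult) (auto simp: P_closed P_subset)

lemma nucleus_P: "n \<in> nucleus P \<longleftrightarrow> n \<in> carrier P \<and> n \<in> nucleus Q"
proof -
  have "n \<in> nucleus Q" if "n \<in> nucleus P"
    using quotient that by (auto simp: right_quotient_algebra_def)
  then show ?thesis
    using nucleus_subalgebra[OF subalgebra] P.nucleus_closed by blast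
qed

lemma quotient_denominator:
  assumes "x \<in> carrier Q" "y \<in> carrier Q" "x \<noteq> \<zero>\<^bsub>Q\<^esub>"
  obtains z where "z \<in> nucleus P" "x \<otimes>\<^bsub>Q\<^esub> z \<noteq> \<zero>\<^bsub>Q\<^esub>" "y \<otimes>\<^bsub>Q\<^esub> z \<in> carrier P"
proof -
  have "\<exists>z\<in>nucleus P. x \<otimes>\<^bsub>Q\<^esub> z \<noteq> \<zero>\<^bsub>Q\<^esub> \<and> y \<otimes>\<^bsub>Q\<^esub> z \<in> carrier P"
    using quotient assms unfolding right_quotient_algebra_def by blast
  then show ?thesis using that by blast
qed

text \<open>A denominator z moves x to a nonzero x z in \<open>P\<close>. The support idempotent e
  of x z serves for x, since (c e) x = 0 forces (c e)(x z) = 0.\<close>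

sublocale Q: supported_module C Q
proof
  fix x assume x: "x \<in> carrier Q" "x \<noteq> \<zero>\<^bsub>Q\<^esub>"
  then obtain z where z: "z \<in> nucleus P" "x \<otimes>\<^bsub>Q\<^esub> z \<noteq> \<zero>\<^bsub>Q\<^esub>" "x \<otimes>\<^bsub>Q\<^esub> z \<in> carrier P"
    using quotient_denominator[of x x] by blast
  then obtain e where e: "e \<in> idempotents C" "e \<noteq> \<zero>"
    and cancel: "\<And>c. \<lbrakk>c \<in> idempotents C; (c \<otimes> e) \<odot>\<^bsub>P\<^esub> (x \<otimes>\<^bsub>Q\<^esub> z) = \<zero>\<^bsub>P\<^esub>\<rbrakk> \<Longrightarrow> c \<otimes> e = \<zero>"
    using support_P[of "x \<otimes>\<^bsub>Q\<^esub> z"] by (auto simp: P_zero)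
  have "c \<otimes> e = \<zero>" if c: "c \<in> idempotents C" "(c \<otimes> e) \<odot>\<^bsub>Q\<^esub> x = \<zero>\<^bsub>Q\<^esub>" for c
  proof (rule cancel[OF c(1)])
    have ce: "c \<otimes> e \<in> carrier C"
      using c e by (simp add: P.R.idempotents_closed)
    have zQ: "z \<in> carrier Q"
      using z nucleus_P P_subset by blast
    have "(c \<otimes> e) \<odot>\<^bsub>Q\<^esub> (x \<otimes>\<^bsub>Q\<^esub> z) = ((c \<otimes> e) \<odot>\<^bsub>Q\<^esub> x) \<otimes>\<^bsub>Q\<^esub> z"
      using ce x(1) zQ by (simp add: Q.smult_mult_l)
    also have "\<dots> = \<zero>\<^bsub>Q\<^esub>"
      using c(2) zQ by (simp add: Q.mult_zero_left)
    finally show "(c \<otimes> e) \<odot>\<^bsub>P\<^esub> (x \<otimes>\<^bsub>Q\<^esub> z) = \<zero>\<^bsub>P\<^esub>"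
      using ce z(3) by (simp add: P_smult P_zero)
  qed
  then show "\<exists>e\<in>idempotents C. e \<noteq> \<zero> \<and>
      (\<forall>c\<in>idempotents C. (c \<otimes> e) \<odot>\<^bsub>Q\<^esub> x = \<zero>\<^bsub>Q\<^esub> \<longrightarrow> c \<otimes> e = \<zero>)"
    using e by blast
qed

text \<open>The faithfulness clause of \<open>maximal_right_quotient_algebra\<close>, applied to x -
  y.\<close>

lemma dense_right_ideal_cancel:
  assumes "x \<in> carrier Q" "y \<in> carrier Q" "J \<in> dense_right_ideals C P"
    and "\<And>j. j \<in> J \<Longrightarrow> x \<otimes>\<^bsub>Q\<^esub> j = y \<otimes>\<^bsub>Q\<^esub> j"
  shows "x = y"
proof -
  have J: "j \<in> carrier Q" if "j \<in> J" for j
    using assms(3) that nucleus_P P_subset by (auto simp: dense_right_ideals_def)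
  have "x \<ominus>\<^bsub>Q\<^esub> y \<in> carrier Q"
    using assms(1,2) by simp
  moreover have "(x \<ominus>\<^bsub>Q\<^esub> y) \<otimes>\<^bsub>Q\<^esub> j = \<zero>\<^bsub>Q\<^esub>" if "j \<in> J" for j
    using assms(1,2) assms(4)[OF that] J[OF that]
    by (simp add: a_minus_def Q.mult_l_distr Q.mult_neg_left Q.mult_closed Q.M.r_neg)
  ultimately have "x \<ominus>\<^bsub>Q\<^esub> y = \<zero>\<^bsub>Q\<^esub>"
    using assms(3)
      max[unfolded maximal_right_quotient_algebra_def, THEN conjunct2, THEN conjunct2, THEN conjunct1,
        rule_format, of "x \<ominus>\<^bsub>Q\<^esub> y" J]
    by blast
  then show ?thesis
    using assms by (simp add: Q.M.minus_eq_zero_iff)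
qed

end

section \<open>Gluing components to an element of Q\<close>

locale glued_multiplication = supported_max_quotient +
  fixes D u
  assumes D: "dense_orthogonal C D" and u: "u \<in> D \<rightarrow> carrier Q"
begin

text \<open>The graph of left multiplication by the element q that is still to be constructed, as
  far as both v and q v lie in \<open>P\<close>. It can be described by components before q
  exists.\<close>

definition glues where
  "glues v w \<longleftrightarrow> v \<in> carrier P \<and> w \<in> carrier P \<and> (\<forall>d\<in>D. d \<odot>\<^bsub>Q\<^esub> w = d \<odot>\<^bsub>Q\<^esub> (u d \<otimes>\<^bsub>Q\<^esub> v))"

lemma D_closed: "d \<in> D \<Longrightarrow> d \<in> carrier C"
  using D by (rule Q.dense_orthogonal_closed)

lemma u_closed: "d \<in> D \<Longrightarrow> u d \<in> carrier Q"
  using u by blast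

lemma gluesD:
  assumes "glues v w"
  shows "v \<in> carrier P" "w \<in> carrier P" "v \<in> carrier Q" "w \<in> carrier Q"
    "d \<in> D \<Longrightarrow> d \<odot>\<^bsub>Q\<^esub> w = d \<odot>\<^bsub>Q\<^esub> (u d \<otimes>\<^bsub>Q\<^esub> v)"
  using assms by (auto simp: glues_def P_subset)

lemma glues_unique: "\<lbrakk>glues v w; glues v w'\<rbrakk> \<Longrightarrow> w = w'"
  by (rule Q.dense_orthogonal_cancel[OF D]) (simp_all add: gluesD)

lemma glues_zero: "glues \<zero>\<^bsub>Q\<^esub> \<zero>\<^bsub>Q\<^esub>"
  using u_closed by (simp add: glues_def P_zero_closed Q.mult_zero_right D_closed)

lemma glues_add: "\<lbrakk>glues v w; glues v' w'\<rbrakk> \<Longrightarrow> glues (v \<oplus>\<^bsub>Q\<^esub> v') (w \<oplus>\<^bsub>Q\<^esub> w')"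
  using gluesD[of v w] gluesD[of v' w']
  by (subst glues_def)
    (simp add: P_closed D_closed u_closed Q.mult_closed Q.mult_r_distr Q.smult_r_distr)

lemma glues_smult:
  assumes c: "c \<in> carrier C" and vw: "glues v w"
  shows "glues (c \<odot>\<^bsub>Q\<^esub> v) (c \<odot>\<^bsub>Q\<^esub> w)"
proof -
  note vw = gluesD[OF vw]
  have "d \<odot>\<^bsub>Q\<^esub> (c \<odot>\<^bsub>Q\<^esub> w) = d \<odot>\<^bsub>Q\<^esub> (u d \<otimes>\<^bsub>Q\<^esub> (c \<odot>\<^bsub>Q\<^esub> v))" if d: "d \<in> D" for d
  proof -
    note dc = D_closed[OF d] u_closed[OF d]
    have "d \<odot>\<^bsub>Q\<^esub> (c \<odot>\<^bsub>Q\<^esub> w) = c \<odot>\<^bsub>Q\<^esub> (d \<odot>\<^bsub>Q\<^esub> w)"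
      using c dc vw by (simp add: P.R.m_comm flip: Q.smult_assoc1)
    also have "\<dots> = c \<odot>\<^bsub>Q\<^esub> (d \<odot>\<^bsub>Q\<^esub> (u d \<otimes>\<^bsub>Q\<^esub> v))"
      using vw(5)[OF d] by simp
    also have "\<dots> = d \<odot>\<^bsub>Q\<^esub> (u d \<otimes>\<^bsub>Q\<^esub> (c \<odot>\<^bsub>Q\<^esub> v))"
      using c dc vw by (simp add: P.R.m_comm Q.smult_mult_r Q.mult_closed flip: Q.smult_assoc1)
    finally show ?thesis .
  qed
  then show ?thesis
    using vw c by (simp add: glues_def P_closed)
qed

text \<open>A nuclear factor is what turns (u(d) v) x into u(d) (v x). Both alternatives occur:
  nuclear x gives linearity over N(P), and nuclear v gives \<phi>(y x) = \<phi>(y) x for nuclear y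
  and arbitrary x.\<close>

lemma glues_mult:
  assumes vw: "glues v w" and x: "x \<in> carrier P" and n: "v \<in> nucleus P \<or> x \<in> nucleus P"
  shows "glues (v \<otimes>\<^bsub>Q\<^esub> x) (w \<otimes>\<^bsub>Q\<^esub> x)"
proof -
  note vw = gluesD[OF vw]
  have xQ: "x \<in> carrier Q"
    using x by (rule P_subset)
  have "d \<odot>\<^bsub>Q\<^esub> (w \<otimes>\<^bsub>Q\<^esub> x) = d \<odot>\<^bsub>Q\<^esub> (u d \<otimes>\<^bsub>Q\<^esub> (v \<otimes>\<^bsub>Q\<^esub> x))" if d: "d \<in> D" for d
  proof -
    note dc = D_closed[OF d] u_closed[OF d]
    have "d \<odot>\<^bsub>Q\<^esub> (w \<otimes>\<^bsub>Q\<^esub> x) = (d \<odot>\<^bsub>Q\<^esub> w) \<otimes>\<^bsub>Q\<^esub> x"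
      using dc vw xQ by (simp add: Q.smult_mult_l)
    also have "\<dots> = d \<odot>\<^bsub>Q\<^esub> ((u d \<otimes>\<^bsub>Q\<^esub> v) \<otimes>\<^bsub>Q\<^esub> x)"
      using dc vw(3) vw(5)[OF d] xQ by (simp add: Q.smult_mult_l Q.mult_closed)
    also have "(u d \<otimes>\<^bsub>Q\<^esub> v) \<otimes>\<^bsub>Q\<^esub> x = u d \<otimes>\<^bsub>Q\<^esub> (v \<otimes>\<^bsub>Q\<^esub> x)"
      using n dc vw(3) xQ nucleus_P Q.nucleus_assoc_2 Q.nucleus_assoc_3 by blast
    finally show ?thesis .
  qed
  then show ?thesis
    using vw x by (simp add: glues_def P_closed)
qed

text \<open>Each component d w = d (u(d) [y, z]) is nuclear by
  \<open>mult_commutator_in_nucleus\<close>, and vanishing of associators can be tested on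
  components.\<close>

lemma glues_commutator:
  assumes "glues (commutator P y z) w" "y \<in> nucleus P" "z \<in> nucleus P"
  shows "w \<in> nucleus P"
proof -
  have eq: "commutator P y z = commutator Q y z"
    using assms nucleus_P subalgebra_of_minus[OF subalgebra]
    by (simp add: commutator_def P_mult P_mult_closed)
  note w = gluesD[OF assms(1)[unfolded eq]]
  have "associator Q w a b = \<zero>\<^bsub>Q\<^esub>" if ab: "a \<in> carrier Q" "b \<in> carrier Q" for a b
  proof (rule Q.dense_orthogonal_cancel_zero[OF D])
    show "associator Q w a b \<in> carrier Q"
      using w ab by (simp add: Q.associator_closed)
    fix d assume d: "d \<in> D"
    note dc = D_closed[OF d] u_closed[OF d]
    have "u d \<otimes>\<^bsub>Q\<^esub> commutator Q y z \<in> nucleus Q"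
      using dc assms nucleus_P by (simp add: Q.mult_commutator_in_nucleus)
    then have "d \<odot>\<^bsub>Q\<^esub> w \<in> nucleus Q"
      using w(5)[OF d] dc by (simp add: Q.nucleus_smult)
    then have "associator Q (d \<odot>\<^bsub>Q\<^esub> w) a b = \<zero>\<^bsub>Q\<^esub>"
      using ab by (simp add: nucleus_def)
    then show "d \<odot>\<^bsub>Q\<^esub> associator Q w a b = \<zero>\<^bsub>Q\<^esub>"
      using dc w ab by (simp add: Q.associator_smult_1)
  qed
  then have "w \<in> nucleus Q"
    using w(4) by (intro Q.nucleusI)
  then show ?thesis
    using w nucleus_P by simp
qed

definition J where "J = {v \<in> nucleus P. \<exists>w. glues v w}"

text \<open>For density, some d in \<open>D\<close> has d x \<noteq> 0 because x \<noteq> 0. A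
  denominator z for d x and u(d) y, cut down by d, then handles all components at once.\<close>

lemma J_dense: "J \<in> dense_right_ideals C P"
  unfolding dense_right_ideals_def
proof (intro CollectI conjI ballI)
  have smult: "c \<odot>\<^bsub>P\<^esub> x \<in> J" if "c \<in> carrier C" "x \<in> J" for c x
    using that glues_smult[of c x] P.nucleus_smult[of c x]
    by (auto simp: J_def nucleus_P P_smult)
  have add: "x \<oplus>\<^bsub>P\<^esub> y \<in> J" if "x \<in> J" "y \<in> J" for x y
    using that glues_add[of x _ y] P.nucleus_add[of x y]
    by (auto simp: J_def nucleus_P P_add)
  show "submodule J C P"
  proof (rule P.submoduleI_smult)
    show "J \<subseteq> carrier P"
      by (auto simp: J_def nucleus_P)
    show "\<zero>\<^bsub>P\<^esub> \<in> J"
      using glues_zero P.nucleus_zero by (auto simp: J_def P_zero)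
  qed (rule add smult; assumption)+
  show "J \<subseteq> nucleus P"
    by (auto simp: J_def)
  show "x \<otimes>\<^bsub>P\<^esub> y \<in> J" if "x \<in> J" "y \<in> nucleus P" for x y
    using that glues_mult[of x _ y] P.nucleus_mult[of x y]
    by (auto simp: J_def nucleus_P P_mult)
  show "\<exists>z\<in>nucleus P. x \<otimes>\<^bsub>P\<^esub> z \<noteq> \<zero>\<^bsub>P\<^esub> \<and> y \<otimes>\<^bsub>P\<^esub> z \<in> J"
    if x: "x \<in> carrier P - {\<zero>\<^bsub>P\<^esub>}" and y: "y \<in> nucleus P" for x y
  proof -
    have xP: "x \<in> carrier P" and xQ: "x \<in> carrier Q" and "x \<noteq> \<zero>\<^bsub>Q\<^esub>"
      using x P_zero P_subset by auto
    then obtain d where d: "d \<in> D" "d \<odot>\<^bsub>Q\<^esub> x \<noteq> \<zero>\<^bsub>Q\<^esub>"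
      using Q.dense_orthogonal_cancel_zero[OF D] by blast
    note dc = D_closed[OF d(1)] u_closed[OF d(1)]
    have di: "d \<otimes> d = d"
      using D d by (auto simp: dense_orthogonal_def idempotents_def)
    have yP: "y \<in> carrier P" and yQ: "y \<in> carrier Q" "y \<in> nucleus Q"
      using y nucleus_P P_subset by auto
    obtain z where z: "z \<in> nucleus P" "(d \<odot>\<^bsub>Q\<^esub> x) \<otimes>\<^bsub>Q\<^esub> z \<noteq> \<zero>\<^bsub>Q\<^esub>" "(u d \<otimes>\<^bsub>Q\<^esub> y) \<otimes>\<^bsub>Q\<^esub> z \<in> carrier P"
      using quotient_denominator[of "d \<odot>\<^bsub>Q\<^esub> x" "u d \<otimes>\<^bsub>Q\<^esub> y"] xQ dc yQ d(2)
      by (auto simp: Q.mult_closed)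
    have zP: "z \<in> carrier P" and zQ: "z \<in> carrier Q"
      using z(1) nucleus_P P_subset by auto
    \<comment> \<open>The factor d kills the components of y z at all other members of
      \<open>D\<close>, so the single element \<open>?w\<close> of \<open>P\<close> has the right
      components everywhere. On the other side x (d z) = (d x) z is still nonzero.\<close>
    let ?z = "d \<odot>\<^bsub>Q\<^esub> z" and ?w = "d \<odot>\<^bsub>Q\<^esub> ((u d \<otimes>\<^bsub>Q\<^esub> y) \<otimes>\<^bsub>Q\<^esub> z)"
    have z': "?z \<in> nucleus P"
      using P.nucleus_smult[OF dc(1) z(1)] zP dc by (simp add: P_smult)
    then have z'P: "?z \<in> carrier P"
      by (simp add: nucleus_P)
    have "x \<otimes>\<^bsub>P\<^esub> ?z \<noteq> \<zero>\<^bsub>P\<^esub>"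
      using z(2) xP z'P xQ zQ dc by (simp add: P_mult P_zero Q.smult_mult_l Q.smult_mult_r)
    moreover have "glues (y \<otimes>\<^bsub>Q\<^esub> ?z) ?w"
      unfolding glues_def
    proof (intro conjI ballI)
      show "y \<otimes>\<^bsub>Q\<^esub> ?z \<in> carrier P" "?w \<in> carrier P"
        using yP z'P z(3) dc by (simp_all add: P_closed)
      fix c assume c: "c \<in> D"
      note cc = D_closed[OF c] u_closed[OF c]
      have "c \<odot>\<^bsub>Q\<^esub> (u c \<otimes>\<^bsub>Q\<^esub> (y \<otimes>\<^bsub>Q\<^esub> ?z)) = (c \<otimes> d) \<odot>\<^bsub>Q\<^esub> (u c \<otimes>\<^bsub>Q\<^esub> (y \<otimes>\<^bsub>Q\<^esub> z))"
        using cc dc yQ zQ by (simp add: Q.smult_mult_r Q.mult_closed Q.smult_assoc1)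
      also have "\<dots> = (c \<otimes> d) \<odot>\<^bsub>Q\<^esub> ((u c \<otimes>\<^bsub>Q\<^esub> y) \<otimes>\<^bsub>Q\<^esub> z)"
        using cc zQ by (simp add: Q.nucleus_assoc_2[OF yQ(2)])
      also have "\<dots> = (c \<otimes> d) \<odot>\<^bsub>Q\<^esub> ((u d \<otimes>\<^bsub>Q\<^esub> y) \<otimes>\<^bsub>Q\<^esub> z)"
      proof (cases "c = d")
        case False
        then have "c \<otimes> d = \<zero>"
          using D c d(1) by (auto simp: dense_orthogonal_def)
        then show ?thesis
          using cc dc yQ zQ by (simp add: Q.mult_closed)
      qed simp
      also have "\<dots> = c \<odot>\<^bsub>Q\<^esub> ?w"
        using cc dc yQ zQ by (simp add: Q.mult_closed Q.smult_assoc1)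
      finally show "c \<odot>\<^bsub>Q\<^esub> ?w = c \<odot>\<^bsub>Q\<^esub> (u c \<otimes>\<^bsub>Q\<^esub> (y \<otimes>\<^bsub>Q\<^esub> ?z))"
        by (rule sym)
    qed
    then have "y \<otimes>\<^bsub>P\<^esub> ?z \<in> J"
      using P.nucleus_mult[OF y z'] yP z'P by (auto simp: J_def P_mult)
    ultimately show ?thesis
      using z' by blast
  qed
qed

definition \<phi> where "\<phi> v = (THE w. glues v w)"

lemma \<phi>_eq: "glues v w \<Longrightarrow> \<phi> v = w"
  unfolding \<phi>_def by (rule the_equality) (auto intro: glues_unique)

text \<open>Elements of J + J P need not be nuclear, but each generator y x has a nuclear left
  factor y in \<open>J\<close>, to which \<open>glues_mult\<close> applies. Negatives are handled as
  multiples by -1.\<close>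

lemma span_glues:
  assumes "v \<in> unital_right_span P J"
  shows "\<exists>w. glues v w"
  using assms unfolding unital_right_span_def
proof (induction rule: generate.induct)
  case one
  then show ?case
    using glues_zero by (auto simp: P_zero)
next
  have base: "\<exists>w. glues h w" if "h \<in> J \<union> (J <#>\<^bsub>P\<^esub> carrier P)" for h
    using that
  proof
    assume "h \<in> J <#>\<^bsub>P\<^esub> carrier P"
    then obtain y x where h: "y \<in> J" "x \<in> carrier P" "h = y \<otimes>\<^bsub>P\<^esub> x"
      by (auto simp: set_mult_def)
    then obtain w where "glues y w" "y \<in> nucleus P"
      by (auto simp: J_def)
    then show ?thesis
      using h glues_mult[of y w x] by (auto simp: P_mult nucleus_P)
  qed (auto simp: J_def)
  {
    case (incl h)
    then show ?case by (rule base)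
  next
    case (inv h)
    then obtain w where w: "glues h w"
      using base by blast
    have "(\<ominus> \<one>) \<odot>\<^bsub>Q\<^esub> h = (\<ominus> \<one>) \<odot>\<^bsub>P\<^esub> h"
      using gluesD(1)[OF w] by (simp add: P_smult)
    also have "\<dots> = \<ominus>\<^bsub>P\<^esub> h"
      using gluesD(1)[OF w] by (simp add: P.smult_l_minus)
    finally have "(\<ominus> \<one>) \<odot>\<^bsub>Q\<^esub> h = inv\<^bsub>add_monoid P\<^esub> h"
      by (simp add: a_inv_def)
    then show ?case
      using glues_smult[OF _ w, of "\<ominus> \<one>"] by auto
  }
next
  case (eng h1 h2)
  then obtain w1 w2 where "glues h1 w1" "glues h2 w2"
    by blast
  then show ?case
    using glues_add[of h1 w1 h2 w2] gluesD(1)[of h1 w1] gluesD(1)[of h2 w2] by (auto simp: P_add)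
qed

lemma \<phi>_Hom_star: "\<phi> \<in> Hom_star P (unital_right_span P J)"
  unfolding Hom_star_def
proof (intro CollectI conjI ballI Pi_I)
  fix v assume "v \<in> unital_right_span P J"
  then obtain w where w: "glues v w" using span_glues by blast
  then show "\<phi> v \<in> carrier P"
    using \<phi>_eq gluesD(2) by simp
  show "\<phi> (v \<oplus>\<^bsub>P\<^esub> v') = \<phi> v \<oplus>\<^bsub>P\<^esub> \<phi> v'" if v': "v' \<in> unital_right_span P J" for v'
  proof -
    obtain w' where w': "glues v' w'" using span_glues[OF v'] by blast
    show ?thesis
      using \<phi>_eq[OF glues_add[OF w w']] \<phi>_eq[OF w] \<phi>_eq[OF w'] gluesD(1,2)[OF w] gluesD(1,2)[OF w']
      by (simp add: P_add)
  qed
  show "\<phi> (v \<otimes>\<^bsub>P\<^esub> n) = \<phi> v \<otimes>\<^bsub>P\<^esub> n" if "n \<in> nucleus P" for n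
    using \<phi>_eq[OF glues_mult[OF w, of n]] \<phi>_eq[OF w] gluesD(1,2)[OF w] that
    by (simp add: P_mult nucleus_P)
next
  fix y assume y: "y \<in> unital_right_span P J \<inter> nucleus P"
  then obtain w where w: "glues y w" using span_glues by blast
  show "\<phi> (y \<otimes>\<^bsub>P\<^esub> x) = \<phi> y \<otimes>\<^bsub>P\<^esub> x" if "x \<in> carrier P" for x
    using \<phi>_eq[OF glues_mult[OF w, of x]] \<phi>_eq[OF w] gluesD(1,2)[OF w] that y
    by (simp add: P_mult)
  show "\<phi> (commutator P y z) \<in> nucleus P" if z: "z \<in> unital_right_span P J \<inter> nucleus P" for z
  proof -
    obtain w' where w': "glues z w'" using span_glues z by blast
    have yz: "y \<in> nucleus P" "z \<in> nucleus P" "y \<in> carrier P" "z \<in> carrier P"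
      using y z nucleus_P by auto
    have "glues (y \<otimes>\<^bsub>Q\<^esub> z) (w \<otimes>\<^bsub>Q\<^esub> z)" "glues (z \<otimes>\<^bsub>Q\<^esub> y) (w' \<otimes>\<^bsub>Q\<^esub> y)"
      using yz w w' by (auto intro: glues_mult)
    \<comment> \<open>The commutator is written with the scalar -1 so that closure of
      \<open>glues\<close> under sums and scalars yields its image.\<close>
    then have "glues (y \<otimes>\<^bsub>Q\<^esub> z \<oplus>\<^bsub>Q\<^esub> (\<ominus> \<one>) \<odot>\<^bsub>Q\<^esub> (z \<otimes>\<^bsub>Q\<^esub> y)) (w \<otimes>\<^bsub>Q\<^esub> z \<oplus>\<^bsub>Q\<^esub> (\<ominus> \<one>) \<odot>\<^bsub>Q\<^esub> (w' \<otimes>\<^bsub>Q\<^esub> y))"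
      by (intro glues_add glues_smult) auto
    moreover have "y \<otimes>\<^bsub>Q\<^esub> z \<oplus>\<^bsub>Q\<^esub> (\<ominus> \<one>) \<odot>\<^bsub>Q\<^esub> (z \<otimes>\<^bsub>Q\<^esub> y) = commutator P y z"
      using yz subalgebra_of_minus[OF subalgebra] P_subset
      by (simp add: commutator_def P_mult P_mult_closed Q.smult_l_minus a_minus_def Q.mult_closed)
    ultimately obtain w'' where "glues (commutator P y z) w''"
      by auto
    then show ?thesis
      using glues_commutator yz \<phi>_eq by simp
  qed
qed

text \<open>The map \<phi> is left multiplication by some q. Then d q and d u(d) have the same
  products with all of the dense right ideal \<open>J\<close>, hence are equal.\<close>

lemma glued_element: "\<exists>q\<in>carrier Q. \<forall>d\<in>D. d \<odot>\<^bsub>Q\<^esub> q = d \<odot>\<^bsub>Q\<^esub> u d"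
proof -
  obtain q where q: "q \<in> carrier Q" "\<forall>v\<in>unital_right_span P J. q \<otimes>\<^bsub>Q\<^esub> v = \<phi> v"
    using max J_dense \<phi>_Hom_star unfolding maximal_right_quotient_algebra_def by blast
  have "d \<odot>\<^bsub>Q\<^esub> q = d \<odot>\<^bsub>Q\<^esub> u d" if d: "d \<in> D" for d
  proof (rule dense_right_ideal_cancel[OF _ _ J_dense])
    note dc = D_closed[OF d] u_closed[OF d]
    show "d \<odot>\<^bsub>Q\<^esub> q \<in> carrier Q" "d \<odot>\<^bsub>Q\<^esub> u d \<in> carrier Q"
      using dc q(1) by simp_all
    fix j assume j: "j \<in> J"
    then obtain w where w: "glues j w"
      by (auto simp: J_def)
    have "j \<in> unital_right_span P J"
      using j by (auto simp: unital_right_span_def intro: generate.incl)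
    then have "q \<otimes>\<^bsub>Q\<^esub> j = w"
      using q(2) \<phi>_eq[OF w] by simp
    then show "(d \<odot>\<^bsub>Q\<^esub> q) \<otimes>\<^bsub>Q\<^esub> j = (d \<odot>\<^bsub>Q\<^esub> u d) \<otimes>\<^bsub>Q\<^esub> j"
      using gluesD(3)[OF w] gluesD(5)[OF w d] dc q(1) by (simp add: Q.smult_mult_l)
  qed
  then show ?thesis
    using q(1) by blast
qed

end

lemma (in supported_max_quotient) orthogonally_complete: "orthogonally_complete C Q (carrier Q)"
proof (rule Q.orthogonally_completeI)
  fix D u assume "dense_orthogonal C D" "u \<in> D \<rightarrow> carrier Q"
  then interpret glued_multiplication C P Q D u
    by unfold_locales
  show "\<exists>x\<in>carrier Q. \<forall>d\<in>D. d \<odot>\<^bsub>Q\<^esub> x = d \<odot>\<^bsub>Q\<^esub> u d"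
    by (rule glued_element)
qed simp

section \<open>The orthogonal completion and quotients at ultrafilters\<close>

context supported_max_quotient
begin

definition completion where "completion = orthogonal_completion C Q (carrier P)"

definition O_P where "O_P = Q\<lparr>carrier := completion\<rparr>"

lemma completion_iff:
  "x \<in> completion \<longleftrightarrow>
    x \<in> carrier Q \<and> (\<exists>D. dense_orthogonal C D \<and> (\<forall>d\<in>D. d \<odot>\<^bsub>Q\<^esub> x \<in> carrier P))"
  unfolding completion_def Q.orthogonal_completion_eq[OF orthogonally_complete P_submodule] by blast

lemma completionI:
  "\<lbrakk>x \<in> carrier Q; dense_orthogonal C D; \<And>d. d \<in> D \<Longrightarrow> d \<odot>\<^bsub>Q\<^esub> x \<in> carrier P\<rbrakk> \<Longrightarrow> x \<in> completion"
  unfolding completion_iff by blast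

lemma completion_closed: "x \<in> completion \<Longrightarrow> x \<in> carrier Q"
  unfolding completion_iff by blast

lemma P_completion: "x \<in> carrier P \<Longrightarrow> x \<in> completion"
  by (rule completionI[OF _ P.R.dense_orthogonal_one]) (simp_all add: P_subset)

lemma common_refinement:
  assumes "x \<in> completion" "y \<in> completion"
  obtains D where "dense_orthogonal C D"
    "\<And>d. d \<in> D \<Longrightarrow> d \<odot>\<^bsub>Q\<^esub> x \<in> carrier P" "\<And>d. d \<in> D \<Longrightarrow> d \<odot>\<^bsub>Q\<^esub> y \<in> carrier P"
proof -
  obtain D where x: "x \<in> carrier Q" and D: "dense_orthogonal C D" and DP: "\<And>d. d \<in> D \<Longrightarrow> d \<odot>\<^bsub>Q\<^esub> x \<in> carrier P"
    using assms(1) unfolding completion_iff by blast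
  obtain E where y: "y \<in> carrier Q" and E: "dense_orthogonal C E" and EP: "\<And>e. e \<in> E \<Longrightarrow> e \<odot>\<^bsub>Q\<^esub> y \<in> carrier P"
    using assms(2) unfolding completion_iff by blast
  have "(d \<otimes> e) \<odot>\<^bsub>Q\<^esub> x \<in> carrier P" "(d \<otimes> e) \<odot>\<^bsub>Q\<^esub> y \<in> carrier P" if "d \<in> D" "e \<in> E" for d e
  proof -
    have c: "d \<in> carrier C" "e \<in> carrier C"
      using that D E by (auto intro: Q.dense_orthogonal_closed)
    show "(d \<otimes> e) \<odot>\<^bsub>Q\<^esub> y \<in> carrier P"
      using c y EP[OF that(2)] by (simp add: Q.smult_assoc1 P_smult_closed)
    have "(d \<otimes> e) \<odot>\<^bsub>Q\<^esub> x = e \<odot>\<^bsub>Q\<^esub> (d \<odot>\<^bsub>Q\<^esub> x)"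
      using c x by (simp add: P.R.m_comm[of d e] Q.smult_assoc1)
    then show "(d \<otimes> e) \<odot>\<^bsub>Q\<^esub> x \<in> carrier P"
      using c DP[OF that(1)] by (simp add: P_smult_closed)
  qed
  moreover have "dense_orthogonal C {d \<otimes> e | d e. d \<in> D \<and> e \<in> E}"
    using P.R.dense_orthogonal_refine[OF D, of "\<lambda>_. E"] E by simp
  ultimately show ?thesis
    using that[of "{d \<otimes> e | d e. d \<in> D \<and> e \<in> E}"] by blast
qed

lemma completion_submodule: "submodule completion C Q"
proof (rule Q.submoduleI_smult)
  show "\<zero>\<^bsub>Q\<^esub> \<in> completion"
    by (rule P_completion) (rule P_zero_closed)
  show "x \<oplus>\<^bsub>Q\<^esub> y \<in> completion" if xy: "x \<in> completion" "y \<in> completion" for x y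
  proof -
    obtain D where D: "dense_orthogonal C D"
      "\<And>d. d \<in> D \<Longrightarrow> d \<odot>\<^bsub>Q\<^esub> x \<in> carrier P" "\<And>d. d \<in> D \<Longrightarrow> d \<odot>\<^bsub>Q\<^esub> y \<in> carrier P"
      using common_refinement[OF xy] by metis
    show ?thesis
      using D completion_closed[OF xy(1)] completion_closed[OF xy(2)] Q.dense_orthogonal_closed[OF D(1)]
      by (intro completionI[OF _ D(1)]) (simp_all add: Q.smult_r_distr P_add_closed)
  qed
  show "c \<odot>\<^bsub>Q\<^esub> x \<in> completion" if c: "c \<in> carrier C" and x: "x \<in> completion" for c x
  proof -
    obtain D where D: "dense_orthogonal C D" "\<And>d. d \<in> D \<Longrightarrow> d \<odot>\<^bsub>Q\<^esub> x \<in> carrier P"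
      using x unfolding completion_iff by blast
    have "d \<odot>\<^bsub>Q\<^esub> (c \<odot>\<^bsub>Q\<^esub> x) \<in> carrier P" if d: "d \<in> D" for d
    proof -
      have "d \<odot>\<^bsub>Q\<^esub> (c \<odot>\<^bsub>Q\<^esub> x) = c \<odot>\<^bsub>Q\<^esub> (d \<odot>\<^bsub>Q\<^esub> x)"
        using Q.dense_orthogonal_closed[OF D(1) d] c completion_closed[OF x]
        by (simp add: P.R.m_comm flip: Q.smult_assoc1)
      then show ?thesis using D(2)[OF d] c by (simp add: P_smult_closed)
    qed
    then show ?thesis
      using c completion_closed[OF x] by (intro completionI[OF _ D(1)]) simp_all
  qed
qed (use completion_closed in blast)

lemma completion_mult:
  assumes xy: "x \<in> completion" "y \<in> completion"
  shows "x \<otimes>\<^bsub>Q\<^esub> y \<in> completion"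
proof -
  obtain D where D: "dense_orthogonal C D"
    and DP: "\<And>d. d \<in> D \<Longrightarrow> d \<odot>\<^bsub>Q\<^esub> x \<in> carrier P" "\<And>d. d \<in> D \<Longrightarrow> d \<odot>\<^bsub>Q\<^esub> y \<in> carrier P"
    using common_refinement[OF xy] by metis
  note c = completion_closed[OF xy(1)] completion_closed[OF xy(2)]
  have "d \<odot>\<^bsub>Q\<^esub> (x \<otimes>\<^bsub>Q\<^esub> y) \<in> carrier P" if d: "d \<in> D" for d
  proof -
    have dc: "d \<in> carrier C" "d \<otimes> d = d"
      using D d by (auto simp: dense_orthogonal_def idempotents_def)
    \<comment> \<open>Idempotence of d turns the product of the two components into the component of
      the product.\<close>
    have "(d \<odot>\<^bsub>Q\<^esub> x) \<otimes>\<^bsub>Q\<^esub> (d \<odot>\<^bsub>Q\<^esub> y) = (d \<otimes> d) \<odot>\<^bsub>Q\<^esub> (x \<otimes>\<^bsub>Q\<^esub> y)"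
      using dc(1) c by (simp add: Q.smult_mult_l Q.smult_mult_r Q.mult_closed Q.smult_assoc1)
    then show ?thesis
      using P_mult_closed[OF DP(1)[OF d] DP(2)[OF d]] dc(2) by simp
  qed
  then show ?thesis
    using c D by (intro completionI[of _ D]) (simp_all add: Q.mult_closed)
qed

text \<open>The gluing exists in \<open>Q\<close>. It stays in the completion because
  \<open>D\<close> can be refined by dense sets that carry the individual \<open>u d\<close> into
  \<open>P\<close>.\<close>

lemma completion_glue:
  assumes D: "dense_orthogonal C D" and u: "\<And>d. d \<in> D \<Longrightarrow> u d \<in> completion"
  obtains x where "x \<in> completion" "\<forall>d\<in>D. d \<odot>\<^bsub>Q\<^esub> x = d \<odot>\<^bsub>Q\<^esub> u d"
proof -
  have uQ: "u \<in> D \<rightarrow> carrier Q"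
    using u completion_closed by blast
  obtain x where x: "x \<in> carrier Q" "\<forall>d\<in>D. d \<odot>\<^bsub>Q\<^esub> x = d \<odot>\<^bsub>Q\<^esub> u d"
    by (rule Q.orthogonally_complete_obtain[OF orthogonally_complete D uQ])
  have "\<forall>d\<in>D. \<exists>E. dense_orthogonal C E \<and> (\<forall>e\<in>E. e \<odot>\<^bsub>Q\<^esub> u d \<in> carrier P)"
    using u unfolding completion_iff by blast
  then obtain E where E: "\<And>d. d \<in> D \<Longrightarrow> dense_orthogonal C (E d)"
    and EP: "\<And>d e. \<lbrakk>d \<in> D; e \<in> E d\<rbrakk> \<Longrightarrow> e \<odot>\<^bsub>Q\<^esub> u d \<in> carrier P" by metis
  have "(d \<otimes> e) \<odot>\<^bsub>Q\<^esub> x \<in> carrier P" if d: "d \<in> D" and e: "e \<in> E d" for d e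
  proof -
    have c: "d \<in> carrier C" "e \<in> carrier C" "u d \<in> carrier Q"
      using Q.dense_orthogonal_closed[OF D d] Q.dense_orthogonal_closed[OF E[OF d] e] uQ d by auto
    have "(d \<otimes> e) \<odot>\<^bsub>Q\<^esub> x = e \<odot>\<^bsub>Q\<^esub> (d \<odot>\<^bsub>Q\<^esub> x)"
      using c x(1) by (simp add: P.R.m_comm[of d e] Q.smult_assoc1)
    also have "\<dots> = e \<odot>\<^bsub>Q\<^esub> (d \<odot>\<^bsub>Q\<^esub> u d)"
      using x(2) d by simp
    also have "\<dots> = d \<odot>\<^bsub>Q\<^esub> (e \<odot>\<^bsub>Q\<^esub> u d)"
      using c by (simp add: P.R.m_comm flip: Q.smult_assoc1)
    finally show ?thesis
      using P_smult_closed[OF c(1) EP[OF d e]] by simp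
  qed
  moreover have "dense_orthogonal C {d \<otimes> e | d e. d \<in> D \<and> e \<in> E d}"
    using D E by (rule P.R.dense_orthogonal_refine)
  ultimately have "x \<in> completion"
    using x(1) by (intro completionI) auto
  then show ?thesis
    using x(2) that by blast
qed

lemma O_P_subalgebra: "subalgebra_of C O_P Q"
  unfolding O_P_def
  by (rule Q.subalgebra_restrict[OF completion_submodule completion_mult])

text \<open>Testing against \<open>P\<close> suffices: the pieces d n lie in \<open>P\<close> and
  are nuclear there, hence nuclear in \<open>Q\<close> because N(P) is contained in N(Q).
  Associators of n with elements of \<open>Q\<close> therefore vanish on every d.\<close>

lemma nucleus_completionI:
  assumes n: "n \<in> completion"
    and assoc: "\<And>a b. \<lbrakk>a \<in> carrier P; b \<in> carrier P\<rbrakk> \<Longrightarrow> associator Q n a b = \<zero>\<^bsub>Q\<^esub>"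
  shows "n \<in> nucleus Q"
proof (rule Q.nucleusI)
  show nQ: "n \<in> carrier Q"
    using n by (rule completion_closed)
  obtain D where D: "dense_orthogonal C D" "\<And>d. d \<in> D \<Longrightarrow> d \<odot>\<^bsub>Q\<^esub> n \<in> carrier P"
    using n unfolding completion_iff by blast
  fix a b assume ab: "a \<in> carrier Q" "b \<in> carrier Q"
  show "associator Q n a b = \<zero>\<^bsub>Q\<^esub>"
  proof (rule Q.dense_orthogonal_cancel_zero[OF D(1)])
    show "associator Q n a b \<in> carrier Q"
      using nQ ab by (rule Q.associator_closed)
    fix d assume d: "d \<in> D"
    have dc: "d \<in> carrier C"
      using D(1) d by (rule Q.dense_orthogonal_closed)
    have "d \<odot>\<^bsub>Q\<^esub> n \<in> nucleus P"
    proof (rule P.nucleusI[OF D(2)[OF d]])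
      fix y z assume yz: "y \<in> carrier P" "z \<in> carrier P"
      have "associator P (d \<odot>\<^bsub>Q\<^esub> n) y z = associator Q (d \<odot>\<^bsub>Q\<^esub> n) y z"
        using D(2)[OF d] yz by (rule subalgebra_of_associator[OF subalgebra])
      also have "\<dots> = \<zero>\<^bsub>P\<^esub>"
        using dc nQ yz assoc[OF yz] by (simp add: Q.associator_smult_1 P_subset P_zero)
      finally show "associator P (d \<odot>\<^bsub>Q\<^esub> n) y z = \<zero>\<^bsub>P\<^esub>" .
    qed
    then have "d \<odot>\<^bsub>Q\<^esub> n \<in> nucleus Q"
      by (simp add: nucleus_P)
    then have "associator Q (d \<odot>\<^bsub>Q\<^esub> n) a b = \<zero>\<^bsub>Q\<^esub>"
      using ab by (simp add: nucleus_def)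
    then show "d \<odot>\<^bsub>Q\<^esub> associator Q n a b = \<zero>\<^bsub>Q\<^esub>"
      using dc nQ ab by (simp add: Q.associator_smult_1)
  qed
qed

text \<open>Denominators from N(P) still serve, since they are nuclear in \<open>Q\<close> and so in
  the completion. The inclusion of the nuclei is reduced to associators with elements of
  \<open>P\<close>.\<close>

lemma O_P_right_quotient: "right_quotient_algebra C O_P Q"
  unfolding right_quotient_algebra_def
proof (intro conjI ballI impI subsetI)
  show "alternative_algebra C O_P"
    using O_P_subalgebra Q.alternative_algebra_axioms by (rule subalgebra_of_alternative)
  have carrier: "carrier O_P = completion" and zero: "\<zero>\<^bsub>O_P\<^esub> = \<zero>\<^bsub>Q\<^esub>"
    by (simp_all add: O_P_def)
  show "n \<in> nucleus Q" if n: "n \<in> nucleus O_P" for n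
  proof (rule nucleus_completionI)
    show nO: "n \<in> completion"
      using n by (simp add: nucleus_def carrier)
    fix a b assume ab: "a \<in> carrier P" "b \<in> carrier P"
    then have "a \<in> carrier O_P" "b \<in> carrier O_P"
      by (simp_all add: carrier P_completion)
    then show "associator Q n a b = \<zero>\<^bsub>Q\<^esub>"
      using n subalgebra_of_associator[OF O_P_subalgebra, of n a b] by (auto simp: nucleus_def zero)
  qed
  fix x y assume "x \<in> carrier Q" "y \<in> carrier Q" "x \<noteq> \<zero>\<^bsub>Q\<^esub>"
  then obtain z where z: "z \<in> nucleus P" "x \<otimes>\<^bsub>Q\<^esub> z \<noteq> \<zero>\<^bsub>Q\<^esub>" "y \<otimes>\<^bsub>Q\<^esub> z \<in> carrier P"
    by (rule quotient_denominator)
  moreover have "z \<in> nucleus O_P"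
    using z(1) by (intro nucleus_subalgebra[OF O_P_subalgebra]) (simp_all add: nucleus_P carrier P_completion)
  ultimately show "\<exists>z\<in>nucleus O_P. x \<otimes>\<^bsub>Q\<^esub> z \<noteq> \<zero>\<^bsub>Q\<^esub> \<and> y \<otimes>\<^bsub>Q\<^esub> z \<in> carrier O_P"
    by (auto simp: carrier P_completion)
qed (rule Q.alternative_algebra_axioms O_P_subalgebra)+

end

section \<open>Ultrafilters of idempotents and the ideals they define\<close>

context cring
begin

lemma ultrafilter_mult: "\<lbrakk>boolean_ultrafilter R B; b \<in> B; c \<in> B\<rbrakk> \<Longrightarrow> b \<otimes> c \<in> B"
  by (simp add: boolean_ultrafilter_def)

lemma ultrafilter_complement:
  assumes B: "boolean_ultrafilter R B" and e: "e \<in> idempotents R"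
  shows "e \<notin> B \<longleftrightarrow> \<one> \<ominus> e \<in> B"
proof
  show "\<one> \<ominus> e \<in> B" if "e \<notin> B"
    using B e that by (auto simp: boolean_ultrafilter_def)
  show "e \<notin> B" if "\<one> \<ominus> e \<in> B"
  proof
    assume "e \<in> B"
    then have "\<zero> \<in> B"
      using ultrafilter_mult[OF B, of e "\<one> \<ominus> e"] that idempotents_complement[OF e] by simp
    then show False
      using B by (auto simp: boolean_ultrafilter_def)
  qed
qed

lemma ultrafilter_one:
  assumes "boolean_ultrafilter R B"
  shows "\<one> \<in> B"
proof -
  have "\<zero> \<notin> B"
    using assms by (auto simp: boolean_ultrafilter_def)
  then have "\<one> \<ominus> \<zero> \<in> B"
    using ultrafilter_complement[OF assms idempotents_zero] by simp
  then show ?thesis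
    by (simp add: a_minus_def)
qed

end

locale ultra_algebra = plain_algebra +
  fixes B
  assumes ultrafilter: "boolean_ultrafilter K B"
begin

lemma ultrafilter_closed: "b \<in> B \<Longrightarrow> b \<in> carrier K"
  using R.boolean_ultrafilter_closed[OF ultrafilter] R.idempotents_closed by blast

text \<open>If x = e y with e outside \<open>B\<close>, then 1 - e lies in \<open>B\<close> and
  kills x. Conversely b x = 0 gives x = (1 - b) x with 1 - b outside \<open>B\<close>.\<close>

lemma ultra_ideal_iff: "x \<in> ultra_ideal K A B \<longleftrightarrow> x \<in> carrier A \<and> (\<exists>b\<in>B. b \<odot>\<^bsub>A\<^esub> x = \<zero>\<^bsub>A\<^esub>)"
proof
  assume "x \<in> ultra_ideal K A B"
  then obtain e y where x: "x \<in> carrier A" "x = e \<odot>\<^bsub>A\<^esub> y" and e: "e \<in> idempotents K" "e \<notin> B"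
    and y: "y \<in> carrier A"
    by (auto simp: ultra_ideal_def)
  note comp = R.idempotents_complement[OF e(1)]
  have "(\<one> \<ominus> e) \<odot>\<^bsub>A\<^esub> x = ((\<one> \<ominus> e) \<otimes> e) \<odot>\<^bsub>A\<^esub> y"
    using x e y R.idempotents_closed[OF comp(1)] R.idempotents_closed[OF e(1)]
    by (simp add: smult_assoc1)
  also have "\<dots> = \<zero>\<^bsub>A\<^esub>"
    using comp(2) y by simp
  finally show "x \<in> carrier A \<and> (\<exists>b\<in>B. b \<odot>\<^bsub>A\<^esub> x = \<zero>\<^bsub>A\<^esub>)"
    using x(1) R.ultrafilter_complement[OF ultrafilter e(1)] e(2) by blast
next
  assume "x \<in> carrier A \<and> (\<exists>b\<in>B. b \<odot>\<^bsub>A\<^esub> x = \<zero>\<^bsub>A\<^esub>)"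
  then obtain b where x: "x \<in> carrier A" and b: "b \<in> B" "b \<odot>\<^bsub>A\<^esub> x = \<zero>\<^bsub>A\<^esub>"
    by blast
  have bi: "b \<in> idempotents K"
    using ultrafilter b(1) by (rule R.boolean_ultrafilter_closed)
  then have bc: "b \<in> carrier K"
    by (rule R.idempotents_closed)
  have "(\<one> \<ominus> b) \<odot>\<^bsub>A\<^esub> x = x"
    using x b bc by (simp add: a_minus_def smult_l_distr smult_l_minus M_minus_zero)
  moreover have "\<one> \<ominus> b \<in> idempotents K - B"
    using R.idempotents_complement(1)[OF bi] R.ultrafilter_complement[OF ultrafilter bi] b(1)
      R.ultrafilter_complement[OF ultrafilter R.idempotents_complement(1)[OF bi]]
    by auto
  ultimately have "\<exists>e y. x = e \<odot>\<^bsub>A\<^esub> y \<and> e \<in> idempotents K - B \<and> y \<in> carrier A"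
    using x by metis
  then show "x \<in> ultra_ideal K A B"
    using x unfolding ultra_ideal_def by blast
qed

lemma ultra_idealI: "\<lbrakk>x \<in> carrier A; b \<in> B; b \<odot>\<^bsub>A\<^esub> x = \<zero>\<^bsub>A\<^esub>\<rbrakk> \<Longrightarrow> x \<in> ultra_ideal K A B"
  using ultra_ideal_iff by blast

text \<open>The product of a member of \<open>B\<close> killing x and one killing y lies in
  \<open>B\<close> and kills x + y; the other closure properties keep the same member.\<close>

lemma ultra_ideal: "algebra_ideal K A (ultra_ideal K A B)"
  unfolding algebra_ideal_def
proof (intro conjI ballI)
  show "submodule (ultra_ideal K A B) K A"
  proof (rule submoduleI_smult)
    show "\<zero>\<^bsub>A\<^esub> \<in> ultra_ideal K A B"
      by (rule ultra_idealI[OF _ R.ultrafilter_one[OF ultrafilter]]) simp_all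
    show "x \<oplus>\<^bsub>A\<^esub> y \<in> ultra_ideal K A B"
      if xI: "x \<in> ultra_ideal K A B" and yI: "y \<in> ultra_ideal K A B" for x y
    proof -
      obtain b where x: "x \<in> carrier A" and b: "b \<in> B" "b \<odot>\<^bsub>A\<^esub> x = \<zero>\<^bsub>A\<^esub>"
        using xI ultra_ideal_iff by blast
      obtain c where y: "y \<in> carrier A" and c: "c \<in> B" "c \<odot>\<^bsub>A\<^esub> y = \<zero>\<^bsub>A\<^esub>"
        using yI ultra_ideal_iff by blast
      note bc = ultrafilter_closed[OF b(1)] ultrafilter_closed[OF c(1)]
      have "(b \<otimes> c) \<odot>\<^bsub>A\<^esub> x = c \<odot>\<^bsub>A\<^esub> (b \<odot>\<^bsub>A\<^esub> x)"
        using bc x by (simp add: R.m_comm[of b c] smult_assoc1)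
      moreover have "(b \<otimes> c) \<odot>\<^bsub>A\<^esub> y = b \<odot>\<^bsub>A\<^esub> (c \<odot>\<^bsub>A\<^esub> y)"
        using bc y by (simp add: smult_assoc1)
      ultimately have "(b \<otimes> c) \<odot>\<^bsub>A\<^esub> (x \<oplus>\<^bsub>A\<^esub> y) = \<zero>\<^bsub>A\<^esub>"
        using bc x y b c by (simp add: smult_r_distr)
      then show ?thesis
        using x y R.ultrafilter_mult[OF ultrafilter b(1) c(1)] by (intro ultra_idealI) simp_all
    qed
    show "c \<odot>\<^bsub>A\<^esub> x \<in> ultra_ideal K A B" if c: "c \<in> carrier K" and xI: "x \<in> ultra_ideal K A B" for c x
    proof -
      obtain b where x: "x \<in> carrier A" and b: "b \<in> B" "b \<odot>\<^bsub>A\<^esub> x = \<zero>\<^bsub>A\<^esub>"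
        using xI ultra_ideal_iff by blast
      have "b \<odot>\<^bsub>A\<^esub> (c \<odot>\<^bsub>A\<^esub> x) = c \<odot>\<^bsub>A\<^esub> (b \<odot>\<^bsub>A\<^esub> x)"
        using ultrafilter_closed[OF b(1)] c x by (simp add: R.m_comm flip: smult_assoc1)
      then show ?thesis
        using b c x by (intro ultra_idealI[OF _ b(1)]) simp_all
    qed
  qed (auto simp: ultra_ideal_iff)
  fix x y assume x: "x \<in> carrier A" and yI: "y \<in> ultra_ideal K A B"
  obtain b where y: "y \<in> carrier A" and b: "b \<in> B" "b \<odot>\<^bsub>A\<^esub> y = \<zero>\<^bsub>A\<^esub>"
    using yI ultra_ideal_iff by blast
  note bc = ultrafilter_closed[OF b(1)]
  have "b \<odot>\<^bsub>A\<^esub> (x \<otimes>\<^bsub>A\<^esub> y) = x \<otimes>\<^bsub>A\<^esub> (b \<odot>\<^bsub>A\<^esub> y)" "b \<odot>\<^bsub>A\<^esub> (y \<otimes>\<^bsub>A\<^esub> x) = (b \<odot>\<^bsub>A\<^esub> y) \<otimes>\<^bsub>A\<^esub> x"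
    using bc x y by (simp_all add: smult_mult_l smult_mult_r)
  then show "x \<otimes>\<^bsub>A\<^esub> y \<in> ultra_ideal K A B" "y \<otimes>\<^bsub>A\<^esub> x \<in> ultra_ideal K A B"
    using x y b(2) by (auto intro!: ultra_idealI[OF _ b(1)] simp: mult_closed mult_zero_left mult_zero_right)
qed

sublocale algebra_quotient K A "ultra_ideal K A B"
  by unfold_locales (rule ultra_ideal)

end

section \<open>The quotients of Q and of the completion at an ultrafilter\<close>

locale ultra_max_quotient = supported_max_quotient +
  fixes B
  assumes ultrafilter: "boolean_ultrafilter C B"
begin

sublocale U: ultra_algebra C Q B
  by unfold_locales (rule ultrafilter)

sublocale OA: alternative_algebra C O_P
  using O_P_subalgebra Q.alternative_algebra_axioms by (rule subalgebra_of_alternative)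

sublocale V: ultra_algebra C O_P B
  by unfold_locales (rule ultrafilter)

abbreviation Q_B where "Q_B \<equiv> ultra_quotient C Q B"

abbreviation O_P_B where "O_P_B \<equiv> ultra_quotient C O_P B"

abbreviation coset where "coset x \<equiv> ultra_ideal C Q B +>\<^bsub>Q\<^esub> x"

abbreviation O_coset where "O_coset x \<equiv> ultra_ideal C O_P B +>\<^bsub>O_P\<^esub> x"

lemma O_P_ops:
  "carrier O_P = completion" "x \<oplus>\<^bsub>O_P\<^esub> y = x \<oplus>\<^bsub>Q\<^esub> y" "x \<otimes>\<^bsub>O_P\<^esub> y = x \<otimes>\<^bsub>Q\<^esub> y"
  "c \<odot>\<^bsub>O_P\<^esub> x = c \<odot>\<^bsub>Q\<^esub> x" "\<zero>\<^bsub>O_P\<^esub> = \<zero>\<^bsub>Q\<^esub>"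
  by (simp_all add: O_P_def)

lemma O_P_ultra_ideal: "x \<in> ultra_ideal C O_P B \<longleftrightarrow> x \<in> completion \<and> x \<in> ultra_ideal C Q B"
  by (auto simp: U.ultra_ideal_iff V.ultra_ideal_iff O_P_ops completion_closed)

text \<open>Representatives of a coset in the completion differ by elements of its ultrafilter
  ideal, which is contained in that of \<open>Q\<close>, so the union consists of one coset
  only.\<close>

lemma ultra_map_coset:
  assumes "x \<in> completion"
  shows "ultra_map C Q B (O_coset x) = coset x"
proof -
  have "coset y = coset x" if "y \<in> O_coset x" for y
  proof -
    obtain h where "h \<in> ultra_ideal C O_P B" "y = h \<oplus>\<^bsub>O_P\<^esub> x"
      using \<open>y \<in> O_coset x\<close> by (rule V.coset_memE)
    then show ?thesis
      using assms by (simp add: O_P_ultra_ideal O_P_ops U.coset_add_absorb completion_closed)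
  qed
  then have "ultra_map C Q B (O_coset x) = (\<Union>y\<in>O_coset x. coset x)"
    unfolding ultra_map_def by (intro SUP_cong refl)
  also have "\<dots> = coset x"
    using V.I.a_rcos_self[of x] assms by (auto simp: O_P_ops)
  finally show ?thesis .
qed

lemma O_P_B_carrier: "carrier O_P_B = O_coset ` completion"
  unfolding ultra_quotient_def by (simp add: V.quotient_carrier O_P_ops)

lemma Q_B_carrier: "carrier Q_B = coset ` carrier Q"
  unfolding ultra_quotient_def by (rule U.quotient_carrier)

lemma ultra_map_image: "ultra_map C Q B ` carrier O_P_B = coset ` completion"
  unfolding O_P_B_carrier image_image by (intro image_cong refl ultra_map_coset)

lemma Q_B_ops:
  assumes "x \<in> carrier Q" "y \<in> carrier Q"
  shows "coset x \<oplus>\<^bsub>Q_B\<^esub> coset y = coset (x \<oplus>\<^bsub>Q\<^esub> y)"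
    and "coset x \<otimes>\<^bsub>Q_B\<^esub> coset y = coset (x \<otimes>\<^bsub>Q\<^esub> y)"
    and "c \<in> carrier C \<Longrightarrow> c \<odot>\<^bsub>Q_B\<^esub> coset x = coset (c \<odot>\<^bsub>Q\<^esub> x)"
  using assms by (simp_all add: ultra_quotient_def U.quotient_ops)

lemma O_P_B_ops:
  assumes "x \<in> completion" "y \<in> completion"
  shows "O_coset x \<oplus>\<^bsub>O_P_B\<^esub> O_coset y = O_coset (x \<oplus>\<^bsub>Q\<^esub> y)"
    and "O_coset x \<otimes>\<^bsub>O_P_B\<^esub> O_coset y = O_coset (x \<otimes>\<^bsub>Q\<^esub> y)"
    and "c \<in> carrier C \<Longrightarrow> c \<odot>\<^bsub>O_P_B\<^esub> O_coset x = O_coset (c \<odot>\<^bsub>Q\<^esub> x)"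
  using assms V.quotient_add[of x y] V.quotient_mult[of x y] V.quotient_smult[of c x]
  by (simp_all add: ultra_quotient_def O_P_ops)

lemma Q_B_zero: "\<zero>\<^bsub>Q_B\<^esub> = ultra_ideal C Q B"
  by (simp add: ultra_quotient_def U.quotient_zero)

lemma coset_zero_iff: "x \<in> carrier Q \<Longrightarrow> coset x = \<zero>\<^bsub>Q_B\<^esub> \<longleftrightarrow> (\<exists>b\<in>B. b \<odot>\<^bsub>Q\<^esub> x = \<zero>\<^bsub>Q\<^esub>)"
  by (simp add: Q_B_zero U.coset_zero_iff U.ultra_ideal_iff)

sublocale QB: alternative_algebra C Q_B
  unfolding ultra_quotient_def
  by (rule U.quotient_alternative_algebra) (rule Q.alternative_algebra_axioms)

sublocale QB: plain_alternative_algebra C Q_B ..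

lemma completion_ops:
  assumes "x \<in> completion" "y \<in> completion"
  shows "x \<oplus>\<^bsub>Q\<^esub> y \<in> completion" "x \<otimes>\<^bsub>Q\<^esub> y \<in> completion" "c \<in> carrier C \<Longrightarrow> c \<odot>\<^bsub>Q\<^esub> x \<in> completion"
  using assms Q.submoduleE(4,5)[OF completion_submodule] completion_mult by simp_all

text \<open>Injectivity comes from \<open>O_P_ultra_ideal\<close>: whether a member of
  \<open>B\<close> kills an element does not depend on the algebra in which this is asked.\<close>

lemma ultra_map_embedding: "algebra_embedding C O_P_B Q_B (ultra_map C Q B)"
  unfolding algebra_embedding_def
proof (intro conjI ballI)
  show "nonassoc_algebra C O_P_B"
    unfolding ultra_quotient_def by (rule V.quotient_nonassoc_algebra)
  show "nonassoc_algebra C Q_B"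
    by (rule QB.nonassoc_algebra_axioms)
  show "ultra_map C Q B \<in> carrier O_P_B \<rightarrow> carrier Q_B"
    unfolding Pi_iff O_P_B_carrier Q_B_carrier
    using completion_closed by (auto simp: ultra_map_coset)
  show "inj_on (ultra_map C Q B) (carrier O_P_B)"
  proof (rule inj_onI)
    fix X Y assume XY: "X \<in> carrier O_P_B" "Y \<in> carrier O_P_B"
      and eq: "ultra_map C Q B X = ultra_map C Q B Y"
    obtain x where x: "x \<in> completion" "X = O_coset x"
      using XY(1) unfolding O_P_B_carrier by blast
    obtain y where y: "y \<in> completion" "Y = O_coset y"
      using XY(2) unfolding O_P_B_carrier by blast
    have minus: "x \<ominus>\<^bsub>O_P\<^esub> y = x \<ominus>\<^bsub>Q\<^esub> y"
      using x(1) y(1) by (intro subalgebra_of_minus[OF O_P_subalgebra]) (simp_all add: O_P_ops)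
    have "x \<ominus>\<^bsub>O_P\<^esub> y \<in> completion"
      using x(1) y(1) OA.M.minus_closed[of x y] by (simp add: O_P_ops)
    moreover have "x \<ominus>\<^bsub>Q\<^esub> y \<in> ultra_ideal C Q B"
      using eq x y U.coset_eq_iff[of x y] by (simp add: ultra_map_coset completion_closed)
    ultimately have "x \<ominus>\<^bsub>O_P\<^esub> y \<in> ultra_ideal C O_P B"
      by (simp add: O_P_ultra_ideal minus)
    then show "X = Y"
      using x y V.coset_eq_iff[of x y] by (simp add: O_P_ops)
  qed
  fix X Y assume XY: "X \<in> carrier O_P_B" "Y \<in> carrier O_P_B"
  obtain x where x: "x \<in> completion" "X = O_coset x"
    using XY(1) unfolding O_P_B_carrier by blast
  obtain y where y: "y \<in> completion" "Y = O_coset y"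
    using XY(2) unfolding O_P_B_carrier by blast
  note xyQ = completion_closed[OF x(1)] completion_closed[OF y(1)]
  show "ultra_map C Q B (X \<oplus>\<^bsub>O_P_B\<^esub> Y) = ultra_map C Q B X \<oplus>\<^bsub>Q_B\<^esub> ultra_map C Q B Y"
    using x y xyQ by (simp add: O_P_B_ops Q_B_ops ultra_map_coset completion_ops)
  show "ultra_map C Q B (X \<otimes>\<^bsub>O_P_B\<^esub> Y) = ultra_map C Q B X \<otimes>\<^bsub>Q_B\<^esub> ultra_map C Q B Y"
    using x y xyQ by (simp add: O_P_B_ops Q_B_ops ultra_map_coset completion_ops)
next
  fix c X assume c: "c \<in> carrier C" and X: "X \<in> carrier O_P_B"
  obtain x where x: "x \<in> completion" "X = O_coset x"
    using X unfolding O_P_B_carrier by blast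
  show "ultra_map C Q B (c \<odot>\<^bsub>O_P_B\<^esub> X) = c \<odot>\<^bsub>Q_B\<^esub> ultra_map C Q B X"
    using c x completion_closed[OF x(1)]
    by (simp add: O_P_B_ops(3)[OF _ x(1)] Q_B_ops(3)[of x x] ultra_map_coset completion_ops(3)[of x x])
qed

text \<open>A quotient of the completion consists of smaller cosets than those of
  \<open>Q_B\<close>, whereas \<open>right_quotient_algebra\<close> asks for a literal subalgebra;
  its image under the embedding is one.\<close>

definition O_image where "O_image = Q_B\<lparr>carrier := coset ` completion\<rparr>"

lemma O_image_subalgebra: "subalgebra_of C O_image Q_B"
  unfolding O_image_def
proof (rule QB.subalgebra_restrict[OF QB.submoduleI_smult])
  show "coset ` completion \<subseteq> carrier Q_B"
    unfolding Q_B_carrier using completion_closed by blast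
  show "\<zero>\<^bsub>Q_B\<^esub> \<in> coset ` completion"
  proof -
    have "\<zero>\<^bsub>Q_B\<^esub> = coset \<zero>\<^bsub>Q\<^esub>"
      by (simp add: Q_B_zero U.ideal_subset)
    then show ?thesis
      using P_completion[OF P_zero_closed] by blast
  qed
  show "X \<oplus>\<^bsub>Q_B\<^esub> Y \<in> coset ` completion" "X \<otimes>\<^bsub>Q_B\<^esub> Y \<in> coset ` completion"
    if X: "X \<in> coset ` completion" and Y: "Y \<in> coset ` completion" for X Y
  proof -
    obtain x where x: "x \<in> completion" "X = coset x" using X by blast
    obtain y where y: "y \<in> completion" "Y = coset y" using Y by blast
    show "X \<oplus>\<^bsub>Q_B\<^esub> Y \<in> coset ` completion" "X \<otimes>\<^bsub>Q_B\<^esub> Y \<in> coset ` completion"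
      using x y by (simp_all add: Q_B_ops completion_closed completion_ops)
  qed
  show "c \<odot>\<^bsub>Q_B\<^esub> X \<in> coset ` completion" if c: "c \<in> carrier C" and X: "X \<in> coset ` completion" for c X
  proof -
    obtain x where x: "x \<in> completion" "X = coset x" using X by blast
    then show ?thesis
      using c by (simp add: Q_B_ops(3)[of x x] completion_closed completion_ops(3)[of x x])
  qed
qed

lemma O_image_carrier: "carrier O_image = coset ` completion"
  by (simp add: O_image_def)

section \<open>Nuclear elements and denominators modulo an ultrafilter\<close>

lemma Q_B_associator_zero_iff:
  assumes "x \<in> carrier Q" "y \<in> carrier Q" "z \<in> carrier Q"
  shows "associator Q_B (coset x) (coset y) (coset z) = \<zero>\<^bsub>Q_B\<^esub>
    \<longleftrightarrow> (\<exists>b\<in>B. b \<odot>\<^bsub>Q\<^esub> associator Q x y z = \<zero>\<^bsub>Q\<^esub>)"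
proof -
  have "associator Q_B (coset x) (coset y) (coset z) = \<zero>\<^bsub>Q_B\<^esub>
      \<longleftrightarrow> coset ((x \<otimes>\<^bsub>Q\<^esub> y) \<otimes>\<^bsub>Q\<^esub> z) = coset (x \<otimes>\<^bsub>Q\<^esub> (y \<otimes>\<^bsub>Q\<^esub> z))"
    using assms by (subst QB.associator_eq_zero_iff) (simp_all add: Q_B_carrier Q_B_ops Q.mult_closed)
  also have "\<dots> \<longleftrightarrow> associator Q x y z \<in> ultra_ideal C Q B"
    unfolding associator_def using assms by (intro U.coset_eq_iff) (simp_all add: Q.mult_closed)
  finally show ?thesis
    using assms by (simp add: U.ultra_ideal_iff Q.associator_closed)
qed

lemma nucleus_Q_B:
  assumes "n \<in> carrier Q" "b \<in> B" "\<And>x y. \<lbrakk>x \<in> carrier Q; y \<in> carrier Q\<rbrakk> \<Longrightarrow> b \<odot>\<^bsub>Q\<^esub> associator Q n x y = \<zero>\<^bsub>Q\<^esub>"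
  shows "coset n \<in> nucleus Q_B"
proof (rule QB.nucleusI)
  show "coset n \<in> carrier Q_B"
    using assms(1) by (simp add: Q_B_carrier)
  fix X Y assume XY: "X \<in> carrier Q_B" "Y \<in> carrier Q_B"
  obtain x where x: "x \<in> carrier Q" "X = coset x" using XY(1) unfolding Q_B_carrier by blast
  obtain y where y: "y \<in> carrier Q" "Y = coset y" using XY(2) unfolding Q_B_carrier by blast
  show "associator Q_B (coset n) X Y = \<zero>\<^bsub>Q_B\<^esub>"
    unfolding x(2) y(2) Q_B_associator_zero_iff[OF assms(1) x(1) y(1)]
    using assms(2,3) x(1) y(1) by blast
qed

text \<open>For each x and y in the completion some member of \<open>B\<close> kills (n, x, y), and
  \<open>uniform_vanishing\<close> produces one b for all of them. Then b n is nuclear in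
  \<open>Q\<close> by \<open>nucleus_completionI\<close>, so b kills (n, x, y) even for all x and y
  in \<open>Q\<close>.\<close>

lemma nucleus_O_image:
  assumes N: "N \<in> nucleus O_image"
  shows "N \<in> nucleus Q_B"
proof -
  obtain n where n: "n \<in> completion" "N = coset n"
    using N by (auto simp: nucleus_def O_image_carrier)
  have nQ: "n \<in> carrier Q"
    using n(1) by (rule completion_closed)
  \<comment> \<open>The arguments range over the completion: the hypothesis reaches no further, and
    over \<open>P\<close> alone the set would not have to be closed under gluing.\<close>
  define G where "G = {associator Q n x y | x y. x \<in> completion \<and> y \<in> completion}"
  have "\<exists>b\<in>B. \<forall>g\<in>G. b \<odot>\<^bsub>Q\<^esub> g = \<zero>\<^bsub>Q\<^esub>"
  proof (rule Q.uniform_vanishing[OF orthogonally_complete ultrafilter])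
    show "G \<subseteq> carrier Q"
      using nQ by (auto simp: G_def completion_closed Q.associator_closed)
    show "G \<noteq> {}"
      using n(1) by (auto simp: G_def)
    show "\<exists>b\<in>B. b \<odot>\<^bsub>Q\<^esub> g = \<zero>\<^bsub>Q\<^esub>" if g: "g \<in> G" for g
    proof -
      obtain x y where xy: "x \<in> completion" "y \<in> completion" "g = associator Q n x y"
        using g by (auto simp: G_def)
      have "associator Q_B N (coset x) (coset y) = associator O_image N (coset x) (coset y)"
        using n xy by (intro subalgebra_of_associator[OF O_image_subalgebra, symmetric])
          (simp_all add: O_image_carrier)
      also have "\<dots> = \<zero>\<^bsub>Q_B\<^esub>"
        using N xy by (simp add: nucleus_def O_image_carrier) (simp add: O_image_def)
      finally show ?thesis
        using n nQ xy by (simp add: Q_B_associator_zero_iff completion_closed)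
    qed
    \<comment> \<open>A gluing of associators is the associator of glued arguments: the factor d can
      be moved from one argument to another, so x(d) and y(d) are replaced in turn by x' and
      y'.\<close>
    fix D u t assume D: "dense_orthogonal C D" and u: "u \<in> D \<rightarrow> G" and t: "t \<in> carrier Q"
      and tu: "\<And>d. d \<in> D \<Longrightarrow> d \<odot>\<^bsub>Q\<^esub> t = d \<odot>\<^bsub>Q\<^esub> u d"
    have "\<forall>d\<in>D. \<exists>x y. x \<in> completion \<and> y \<in> completion \<and> u d = associator Q n x y"
      using u unfolding G_def Pi_iff by blast
    then obtain x y where xc: "\<And>d. d \<in> D \<Longrightarrow> x d \<in> completion" and yc: "\<And>d. d \<in> D \<Longrightarrow> y d \<in> completion"
      and uxy: "\<And>d. d \<in> D \<Longrightarrow> u d = associator Q n (x d) (y d)"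
      by metis
    obtain x' where x': "x' \<in> completion" "\<forall>d\<in>D. d \<odot>\<^bsub>Q\<^esub> x' = d \<odot>\<^bsub>Q\<^esub> x d"
      using D xc by (rule completion_glue)
    obtain y' where y': "y' \<in> completion" "\<forall>d\<in>D. d \<odot>\<^bsub>Q\<^esub> y' = d \<odot>\<^bsub>Q\<^esub> y d"
      using D yc by (rule completion_glue)
    note xyQ = completion_closed[OF x'(1)] completion_closed[OF y'(1)]
    have "t = associator Q n x' y'"
    proof (rule Q.dense_orthogonal_cancel[OF D t])
      show "associator Q n x' y' \<in> carrier Q"
        using nQ xyQ by (rule Q.associator_closed)
      fix d assume d: "d \<in> D"
      note dc = Q.dense_orthogonal_closed[OF D d]
      note c = completion_closed[OF xc[OF d]] completion_closed[OF yc[OF d]]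
      have "d \<odot>\<^bsub>Q\<^esub> t = associator Q n (d \<odot>\<^bsub>Q\<^esub> x d) (y d)"
        using tu[OF d] uxy[OF d] dc c nQ by (simp add: Q.associator_smult_2)
      also have "\<dots> = associator Q n (d \<odot>\<^bsub>Q\<^esub> x') (y d)"
        using x'(2) d by simp
      also have "\<dots> = associator Q n x' (d \<odot>\<^bsub>Q\<^esub> y d)"
        using dc c nQ xyQ by (simp add: Q.associator_smult_2 Q.associator_smult_3)
      also have "\<dots> = associator Q n x' (d \<odot>\<^bsub>Q\<^esub> y')"
        using y'(2) d by simp
      also have "\<dots> = d \<odot>\<^bsub>Q\<^esub> associator Q n x' y'"
        using dc nQ xyQ by (simp add: Q.associator_smult_3)
      finally show "d \<odot>\<^bsub>Q\<^esub> t = d \<odot>\<^bsub>Q\<^esub> associator Q n x' y'" .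
    qed
    then show "t \<in> G"
      using x'(1) y'(1) unfolding G_def by blast
  qed
  then obtain b where b: "b \<in> B" and bG: "\<And>g. g \<in> G \<Longrightarrow> b \<odot>\<^bsub>Q\<^esub> g = \<zero>\<^bsub>Q\<^esub>"
    by blast
  have bc: "b \<in> carrier C"
    using b by (rule U.ultrafilter_closed)
  have "b \<odot>\<^bsub>Q\<^esub> n \<in> nucleus Q"
  proof (rule nucleus_completionI)
    show "b \<odot>\<^bsub>Q\<^esub> n \<in> completion"
      using bc n(1) by (simp add: completion_ops(3)[of n n])
    fix x y assume xy: "x \<in> carrier P" "y \<in> carrier P"
    then have "associator Q n x y \<in> G"
      using P_completion unfolding G_def by blast
    then show "associator Q (b \<odot>\<^bsub>Q\<^esub> n) x y = \<zero>\<^bsub>Q\<^esub>"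
      using bG bc nQ xy by (simp add: Q.associator_smult_1 P_subset)
  qed
  then have "b \<odot>\<^bsub>Q\<^esub> associator Q n x y = \<zero>\<^bsub>Q\<^esub>" if "x \<in> carrier Q" "y \<in> carrier Q" for x y
    using that bc nQ by (simp add: nucleus_def Q.associator_smult_1)
  then show ?thesis
    unfolding n(2) using nQ b by (intro nucleus_Q_B)
qed

text \<open>The assumption on x says that its coset is nonzero. A single denominator from
  \<open>P\<close> could make x z vanish modulo \<open>B\<close>, so denominators are chosen
  locally, with x z of full support wherever x does not vanish, and then glued.\<close>

lemma glued_denominator:
  assumes x: "x \<in> carrier Q" and y: "y \<in> carrier Q" and nz: "\<And>b. b \<in> B \<Longrightarrow> b \<odot>\<^bsub>Q\<^esub> x \<noteq> \<zero>\<^bsub>Q\<^esub>"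
  obtains z where "z \<in> completion" "z \<in> nucleus Q" "y \<otimes>\<^bsub>Q\<^esub> z \<in> completion"
    "\<And>b. b \<in> B \<Longrightarrow> b \<odot>\<^bsub>Q\<^esub> (x \<otimes>\<^bsub>Q\<^esub> z) \<noteq> \<zero>\<^bsub>Q\<^esub>"
proof -
  define good where "good d z \<longleftrightarrow> z \<in> nucleus P \<and> y \<otimes>\<^bsub>Q\<^esub> z \<in> carrier P \<and>
    (d \<odot>\<^bsub>Q\<^esub> x = \<zero>\<^bsub>Q\<^esub> \<or>
      (\<forall>c\<in>idempotents C. (c \<otimes> d) \<odot>\<^bsub>Q\<^esub> (x \<otimes>\<^bsub>Q\<^esub> z) = \<zero>\<^bsub>Q\<^esub> \<longrightarrow> c \<otimes> d = \<zero>))" for d z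
  define T where "T = {d \<in> idempotents C. \<exists>z. good d z}"
  have "\<exists>d\<in>T. d \<noteq> \<zero> \<and> b \<otimes> d = d" if b: "b \<in> idempotents C" "b \<noteq> \<zero>" for b
  proof (cases "b \<odot>\<^bsub>Q\<^esub> x = \<zero>\<^bsub>Q\<^esub>")
    case True
    \<comment> \<open>Where x vanishes, no condition is put on x z, so z = 0 is a valid
      choice.\<close>
    then have "good b \<zero>\<^bsub>Q\<^esub>"
      using y Q.nucleus_zero by (simp add: good_def nucleus_P P_zero_closed Q.mult_zero_right)
    then show ?thesis
      using b by (auto simp: T_def P.R.idempotents_idem)
  next
    case False
    have bc: "b \<in> carrier C"
      using b(1) by (rule P.R.idempotents_closed)
    obtain z where z: "z \<in> nucleus P" "(b \<odot>\<^bsub>Q\<^esub> x) \<otimes>\<^bsub>Q\<^esub> z \<noteq> \<zero>\<^bsub>Q\<^esub>" "y \<otimes>\<^bsub>Q\<^esub> z \<in> carrier P"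
      using quotient_denominator[of "b \<odot>\<^bsub>Q\<^esub> x" y] bc x y False by auto
    have zQ: "z \<in> carrier Q"
      using z(1) by (simp add: nucleus_P P_subset)
    have nz': "b \<odot>\<^bsub>Q\<^esub> (x \<otimes>\<^bsub>Q\<^esub> z) \<noteq> \<zero>\<^bsub>Q\<^esub>"
      using z(2) bc x zQ by (simp add: Q.smult_mult_l)
    obtain e where e: "e \<in> idempotents C" "e \<noteq> \<zero>" "b \<otimes> e = e"
      and cancel: "\<And>c. \<lbrakk>c \<in> idempotents C; (c \<otimes> e) \<odot>\<^bsub>Q\<^esub> (x \<otimes>\<^bsub>Q\<^esub> z) = \<zero>\<^bsub>Q\<^esub>\<rbrakk> \<Longrightarrow> c \<otimes> e = \<zero>"
      using Q.support_below[OF Q.mult_closed[OF x zQ] b(1) nz'] by metis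
    have "good e z"
      using z cancel by (simp add: good_def)
    then show ?thesis
      using e by (auto simp: T_def)
  qed
  then obtain D where DT: "D \<subseteq> T" and D: "dense_orthogonal C D"
    using P.R.obtain_dense_orthogonal[of T] by (auto simp: T_def)
  have "\<forall>d\<in>D. \<exists>z. good d z"
    using DT by (auto simp: T_def)
  then obtain z where z: "\<And>d. d \<in> D \<Longrightarrow> good d (z d)"
    by metis
  have zP: "z d \<in> carrier P" "z d \<in> nucleus Q" "z d \<in> carrier Q" if "d \<in> D" for d
    using z[OF that] by (auto simp: good_def nucleus_P P_subset)
  obtain t where t: "t \<in> completion" "\<forall>d\<in>D. d \<odot>\<^bsub>Q\<^esub> t = d \<odot>\<^bsub>Q\<^esub> z d"
    using D P_completion[OF zP(1)] by (rule completion_glue)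
  have tQ: "t \<in> carrier Q"
    using t(1) by (rule completion_closed)
  have eq: "d \<odot>\<^bsub>Q\<^esub> (v \<otimes>\<^bsub>Q\<^esub> t) = d \<odot>\<^bsub>Q\<^esub> (v \<otimes>\<^bsub>Q\<^esub> z d)" if d: "d \<in> D" and v: "v \<in> carrier Q" for d v
  proof -
    have "d \<odot>\<^bsub>Q\<^esub> (v \<otimes>\<^bsub>Q\<^esub> t) = v \<otimes>\<^bsub>Q\<^esub> (d \<odot>\<^bsub>Q\<^esub> t)"
      using Q.dense_orthogonal_closed[OF D d] v tQ by (simp add: Q.smult_mult_r)
    also have "\<dots> = v \<otimes>\<^bsub>Q\<^esub> (d \<odot>\<^bsub>Q\<^esub> z d)"
      using t(2) d by simp
    also have "\<dots> = d \<odot>\<^bsub>Q\<^esub> (v \<otimes>\<^bsub>Q\<^esub> z d)"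
      using Q.dense_orthogonal_closed[OF D d] v zP(3)[OF d] by (simp add: Q.smult_mult_r)
    finally show ?thesis .
  qed
  have "t \<in> nucleus Q"
  proof (rule nucleus_completionI[OF t(1)])
    fix a b assume ab: "a \<in> carrier P" "b \<in> carrier P"
    then have abQ: "a \<in> carrier Q" "b \<in> carrier Q"
      by (simp_all add: P_subset)
    show "associator Q t a b = \<zero>\<^bsub>Q\<^esub>"
    proof (rule Q.dense_orthogonal_cancel_zero[OF D])
      show "associator Q t a b \<in> carrier Q"
        using tQ abQ by (rule Q.associator_closed)
      fix d assume d: "d \<in> D"
      note dc = Q.dense_orthogonal_closed[OF D d]
      have "d \<odot>\<^bsub>Q\<^esub> associator Q t a b = associator Q (d \<odot>\<^bsub>Q\<^esub> z d) a b"
        using t(2) d dc tQ abQ by (simp flip: Q.associator_smult_1)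
      also have "\<dots> = \<zero>\<^bsub>Q\<^esub>"
        using Q.nucleus_smult[OF dc zP(2)[OF d]] abQ by (simp add: nucleus_def)
      finally show "d \<odot>\<^bsub>Q\<^esub> associator Q t a b = \<zero>\<^bsub>Q\<^esub>" .
    qed
  qed
  moreover have "y \<otimes>\<^bsub>Q\<^esub> t \<in> completion"
  proof (rule completionI[OF _ D])
    show "y \<otimes>\<^bsub>Q\<^esub> t \<in> carrier Q"
      using y tQ by (rule Q.mult_closed)
    show "d \<odot>\<^bsub>Q\<^esub> (y \<otimes>\<^bsub>Q\<^esub> t) \<in> carrier P" if d: "d \<in> D" for d
      using eq[OF d y] z[OF d] Q.dense_orthogonal_closed[OF D d] by (simp add: good_def P_smult_closed)
  qed
  moreover have "b \<odot>\<^bsub>Q\<^esub> (x \<otimes>\<^bsub>Q\<^esub> t) \<noteq> \<zero>\<^bsub>Q\<^esub>" if b: "b \<in> B" for b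
  proof
    assume zero: "b \<odot>\<^bsub>Q\<^esub> (x \<otimes>\<^bsub>Q\<^esub> t) = \<zero>\<^bsub>Q\<^esub>"
    have bi: "b \<in> idempotents C"
      using ultrafilter b by (rule P.R.boolean_ultrafilter_closed)
    then have bc: "b \<in> carrier C"
      by (rule P.R.idempotents_closed)
    have "b \<odot>\<^bsub>Q\<^esub> x = \<zero>\<^bsub>Q\<^esub>"
    proof (rule Q.dense_orthogonal_cancel_zero[OF D])
      show "b \<odot>\<^bsub>Q\<^esub> x \<in> carrier Q"
        using bc x by simp
      fix d assume d: "d \<in> D"
      note dc = Q.dense_orthogonal_closed[OF D d]
      have xz: "x \<otimes>\<^bsub>Q\<^esub> z d \<in> carrier Q" "x \<otimes>\<^bsub>Q\<^esub> t \<in> carrier Q"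
        using x zP(3)[OF d] tQ by (simp_all add: Q.mult_closed)
      have "(b \<otimes> d) \<odot>\<^bsub>Q\<^esub> (x \<otimes>\<^bsub>Q\<^esub> z d) = b \<odot>\<^bsub>Q\<^esub> (d \<odot>\<^bsub>Q\<^esub> (x \<otimes>\<^bsub>Q\<^esub> t))"
        using eq[OF d x] bc dc xz by (simp add: Q.smult_assoc1)
      also have "\<dots> = d \<odot>\<^bsub>Q\<^esub> (b \<odot>\<^bsub>Q\<^esub> (x \<otimes>\<^bsub>Q\<^esub> t))"
        using bc dc xz by (simp add: P.R.m_comm flip: Q.smult_assoc1)
      also have "\<dots> = \<zero>\<^bsub>Q\<^esub>"
        using zero dc by simp
      \<comment> \<open>Since b d kills x z(d), the two alternatives in \<open>good\<close> leave
        only that x vanishes on d or that b d = 0; in both cases d kills b x.\<close>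
      finally have "d \<odot>\<^bsub>Q\<^esub> x = \<zero>\<^bsub>Q\<^esub> \<or> b \<otimes> d = \<zero>"
        using z[OF d] bi by (auto simp: good_def)
      moreover have "d \<odot>\<^bsub>Q\<^esub> (b \<odot>\<^bsub>Q\<^esub> x) = (b \<otimes> d) \<odot>\<^bsub>Q\<^esub> x" "d \<odot>\<^bsub>Q\<^esub> (b \<odot>\<^bsub>Q\<^esub> x) = b \<odot>\<^bsub>Q\<^esub> (d \<odot>\<^bsub>Q\<^esub> x)"
        using bc dc x by (simp_all add: P.R.m_comm flip: Q.smult_assoc1)
      ultimately show "d \<odot>\<^bsub>Q\<^esub> (b \<odot>\<^bsub>Q\<^esub> x) = \<zero>\<^bsub>Q\<^esub>"
        using bc x by auto
    qed
    then show False
      using nz[OF b] by simp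
  qed
  ultimately show ?thesis
    using that t(1) by blast
qed

lemma O_image_right_quotient: "right_quotient_algebra C O_image Q_B"
  unfolding right_quotient_algebra_def
proof (intro conjI ballI impI subsetI)
  show "alternative_algebra C O_image"
    using O_image_subalgebra QB.alternative_algebra_axioms by (rule subalgebra_of_alternative)
  show "N \<in> nucleus Q_B" if "N \<in> nucleus O_image" for N
    using that by (rule nucleus_O_image)
  fix X Y assume XY: "X \<in> carrier Q_B" "Y \<in> carrier Q_B" and X0: "X \<noteq> \<zero>\<^bsub>Q_B\<^esub>"
  obtain x where x: "x \<in> carrier Q" "X = coset x" using XY(1) unfolding Q_B_carrier by blast
  obtain y where y: "y \<in> carrier Q" "Y = coset y" using XY(2) unfolding Q_B_carrier by blast
  have nz: "b \<odot>\<^bsub>Q\<^esub> x \<noteq> \<zero>\<^bsub>Q\<^esub>" if "b \<in> B" for b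
    using X0 that x coset_zero_iff by blast
  obtain z where z: "z \<in> completion" "z \<in> nucleus Q" "y \<otimes>\<^bsub>Q\<^esub> z \<in> completion"
    and xz: "\<And>b. b \<in> B \<Longrightarrow> b \<odot>\<^bsub>Q\<^esub> (x \<otimes>\<^bsub>Q\<^esub> z) \<noteq> \<zero>\<^bsub>Q\<^esub>"
    using glued_denominator[OF x(1) y(1) nz] by metis
  have zQ: "z \<in> carrier Q"
    using z(1) by (rule completion_closed)
  have "coset z \<in> nucleus Q_B"
    using z(2) by (intro nucleus_Q_B[OF zQ P.R.ultrafilter_one[OF ultrafilter]]) (simp add: nucleus_def)
  then have "coset z \<in> nucleus O_image"
    using z(1) by (intro nucleus_subalgebra[OF O_image_subalgebra]) (simp_all add: O_image_carrier)
  moreover have "X \<otimes>\<^bsub>Q_B\<^esub> coset z \<noteq> \<zero>\<^bsub>Q_B\<^esub>"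
    using xz x zQ by (auto simp: Q_B_ops coset_zero_iff Q.mult_closed)
  moreover have "Y \<otimes>\<^bsub>Q_B\<^esub> coset z \<in> carrier O_image"
    using y zQ z(3) by (simp add: Q_B_ops O_image_carrier)
  ultimately show "\<exists>Z\<in>nucleus O_image. X \<otimes>\<^bsub>Q_B\<^esub> Z \<noteq> \<zero>\<^bsub>Q_B\<^esub> \<and> Y \<otimes>\<^bsub>Q_B\<^esub> Z \<in> carrier O_image"
    by blast
qed (rule QB.alternative_algebra_axioms O_image_subalgebra)+

end

section \<open>Right modules and essential submodules\<close>

context right_module
begin

lemma act_zero_ring: "x \<in> carrier M \<Longrightarrow> \<zero>\<^bsub>S\<^esub> \<odot>\<^bsub>M\<^esub> x = \<zero>\<^bsub>M\<^esub>"
  using act_add_ring[of "\<zero>\<^bsub>S\<^esub>" "\<zero>\<^bsub>S\<^esub>" x] act_closed[of "\<zero>\<^bsub>S\<^esub>" x]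
  by (metis S.add.r_cancel_one' S.l_zero S.zero_closed M.add.r_cancel_one')

lemma act_zero: "s \<in> carrier S \<Longrightarrow> s \<odot>\<^bsub>M\<^esub> \<zero>\<^bsub>M\<^esub> = \<zero>\<^bsub>M\<^esub>"
  using act_add[of s "\<zero>\<^bsub>M\<^esub>" "\<zero>\<^bsub>M\<^esub>"] act_closed[of s "\<zero>\<^bsub>M\<^esub>"]
  by (metis M.l_zero M.zero_closed M.add.r_cancel_one')

lemma act_neg:
  assumes "s \<in> carrier S" "x \<in> carrier M"
  shows "s \<odot>\<^bsub>M\<^esub> (\<ominus>\<^bsub>M\<^esub> x) = \<ominus>\<^bsub>M\<^esub> (s \<odot>\<^bsub>M\<^esub> x)"
proof -
  have "s \<odot>\<^bsub>M\<^esub> (\<ominus>\<^bsub>M\<^esub> x) \<oplus>\<^bsub>M\<^esub> s \<odot>\<^bsub>M\<^esub> x = \<zero>\<^bsub>M\<^esub>"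
    using assms act_add[of s "\<ominus>\<^bsub>M\<^esub> x" x] by (simp add: M.l_neg act_zero)
  then show ?thesis
    using assms M.minus_equality act_closed M.add.inv_closed by metis
qed

lemma submoduleI_act:
  assumes "U \<subseteq> carrier M" "\<zero>\<^bsub>M\<^esub> \<in> U"
    and "\<And>x y. \<lbrakk>x \<in> U; y \<in> U\<rbrakk> \<Longrightarrow> x \<oplus>\<^bsub>M\<^esub> y \<in> U"
    and "\<And>s x. \<lbrakk>s \<in> carrier S; x \<in> U\<rbrakk> \<Longrightarrow> s \<odot>\<^bsub>M\<^esub> x \<in> U"
  shows "submodule U S M"
proof -
  have neg: "\<ominus>\<^bsub>M\<^esub> x \<in> U" if x: "x \<in> U" for x
  proof -
    have xM: "x \<in> carrier M" using x assms(1) by blast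
    have "(\<ominus>\<^bsub>S\<^esub> \<one>\<^bsub>S\<^esub>) \<odot>\<^bsub>M\<^esub> x \<oplus>\<^bsub>M\<^esub> \<one>\<^bsub>S\<^esub> \<odot>\<^bsub>M\<^esub> x = \<zero>\<^bsub>M\<^esub>"
      using xM by (simp add: S.l_neg act_zero_ring flip: act_add_ring)
    then have "\<ominus>\<^bsub>M\<^esub> x = (\<ominus>\<^bsub>S\<^esub> \<one>\<^bsub>S\<^esub>) \<odot>\<^bsub>M\<^esub> x"
      using xM by (intro M.minus_equality) (simp_all add: act_one act_closed)
    then show ?thesis using assms(4)[OF _ x] by simp
  qed
  have "subgroup U (add_monoid M)"
    by (rule subgroup.intro) (use assms neg in \<open>auto simp: a_inv_def\<close>)
  then show ?thesis
    using assms(4) by (simp add: submodule_def submodule_axioms_def)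
qed

text \<open>\<open>submodule\<close> only means an additive subgroup closed under the action, so it
  can be used over the noncommutative ring \<open>S\<close>.\<close>

lemma submodule_act:
  assumes "submodule U S M"
  shows "\<And>x. x \<in> U \<Longrightarrow> x \<in> carrier M"
    and "\<zero>\<^bsub>M\<^esub> \<in> U"
    and "\<And>x y. \<lbrakk>x \<in> U; y \<in> U\<rbrakk> \<Longrightarrow> x \<oplus>\<^bsub>M\<^esub> y \<in> U"
    and "\<And>x. x \<in> U \<Longrightarrow> \<ominus>\<^bsub>M\<^esub> x \<in> U"
    and "\<And>s x. \<lbrakk>s \<in> carrier S; x \<in> U\<rbrakk> \<Longrightarrow> s \<odot>\<^bsub>M\<^esub> x \<in> U"
proof -
  have sub: "subgroup U (add_monoid M)"
    using assms by (rule submodule.axioms)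
  show "x \<in> carrier M" if "x \<in> U" for x
    using subgroup.subset[OF sub] that by auto
  show "\<zero>\<^bsub>M\<^esub> \<in> U"
    using subgroup.one_closed[OF sub] by simp
  show "x \<oplus>\<^bsub>M\<^esub> y \<in> U" if "x \<in> U" "y \<in> U" for x y
    using subgroup.m_closed[OF sub that] by simp
  show "\<ominus>\<^bsub>M\<^esub> x \<in> U" if "x \<in> U" for x
    using subgroup.m_inv_closed[OF sub that] by (simp add: a_inv_def)
  show "s \<odot>\<^bsub>M\<^esub> x \<in> U" if "s \<in> carrier S" "x \<in> U" for s x
    using submodule.smult_closed[OF assms that] .
qed

lemma submodule_act_inter:
  assumes "submodule U S M" "submodule V S M"
  shows "submodule (U \<inter> V) S M"
  using submodule_act[OF assms(1)] submodule_act[OF assms(2)]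
  by (intro submoduleI_act) auto

lemma submodule_act_sum:
  assumes U: "submodule U S M" and V: "submodule V S M"
  shows "submodule {u \<oplus>\<^bsub>M\<^esub> v | u v. u \<in> U \<and> v \<in> V} S M" (is "submodule ?W S M")
proof (rule submoduleI_act)
  note U = submodule_act[OF U] and V = submodule_act[OF V]
  show "?W \<subseteq> carrier M"
    using U(1) V(1) by auto
  have "\<zero>\<^bsub>M\<^esub> \<oplus>\<^bsub>M\<^esub> \<zero>\<^bsub>M\<^esub> \<in> ?W"
    using U(2) V(2) by blast
  then show "\<zero>\<^bsub>M\<^esub> \<in> ?W"
    by simp
  show "x \<oplus>\<^bsub>M\<^esub> y \<in> ?W" if xW: "x \<in> ?W" and yW: "y \<in> ?W" for x y
  proof -
    obtain u v where x: "u \<in> U" "v \<in> V" "x = u \<oplus>\<^bsub>M\<^esub> v" using xW by blast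
    obtain u' v' where y: "u' \<in> U" "v' \<in> V" "y = u' \<oplus>\<^bsub>M\<^esub> v'" using yW by blast
    have "x \<oplus>\<^bsub>M\<^esub> y = (u \<oplus>\<^bsub>M\<^esub> u') \<oplus>\<^bsub>M\<^esub> (v \<oplus>\<^bsub>M\<^esub> v')"
      using x y U(1) V(1) by (simp add: M.a_ac)
    then show ?thesis
      using U(3)[OF x(1) y(1)] V(3)[OF x(2) y(2)] by blast
  qed
  show "s \<odot>\<^bsub>M\<^esub> x \<in> ?W" if s: "s \<in> carrier S" and xW: "x \<in> ?W" for s x
  proof -
    obtain u v where x: "u \<in> U" "v \<in> V" "x = u \<oplus>\<^bsub>M\<^esub> v" using xW by blast
    have "s \<odot>\<^bsub>M\<^esub> x = s \<odot>\<^bsub>M\<^esub> u \<oplus>\<^bsub>M\<^esub> s \<odot>\<^bsub>M\<^esub> v"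
      using s x U(1) V(1) by (simp add: act_add)
    then show ?thesis
      using U(5)[OF s x(1)] V(5)[OF s x(2)] by blast
  qed
qed

lemma submodule_act_cyclic:
  assumes p: "p \<in> carrier M"
  shows "submodule {s \<odot>\<^bsub>M\<^esub> p | s. s \<in> carrier S} S M"
proof (rule submoduleI_act)
  show "\<zero>\<^bsub>M\<^esub> \<in> {s \<odot>\<^bsub>M\<^esub> p | s. s \<in> carrier S}"
    using act_zero_ring[OF p] S.zero_closed by force
  show "x \<oplus>\<^bsub>M\<^esub> y \<in> {s \<odot>\<^bsub>M\<^esub> p | s. s \<in> carrier S}"
    if xy: "x \<in> {s \<odot>\<^bsub>M\<^esub> p | s. s \<in> carrier S}" "y \<in> {s \<odot>\<^bsub>M\<^esub> p | s. s \<in> carrier S}" for x y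
  proof -
    obtain s t where "s \<in> carrier S" "t \<in> carrier S" "x = s \<odot>\<^bsub>M\<^esub> p" "y = t \<odot>\<^bsub>M\<^esub> p"
      using xy by blast
    then have "x \<oplus>\<^bsub>M\<^esub> y = (s \<oplus>\<^bsub>S\<^esub> t) \<odot>\<^bsub>M\<^esub> p" "s \<oplus>\<^bsub>S\<^esub> t \<in> carrier S"
      using p by (simp_all add: act_add_ring)
    then show ?thesis
      by blast
  qed
  show "s \<odot>\<^bsub>M\<^esub> x \<in> {s \<odot>\<^bsub>M\<^esub> p | s. s \<in> carrier S}"
    if s: "s \<in> carrier S" and x: "x \<in> {s \<odot>\<^bsub>M\<^esub> p | s. s \<in> carrier S}" for s x
  proof -
    obtain t where "t \<in> carrier S" "x = t \<odot>\<^bsub>M\<^esub> p"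
      using x by blast
    then have "s \<odot>\<^bsub>M\<^esub> x = (t \<otimes>\<^bsub>S\<^esub> s) \<odot>\<^bsub>M\<^esub> p" "t \<otimes>\<^bsub>S\<^esub> s \<in> carrier S"
      using p s by (simp_all add: act_mult)
    then show ?thesis
      by blast
  qed
qed (use act_closed p in auto)

definition essential where
  "essential L \<longleftrightarrow> (\<forall>V. submodule V S M \<longrightarrow> V \<noteq> {\<zero>\<^bsub>M\<^esub>} \<longrightarrow> V \<inter> L \<noteq> {\<zero>\<^bsub>M\<^esub>})"

text \<open>By Zorn, W is a maximal submodule meeting U trivially. If V meets U + W trivially, then
  W + V still meets U trivially, so W + V = W. Hence V is contained in W and so in U + W, which
  forces V = 0.\<close>

lemma obtain_complement:
  assumes U: "submodule U S M"
  obtains W where "submodule W S M" "U \<inter> W = {\<zero>\<^bsub>M\<^esub>}"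
    "essential {u \<oplus>\<^bsub>M\<^esub> w | u w. u \<in> U \<and> w \<in> W}"
proof -
  define \<A> where "\<A> = {W. submodule W S M \<and> U \<inter> W = {\<zero>\<^bsub>M\<^esub>}}"
  have "\<exists>W\<in>\<A>. \<forall>X\<in>\<A>. W \<subseteq> X \<longrightarrow> X = W"
  proof (rule subset_Zorn_nonempty)
    have "submodule {\<zero>\<^bsub>M\<^esub>} S M"
      by (rule submoduleI_act) (simp_all add: act_zero)
    then have "{\<zero>\<^bsub>M\<^esub>} \<in> \<A>"
      using submodule_act(2)[OF U] by (auto simp: \<A>_def)
    then show "\<A> \<noteq> {}" by blast
    fix \<C> assume ne: "\<C> \<noteq> {}" and ch: "subset.chain \<A> \<C>"
    have sub: "\<And>X. X \<in> \<C> \<Longrightarrow> submodule X S M" "\<And>X. X \<in> \<C> \<Longrightarrow> U \<inter> X = {\<zero>\<^bsub>M\<^esub>}"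
      and tot: "\<And>X Y. \<lbrakk>X \<in> \<C>; Y \<in> \<C>\<rbrakk> \<Longrightarrow> X \<subseteq> Y \<or> Y \<subseteq> X"
      using ch by (auto simp: subset_chain_def \<A>_def)
    have "submodule (\<Union>\<C>) S M"
    proof (rule submoduleI_act)
      show "\<Union>\<C> \<subseteq> carrier M"
        using submodule_act(1)[OF sub(1)] by blast
      show "\<zero>\<^bsub>M\<^esub> \<in> \<Union>\<C>"
        using ne submodule_act(2)[OF sub(1)] by blast
      show "x \<oplus>\<^bsub>M\<^esub> y \<in> \<Union>\<C>" if xy: "x \<in> \<Union>\<C>" "y \<in> \<Union>\<C>" for x y
      proof -
        obtain X Y where XY: "X \<in> \<C>" "Y \<in> \<C>" "x \<in> X" "y \<in> Y" using xy by blast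
        then obtain Z where "Z \<in> \<C>" "x \<in> Z" "y \<in> Z" using tot[of X Y] by blast
        then show ?thesis using submodule_act(3)[OF sub(1)] by blast
      qed
      show "s \<odot>\<^bsub>M\<^esub> x \<in> \<Union>\<C>" if "s \<in> carrier S" "x \<in> \<Union>\<C>" for s x
        using that submodule_act(5)[OF sub(1)] by blast
    qed
    moreover have "U \<inter> \<Union>\<C> = {\<zero>\<^bsub>M\<^esub>}"
      using sub(2) ne by blast
    ultimately show "\<Union>\<C> \<in> \<A>" by (simp add: \<A>_def)
  qed
  then obtain W where WA: "W \<in> \<A>" and max: "\<And>X. \<lbrakk>X \<in> \<A>; W \<subseteq> X\<rbrakk> \<Longrightarrow> X = W" by blast
  have W: "submodule W S M" and UW: "U \<inter> W = {\<zero>\<^bsub>M\<^esub>}"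
    using WA by (simp_all add: \<A>_def)
  note U' = submodule_act[OF U] and W' = submodule_act[OF W]
  let ?L = "{u \<oplus>\<^bsub>M\<^esub> w | u w. u \<in> U \<and> w \<in> W}"
  have "V = {\<zero>\<^bsub>M\<^esub>}" if V: "submodule V S M" and VL: "V \<inter> ?L = {\<zero>\<^bsub>M\<^esub>}" for V
  proof -
    note V' = submodule_act[OF V]
    let ?X = "{w \<oplus>\<^bsub>M\<^esub> v | w v. w \<in> W \<and> v \<in> V}"
    have in_L: "x \<in> ?L" if x: "x \<in> W" for x
    proof -
      have "\<zero>\<^bsub>M\<^esub> \<oplus>\<^bsub>M\<^esub> x \<in> ?L" using U'(2) x by blast
      then show ?thesis using W'(1)[OF x] by simp
    qed
    have "x = \<zero>\<^bsub>M\<^esub>" if x: "x \<in> U" "x \<in> ?X" for x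
    proof -
      obtain w v where wv: "w \<in> W" "v \<in> V" "x = w \<oplus>\<^bsub>M\<^esub> v" using x(2) by blast
      have carr: "w \<in> carrier M" "v \<in> carrier M" using wv W'(1) V'(1) by auto
      \<comment> \<open>Solving for v exhibits it as an element of U + W, where V has only
        0.\<close>
      have "v = x \<oplus>\<^bsub>M\<^esub> \<ominus>\<^bsub>M\<^esub> w"
        using carr wv(3) M.r_neg1[of w v] by (simp add: M.a_comm)
      then have "v \<in> ?L" using x(1) W'(4)[OF wv(1)] by blast
      then have "v = \<zero>\<^bsub>M\<^esub>" using VL wv(2) by blast
      then have "x = w" using wv carr by simp
      then show ?thesis using x(1) wv(1) UW by blast
    qed
    moreover have X: "submodule ?X S M" using W V by (rule submodule_act_sum)
    ultimately have "U \<inter> ?X = {\<zero>\<^bsub>M\<^esub>}"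
      using U'(2) submodule_act(2)[OF X] by blast
    then have "?X \<in> \<A>"
      using X unfolding \<A>_def by simp
    moreover have "W \<subseteq> ?X"
    proof
      fix x assume x: "x \<in> W"
      then have "x \<oplus>\<^bsub>M\<^esub> \<zero>\<^bsub>M\<^esub> \<in> ?X" using V'(2) by blast
      then show "x \<in> ?X" using W'(1)[OF x] by simp
    qed
    ultimately have XW: "?X = W" by (rule max)
    have "x = \<zero>\<^bsub>M\<^esub>" if x: "x \<in> V" for x
    proof -
      have "\<zero>\<^bsub>M\<^esub> \<oplus>\<^bsub>M\<^esub> x \<in> ?X" using W'(2) x by blast
      then have "x \<in> ?L" using V'(1)[OF x] XW in_L by simp
      then show ?thesis using VL x by blast
    qed
    then show ?thesis using V'(2) by blast
  qed
  then have "essential ?L"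
    unfolding essential_def by blast
  then show ?thesis
    using that W UW by blast
qed

end

section \<open>Homomorphisms and the extension property\<close>

lemma right_module_homD:
  assumes "f \<in> right_module_hom S M N"
  shows "x \<in> carrier M \<Longrightarrow> f x \<in> carrier N"
    and "\<lbrakk>x \<in> carrier M; y \<in> carrier M\<rbrakk> \<Longrightarrow> f (x \<oplus>\<^bsub>M\<^esub> y) = f x \<oplus>\<^bsub>N\<^esub> f y"
    and "\<lbrakk>s \<in> carrier S; x \<in> carrier M\<rbrakk> \<Longrightarrow> f (s \<odot>\<^bsub>M\<^esub> x) = s \<odot>\<^bsub>N\<^esub> f x"
  using assms by (auto simp: right_module_hom_def)

lemma right_module_hom_zero:
  assumes "right_module S M" "right_module S N" "f \<in> right_module_hom S M N"
  shows "f \<zero>\<^bsub>M\<^esub> = \<zero>\<^bsub>N\<^esub>"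
proof -
  interpret M: right_module S M by fact
  interpret N: right_module S N by fact
  have "f (\<zero>\<^bsub>S\<^esub> \<odot>\<^bsub>M\<^esub> \<zero>\<^bsub>M\<^esub>) = \<zero>\<^bsub>S\<^esub> \<odot>\<^bsub>N\<^esub> f \<zero>\<^bsub>M\<^esub>"
    using assms(3) by (simp add: right_module_homD(3))
  then show ?thesis
    using right_module_homD(1)[OF assms(3)] by (simp add: M.act_zero_ring N.act_zero_ring)
qed

lemma right_module_hom_neg:
  assumes "right_module S M" "right_module S N" "f \<in> right_module_hom S M N" "x \<in> carrier M"
  shows "f (\<ominus>\<^bsub>M\<^esub> x) = \<ominus>\<^bsub>N\<^esub> f x"
proof -
  interpret M: right_module S M by fact
  interpret N: right_module S N by fact
  have "f (\<ominus>\<^bsub>M\<^esub> x) \<oplus>\<^bsub>N\<^esub> f x = f (\<ominus>\<^bsub>M\<^esub> x \<oplus>\<^bsub>M\<^esub> x)"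
    using assms(3,4) by (simp add: right_module_homD(2))
  also have "\<dots> = \<zero>\<^bsub>N\<^esub>"
    using assms right_module_hom_zero[OF assms(1-3)] by (simp add: M.M.l_neg)
  finally show ?thesis
    using assms(3,4) by (intro N.M.minus_equality[symmetric]) (simp_all add: right_module_homD(1))
qed

text \<open>
  The modules tested in \<open>injective_right_module\<close> have elements of the element type of \<open>S\<close>; an
  injection of types transports the extension property to other element types.
\<close>

lemma injective_right_module_extend:
  fixes S :: "('s, 'k) ring_scheme" and N :: "('s, 'b) module" and i :: "'b \<Rightarrow> 's"
  assumes E: "injective_right_module S E" and N: "right_module S N" and U: "submodule U S N"
    and f: "f \<in> right_module_hom S (N\<lparr>carrier := U\<rparr>) E" and i: "inj i"
  shows "\<exists>g\<in>right_module_hom S N E. \<forall>u\<in>U. g u = f u"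
proof -
  interpret N: right_module S N by (rule N)
  \<comment> \<open>The injection need not be onto; \<open>j\<close> inverts it on its range, where
    the carrier of the transported module lies.\<close>
  define j where "j = inv_into UNIV i"
  have ji [simp]: "j (i x) = x" for x
    using i by (simp add: j_def)
  define N' :: "('s, 's) module" where
    "N' = \<lparr>carrier = i ` carrier N, monoid.mult = undefined, one = undefined, zero = i \<zero>\<^bsub>N\<^esub>,
      add = (\<lambda>a b. i (j a \<oplus>\<^bsub>N\<^esub> j b)), smult = (\<lambda>s a. i (s \<odot>\<^bsub>N\<^esub> j a))\<rparr>"
  have ops [simp]: "carrier N' = i ` carrier N" "\<zero>\<^bsub>N'\<^esub> = i \<zero>\<^bsub>N\<^esub>"
    "a \<oplus>\<^bsub>N'\<^esub> b = i (j a \<oplus>\<^bsub>N\<^esub> j b)" "s \<odot>\<^bsub>N'\<^esub> a = i (s \<odot>\<^bsub>N\<^esub> j a)" for a b s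
    by (simp_all add: N'_def)
  have "abelian_group N'"
  proof (rule abelian_groupI)
    fix a assume "a \<in> carrier N'"
    then obtain x where x: "x \<in> carrier N" "a = i x" by auto
    then show "\<exists>b\<in>carrier N'. b \<oplus>\<^bsub>N'\<^esub> a = \<zero>\<^bsub>N'\<^esub>"
      by (intro bexI[of _ "i (\<ominus>\<^bsub>N\<^esub> x)"]) (simp_all add: N.M.l_neg)
  qed (auto simp: N.M.a_ac)
  moreover have "right_module_axioms S N'"
    by unfold_locales (auto simp: N.act_closed N.act_add_ring N.act_add N.act_mult N.act_one)
  ultimately have N': "right_module S N'"
    using N.S.ring_axioms by (simp add: right_module_def)
  interpret N': right_module S N' by (rule N')
  note Ua = N.submodule_act[OF U]
  have U': "submodule (i ` U) S N'"
    by (rule N'.submoduleI_act) (auto simp: Ua intro!: imageI)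
  have f': "(\<lambda>a. f (j a)) \<in> right_module_hom S (N'\<lparr>carrier := i ` U\<rparr>) E"
    using f by (auto simp: right_module_hom_def)
  obtain g where g: "g \<in> right_module_hom S N' E" "\<forall>u\<in>i ` U. g u = f (j u)"
    using E N' U' f' unfolding injective_right_module_def by blast
  have "(\<lambda>x. g (i x)) \<in> right_module_hom S N E"
  proof -
    have "g (i (x \<oplus>\<^bsub>N\<^esub> y)) = g (i x) \<oplus>\<^bsub>E\<^esub> g (i y)" if "x \<in> carrier N" "y \<in> carrier N" for x y
      using right_module_homD(2)[OF g(1), of "i x" "i y"] that by simp
    moreover have "g (i (s \<odot>\<^bsub>N\<^esub> x)) = s \<odot>\<^bsub>E\<^esub> g (i x)" if "s \<in> carrier S" "x \<in> carrier N" for s x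
      using right_module_homD(3)[OF g(1), of s "i x"] that by simp
    ultimately show ?thesis
      using right_module_homD(1)[OF g(1)] by (simp add: right_module_hom_def)
  qed
  then show ?thesis
    using g(2) by (intro bexI[of _ "\<lambda>x. g (i x)"]) auto
qed

section \<open>Supports in the central closure\<close>

context plain_algebra
begin

lemma multiplication_ringI:
  assumes "c \<in> carrier K" "s \<in> multiplication_algebra K A"
  shows "(\<lambda>y\<in>carrier A. c \<odot>\<^bsub>A\<^esub> y \<oplus>\<^bsub>A\<^esub> s y) \<in> carrier (multiplication_ring K A)"
  using assms unfolding multiplication_ring_def by auto

text \<open>With the right-hand and scalar versions, this shows that a submodule for the
  multiplication ring contained in the algebra is an ideal of it.\<close>

lemma multiplication_ring_left:
  assumes "x \<in> carrier A"
  shows "\<exists>s\<in>carrier (multiplication_ring K A). \<forall>y\<in>carrier A. s y = x \<otimes>\<^bsub>A\<^esub> y"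
proof (intro bexI ballI)
  let ?s = "\<lambda>y\<in>carrier A. \<zero> \<odot>\<^bsub>A\<^esub> y \<oplus>\<^bsub>A\<^esub> (\<lambda>y\<in>carrier A. x \<otimes>\<^bsub>A\<^esub> y) y"
  show "?s \<in> carrier (multiplication_ring K A)"
    using R.zero_closed multiplication_algebra.left_mult[OF assms] by (rule multiplication_ringI)
  show "?s y = x \<otimes>\<^bsub>A\<^esub> y" if "y \<in> carrier A" for y
    using that assms by (simp add: mult_closed)
qed

lemma multiplication_ring_right:
  assumes "x \<in> carrier A"
  shows "\<exists>s\<in>carrier (multiplication_ring K A). \<forall>y\<in>carrier A. s y = y \<otimes>\<^bsub>A\<^esub> x"
proof (intro bexI ballI)
  let ?s = "\<lambda>y\<in>carrier A. \<zero> \<odot>\<^bsub>A\<^esub> y \<oplus>\<^bsub>A\<^esub> (\<lambda>y\<in>carrier A. y \<otimes>\<^bsub>A\<^esub> x) y"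
  show "?s \<in> carrier (multiplication_ring K A)"
    using R.zero_closed multiplication_algebra.right_mult[OF assms] by (rule multiplication_ringI)
  show "?s y = y \<otimes>\<^bsub>A\<^esub> x" if "y \<in> carrier A" for y
    using that assms by (simp add: mult_closed)
qed

text \<open>An element of \<open>multiplication_ring\<close> needs a summand from
  \<open>multiplication_algebra\<close>; the zero operator is available there as left multiplication
  by 0.\<close>

lemma multiplication_ring_smult:
  assumes "c \<in> carrier K"
  shows "\<exists>s\<in>carrier (multiplication_ring K A). \<forall>y\<in>carrier A. s y = c \<odot>\<^bsub>A\<^esub> y"
proof (intro bexI ballI)
  let ?s = "\<lambda>y\<in>carrier A. c \<odot>\<^bsub>A\<^esub> y \<oplus>\<^bsub>A\<^esub> (\<lambda>y\<in>carrier A. \<zero>\<^bsub>A\<^esub> \<otimes>\<^bsub>A\<^esub> y) y"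
  show "?s \<in> carrier (multiplication_ring K A)"
    using assms multiplication_algebra.left_mult[OF M.zero_closed] by (rule multiplication_ringI)
  show "?s y = c \<odot>\<^bsub>A\<^esub> y" if "y \<in> carrier A" for y
    using that assms by (simp add: mult_zero_left)
qed

end

section \<open>The extended centroid acting on the central closure\<close>

locale semiprime_central_closure =
  R: plain_algebra F R + E: right_module "multiplication_ring F R" E +
  P: nonassoc_algebra "CM F R E" P
  for F :: "('f, 'k) ring_scheme" and R :: "('f, 'a) module" and E P :: "('a \<Rightarrow> 'a, 'a) module" +
  assumes semiprime: "semiprime_algebra F R"
    and hull: "injective_hull (multiplication_ring F R) (multiplication_module R) E"
    and closure: "is_central_closure F R E P"
begin

abbreviation S where "S \<equiv> multiplication_ring F R"

abbreviation C where "C \<equiv> CM F R E"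

lemma R_submodule: "submodule (carrier R) S E"
  using hull by (simp add: injective_hull_def multiplication_module_def)

lemma R_zero: "\<zero>\<^bsub>R\<^esub> = \<zero>\<^bsub>E\<^esub>"
  using hull by (simp add: injective_hull_def multiplication_module_def)

lemma R_add: "\<lbrakk>x \<in> carrier R; y \<in> carrier R\<rbrakk> \<Longrightarrow> x \<oplus>\<^bsub>R\<^esub> y = x \<oplus>\<^bsub>E\<^esub> y"
  using hull by (simp add: injective_hull_def multiplication_module_def)

lemma R_act: "\<lbrakk>s \<in> carrier S; x \<in> carrier R\<rbrakk> \<Longrightarrow> s \<odot>\<^bsub>E\<^esub> x = s x"
  using hull by (simp add: injective_hull_def multiplication_module_def)

lemma R_essential: "\<lbrakk>submodule U S E; U \<noteq> {\<zero>\<^bsub>E\<^esub>}\<rbrakk> \<Longrightarrow> U \<inter> carrier R \<noteq> {\<zero>\<^bsub>E\<^esub>}"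
  using hull by (simp add: injective_hull_def multiplication_module_def)

lemma E_injective: "injective_right_module S E"
  using hull by (simp add: injective_hull_def)

lemma E_right_module: "right_module S E"
  by unfold_locales

lemma P_carrier: "carrier P = closure_carrier F R E"
  using closure by (simp add: is_central_closure_def)

lemma P_zero: "\<zero>\<^bsub>P\<^esub> = \<zero>\<^bsub>E\<^esub>"
  using closure by (simp add: is_central_closure_def)

lemma P_add: "\<lbrakk>x \<in> carrier P; y \<in> carrier P\<rbrakk> \<Longrightarrow> x \<oplus>\<^bsub>P\<^esub> y = x \<oplus>\<^bsub>E\<^esub> y"
  using closure by (simp add: is_central_closure_def)

lemma P_smult: "\<lbrakk>c \<in> carrier C; x \<in> carrier P\<rbrakk> \<Longrightarrow> c \<odot>\<^bsub>P\<^esub> x = c x"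
  using closure by (simp add: is_central_closure_def)

lemma P_mult: "\<lbrakk>x \<in> carrier R; y \<in> carrier R\<rbrakk> \<Longrightarrow> x \<otimes>\<^bsub>P\<^esub> y = x \<otimes>\<^bsub>R\<^esub> y"
  using closure by (simp add: is_central_closure_def)

lemma C_carrier:
  "carrier C = right_module_hom S (E\<lparr>carrier := carrier P\<rparr>) (E\<lparr>carrier := carrier P\<rparr>) \<inter> extensional (carrier P)"
  by (simp add: CM_def endomorphism_ring_def P_carrier)

lemma C_zero: "\<zero>\<^bsub>C\<^esub> = (\<lambda>x\<in>carrier P. \<zero>\<^bsub>E\<^esub>)"
  by (simp add: CM_def endomorphism_ring_def P_carrier)

lemma C_mult: "c \<otimes>\<^bsub>C\<^esub> d = (\<lambda>x\<in>carrier P. c (d x))"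
  by (simp add: CM_def endomorphism_ring_def P_carrier)

lemma C_hom:
  assumes "c \<in> carrier C"
  shows "x \<in> carrier P \<Longrightarrow> c x \<in> carrier P"
    and "\<lbrakk>x \<in> carrier P; y \<in> carrier P\<rbrakk> \<Longrightarrow> c (x \<oplus>\<^bsub>E\<^esub> y) = c x \<oplus>\<^bsub>E\<^esub> c y"
    and "\<lbrakk>s \<in> carrier S; x \<in> carrier P\<rbrakk> \<Longrightarrow> c (s \<odot>\<^bsub>E\<^esub> x) = s \<odot>\<^bsub>E\<^esub> c x"
  using assms by (auto simp: C_carrier right_module_hom_def)

lemma C_zero_iff:
  assumes "c \<in> carrier C"
  shows "c = \<zero>\<^bsub>C\<^esub> \<longleftrightarrow> (\<forall>x\<in>carrier P. c x = \<zero>\<^bsub>E\<^esub>)"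
proof -
  have "c \<in> extensional (carrier P)"
    using assms by (simp add: C_carrier)
  then show ?thesis
    unfolding C_zero by (auto intro!: extensionalityI)
qed

definition generators where
  "generators = {\<alpha> x | \<alpha> x. \<alpha> \<in> carrier (endomorphism_ring S E) \<and> x \<in> carrier R}"

lemma P_generate: "carrier P = generate (add_monoid E) generators"
  by (simp add: P_carrier closure_carrier_def generators_def)

lemma R_closed: "x \<in> carrier R \<Longrightarrow> x \<in> carrier E"
  using E.submodule_act(1)[OF R_submodule] .

lemma endomorphismI:
  assumes "g \<in> right_module_hom S E E"
  shows "(\<lambda>x\<in>carrier E. g x) \<in> carrier (endomorphism_ring S E)"
  using assms by (auto simp: endomorphism_ring_def right_module_hom_def E.act_closed)

lemma generators_hom:
  assumes g: "g \<in> right_module_hom S E E" and x: "x \<in> generators"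
  shows "g x \<in> generators"
proof -
  obtain \<alpha> y where \<alpha>: "\<alpha> \<in> carrier (endomorphism_ring S E)" and y: "y \<in> carrier R" and xy: "x = \<alpha> y"
    using x by (auto simp: generators_def)
  have "\<alpha> \<in> right_module_hom S E E"
    using \<alpha> by (simp add: endomorphism_ring_def)
  then have "(\<lambda>x. g (\<alpha> x)) \<in> right_module_hom S E E"
    using right_module_homD[OF g] right_module_homD[of \<alpha> S E E]
    by (subst right_module_hom_def) auto
  then have "(\<lambda>x\<in>carrier E. g (\<alpha> x)) \<in> carrier (endomorphism_ring S E)"
    by (rule endomorphismI)
  moreover have "g x = (\<lambda>x\<in>carrier E. g (\<alpha> x)) y"
    using R_closed[OF y] xy by simp
  ultimately show ?thesis
    using y unfolding generators_def by blast
qed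

lemma R_generators: "x \<in> carrier R \<Longrightarrow> x \<in> generators"
proof -
  assume x: "x \<in> carrier R"
  have "(\<lambda>x. x) \<in> right_module_hom S E E"
    by (simp add: right_module_hom_def)
  then have "(\<lambda>x\<in>carrier E. x) \<in> carrier (endomorphism_ring S E)"
    using endomorphismI by blast
  moreover have "x = (\<lambda>x\<in>carrier E. x) x"
    using R_closed[OF x] by simp
  ultimately show ?thesis
    using x unfolding generators_def by blast
qed

lemma R_P: "x \<in> carrier R \<Longrightarrow> x \<in> carrier P"
  unfolding P_generate by (intro generate.incl R_generators)

lemma generators_closed: "x \<in> generators \<Longrightarrow> x \<in> carrier E"
  using R_closed by (auto simp: generators_def endomorphism_ring_def right_module_hom_def)

text \<open>The central closure is invariant under endomorphisms of the hull, since composing with g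
  sends generators to generators. Membership in \<open>E\<close> is carried along because additivity
  of g is needed in the induction.\<close>

lemma P_hom:
  assumes g: "g \<in> right_module_hom S E E" and x: "x \<in> carrier P"
  shows "x \<in> carrier E \<and> g x \<in> carrier P"
  using x unfolding P_generate
proof (induction rule: generate.induct)
  case one
  then show ?case
    using right_module_hom_zero[OF E_right_module E_right_module g] generate.one[of "add_monoid E"] by simp
next
  case (incl h)
  then show ?case
    using generators_closed generators_hom[OF g] by (auto intro: generate.incl)
next
  case (inv h)
  then have "inv\<^bsub>add_monoid E\<^esub> (g h) \<in> generate (add_monoid E) generators"
    using generators_hom[OF g] by (auto intro: generate.inv)
  then show ?case
    using generators_closed[OF inv] right_module_hom_neg[OF E_right_module E_right_module g generators_closed[OF inv]]
    by (simp flip: a_inv_def)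
next
  case (eng h1 h2)
  then show ?case
    using generate.eng[of "g h1" "add_monoid E" generators "g h2"] right_module_homD(2)[OF g] by simp
qed

text \<open>Endomorphisms commute with the action, so s moves past \<alpha> and acts on an element
  of \<open>R\<close>.\<close>

lemma generators_act:
  "x \<in> generators \<Longrightarrow> s \<in> carrier S \<Longrightarrow> s \<odot>\<^bsub>E\<^esub> x \<in> generators"
proof -
  assume x: "x \<in> generators" and s: "s \<in> carrier S"
  obtain \<alpha> y where \<alpha>: "\<alpha> \<in> carrier (endomorphism_ring S E)" and y: "y \<in> carrier R" and xy: "x = \<alpha> y"
    using x by (auto simp: generators_def)
  have "s \<odot>\<^bsub>E\<^esub> x = \<alpha> (s \<odot>\<^bsub>E\<^esub> y)"
    using \<alpha> s R_closed[OF y] xy by (auto simp: endomorphism_ring_def right_module_hom_def)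
  then show ?thesis
    using \<alpha> E.submodule_act(5)[OF R_submodule s y] unfolding generators_def by blast
qed

lemma P_closed: "x \<in> carrier P \<Longrightarrow> x \<in> carrier E"
proof -
  have "(\<lambda>x. x) \<in> right_module_hom S E E"
    by (simp add: right_module_hom_def)
  then show "x \<in> carrier P \<Longrightarrow> x \<in> carrier E"
    using P_hom by blast
qed

lemma P_submodule: "submodule (carrier P) S E"
proof (rule E.submoduleI_act)
  show "carrier P \<subseteq> carrier E"
    using P_closed by blast
  show "\<zero>\<^bsub>E\<^esub> \<in> carrier P"
    using P.M.zero_closed by (simp add: P_zero)
  show "x \<oplus>\<^bsub>E\<^esub> y \<in> carrier P" if "x \<in> carrier P" "y \<in> carrier P" for x y
    using P.M.a_closed[OF that] that by (simp add: P_add)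
  show "s \<odot>\<^bsub>E\<^esub> x \<in> carrier P" if s: "s \<in> carrier S" and x: "x \<in> carrier P" for s x
    using x unfolding P_generate
  proof (induction rule: generate.induct)
    case one
    then show ?case
      using s generate.one[of "add_monoid E"] by (simp add: E.act_zero)
  next
    case (incl h)
    then show ?case
      using generators_act[OF _ s] by (blast intro: generate.incl)
  next
    case (inv h)
    then have "inv\<^bsub>add_monoid E\<^esub> (s \<odot>\<^bsub>E\<^esub> h) \<in> generate (add_monoid E) generators"
      using generators_act[OF _ s] by (auto intro: generate.inv)
    then show ?case
      using E.act_neg[OF s generators_closed[OF inv]] by (simp flip: a_inv_def)
  next
    case (eng h1 h2)
    then have "h1 \<in> carrier E" "h2 \<in> carrier E"
      using P_closed by (simp_all add: P_generate)
    then show ?case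
      using eng generate.eng[of "s \<odot>\<^bsub>E\<^esub> h1" "add_monoid E" generators "s \<odot>\<^bsub>E\<^esub> h2"] s
      by (simp add: E.act_add)
  qed
qed

lemma restrict_hom:
  assumes "g \<in> right_module_hom S E E"
  shows "(\<lambda>x\<in>carrier P. g x) \<in> carrier C"
  using assms P_hom[OF assms] E.submodule_act[OF P_submodule]
  by (auto simp: C_carrier right_module_hom_def)

text \<open>
  For \<open>c \<noteq> 0\<close> vanishing on an essential submodule \<open>L\<close>, the ideal \<open>c P \<inter> L \<inter> R\<close> of \<open>R\<close> is nonzero,
  but its square vanishes because \<open>c x \<cdot> y = x \<cdot> c y\<close>.
\<close>

lemma vanish_essential:
  assumes c: "c \<in> carrier C" and L: "submodule L S E" and ess: "E.essential L"
    and zero: "\<And>x. \<lbrakk>x \<in> L; x \<in> carrier P\<rbrakk> \<Longrightarrow> c x = \<zero>\<^bsub>E\<^esub>"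
  shows "c = \<zero>\<^bsub>C\<^esub>"
proof (rule ccontr)
  assume "c \<noteq> \<zero>\<^bsub>C\<^esub>"
  then obtain x0 where x0: "x0 \<in> carrier P" "c x0 \<noteq> \<zero>\<^bsub>E\<^esub>"
    using C_zero_iff[OF c] by blast
  note PS = E.submodule_act[OF P_submodule]
  define V where "V = c ` carrier P"
  have V: "submodule V S E"
  proof (rule E.submoduleI_act)
    show "V \<subseteq> carrier E"
      using C_hom(1)[OF c] P_closed by (auto simp: V_def)
    have "c \<zero>\<^bsub>P\<^esub> = \<zero>\<^bsub>P\<^esub>"
      using P.smult_r_null[OF c] P_smult[OF c P.M.zero_closed] by simp
    then show "\<zero>\<^bsub>E\<^esub> \<in> V"
      using PS(2) by (force simp: V_def P_zero)
    show "x \<oplus>\<^bsub>E\<^esub> y \<in> V" if "x \<in> V" "y \<in> V" for x y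
      using that C_hom(2)[OF c, symmetric] PS(3) by (auto simp: V_def)
    show "s \<odot>\<^bsub>E\<^esub> x \<in> V" if "s \<in> carrier S" "x \<in> V" for s x
      using that C_hom(3)[OF c, symmetric] PS(5) by (auto simp: V_def)
  qed
  define J where "J = V \<inter> L \<inter> carrier R"
  have VL: "submodule (V \<inter> L) S E"
    using V L by (rule E.submodule_act_inter)
  have J: "submodule J S E"
    unfolding J_def using VL R_submodule by (rule E.submodule_act_inter)
  have "V \<noteq> {\<zero>\<^bsub>E\<^esub>}"
    using x0 by (auto simp: V_def)
  then have "V \<inter> L \<noteq> {\<zero>\<^bsub>E\<^esub>}"
    using ess V unfolding E.essential_def by blast
  \<comment> \<open>Essentiality is used twice: \<open>L\<close> meets the nonzero image
    \<open>V\<close>, and \<open>R\<close>, being essential in its hull, meets the result.\<close>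
  then have Jnz: "J \<noteq> {\<zero>\<^bsub>R\<^esub>}"
    unfolding J_def R_zero using VL by (intro R_essential)
  have JR: "x \<in> carrier R" if "x \<in> J" for x
    using that by (simp add: J_def)
  have Jact: "s x \<in> J" if "s \<in> carrier S" "x \<in> J" for s x
    using E.submodule_act(5)[OF J that] R_act[OF that(1) JR[OF that(2)]] by simp
  have "algebra_ideal F R J"
    unfolding algebra_ideal_def
  proof (intro conjI ballI)
    show "submodule J F R"
    proof (rule R.submoduleI_smult)
      show "J \<subseteq> carrier R"
        using JR by blast
      show "\<zero>\<^bsub>R\<^esub> \<in> J"
        using E.submodule_act(2)[OF J] by (simp add: R_zero)
      show "x \<oplus>\<^bsub>R\<^esub> y \<in> J" if "x \<in> J" "y \<in> J" for x y
        using E.submodule_act(3)[OF J that] JR that by (simp add: R_add)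
      show "a \<odot>\<^bsub>R\<^esub> x \<in> J" if a: "a \<in> carrier F" and x: "x \<in> J" for a x
        using R.multiplication_ring_smult[OF a] Jact[OF _ x] JR[OF x] by metis
    qed
    fix r x assume r: "r \<in> carrier R" and x: "x \<in> J"
    show "r \<otimes>\<^bsub>R\<^esub> x \<in> J"
      using R.multiplication_ring_left[OF r] Jact[OF _ x] JR[OF x] by metis
    show "x \<otimes>\<^bsub>R\<^esub> r \<in> J"
      using R.multiplication_ring_right[OF r] Jact[OF _ x] JR[OF x] by metis
  qed
  moreover have "x \<otimes>\<^bsub>R\<^esub> y = \<zero>\<^bsub>R\<^esub>" if x: "x \<in> J" and y: "y \<in> J" for x y
  proof -
    obtain x' where x': "x' \<in> carrier P" "x = c x'"
      using x by (auto simp: J_def V_def)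
    have yP: "y \<in> carrier P"
      using R_P[OF JR[OF y]] .
    have "c y = \<zero>\<^bsub>E\<^esub>"
      using y yP by (intro zero) (simp_all add: J_def)
    then have cy: "c \<odot>\<^bsub>P\<^esub> y = \<zero>\<^bsub>P\<^esub>"
      using c yP by (simp add: P_smult P_zero)
    have "x \<otimes>\<^bsub>R\<^esub> y = (c \<odot>\<^bsub>P\<^esub> x') \<otimes>\<^bsub>P\<^esub> y"
      using JR[OF x] JR[OF y] x' c by (simp add: P_mult P_smult)
    also have "\<dots> = x' \<otimes>\<^bsub>P\<^esub> (c \<odot>\<^bsub>P\<^esub> y)"
      using c x'(1) yP by (simp add: P.smult_mult_l P.smult_mult_r)
    also have "\<dots> = \<zero>\<^bsub>R\<^esub>"
      unfolding cy using P.mult_zero_right[OF x'(1)] by (simp add: P_zero R_zero)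
    finally show ?thesis .
  qed
  then have JJ: "J <#>\<^bsub>R\<^esub> J \<subseteq> {\<zero>\<^bsub>R\<^esub>}"
    by (auto simp: set_mult_def)
  have "generate (add_monoid R) (J <#>\<^bsub>R\<^esub> J) = {\<zero>\<^bsub>R\<^esub>}"
  proof
    have "subgroup {\<zero>\<^bsub>R\<^esub>} (add_monoid R)"
      using R.M.add.triv_subgroup by simp
    then show "generate (add_monoid R) (J <#>\<^bsub>R\<^esub> J) \<subseteq> {\<zero>\<^bsub>R\<^esub>}"
      using JJ by (intro R.M.add.generate_subgroup_incl)
    show "{\<zero>\<^bsub>R\<^esub>} \<subseteq> generate (add_monoid R) (J <#>\<^bsub>R\<^esub> J)"
      using generate.one[of "add_monoid R"] by simp
  qed
  ultimately show False
    using semiprime Jnz unfolding semiprime_algebra_def by blast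
qed

lemma agree_essential:
  assumes c: "c \<in> carrier C" "d \<in> carrier C" and L: "submodule L S E" "E.essential L"
    and eq: "\<And>x. \<lbrakk>x \<in> L; x \<in> carrier P\<rbrakk> \<Longrightarrow> c x = d x"
  shows "c = d"
proof -
  have "(c \<ominus>\<^bsub>C\<^esub> d) x = \<zero>\<^bsub>E\<^esub>" if x: "x \<in> L" "x \<in> carrier P" for x
  proof -
    \<comment> \<open>The ring \<open>CM\<close> defines sums pointwise but not differences; these
      are evaluated through the module laws of the scalar action on \<open>P\<close>.\<close>
    have cd: "c \<odot>\<^bsub>P\<^esub> x = d \<odot>\<^bsub>P\<^esub> x"
      using c x eq by (simp add: P_smult)
    have "(c \<ominus>\<^bsub>C\<^esub> d) x = (c \<ominus>\<^bsub>C\<^esub> d) \<odot>\<^bsub>P\<^esub> x"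
      using c x(2) by (simp add: P_smult)
    also have "\<dots> = \<zero>\<^bsub>P\<^esub>"
      using c x(2) cd by (simp add: a_minus_def P.smult_l_distr P.smult_l_minus P.M.r_neg)
    finally show ?thesis
      by (simp add: P_zero)
  qed
  then have "c \<ominus>\<^bsub>C\<^esub> d = \<zero>\<^bsub>C\<^esub>"
    using c L by (intro vanish_essential) simp_all
  then show ?thesis
    using c by (simp add: P.R.minus_eq_zero_iff)
qed

text \<open>Here U is the cyclic submodule generated by p, and the restricted extension e is the
  projection to U on U + W. So e e and e agree on an essential submodule. If c e kills p, then c
  kills p and with it all of U, so c e vanishes on U + W; \<open>vanish_essential\<close> gives c e
  = 0.\<close>

lemma support:
  assumes p: "p \<in> carrier P" and p0: "p \<noteq> \<zero>\<^bsub>P\<^esub>"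
  shows "\<exists>e\<in>idempotents C. e \<noteq> \<zero>\<^bsub>C\<^esub> \<and>
    (\<forall>c\<in>idempotents C. (c \<otimes>\<^bsub>C\<^esub> e) \<odot>\<^bsub>P\<^esub> p = \<zero>\<^bsub>P\<^esub> \<longrightarrow> c \<otimes>\<^bsub>C\<^esub> e = \<zero>\<^bsub>C\<^esub>)"
proof -
  have pE: "p \<in> carrier E"
    using p by (rule P_closed)
  define U where "U = {s \<odot>\<^bsub>E\<^esub> p | s. s \<in> carrier S}"
  have U: "submodule U S E"
    unfolding U_def using pE by (rule E.submodule_act_cyclic)
  note U' = E.submodule_act[OF U]
  have UP: "u \<in> carrier P" if "u \<in> U" for u
    using that E.submodule_act(5)[OF P_submodule _ p] by (auto simp: U_def)
  have pU: "p \<in> U"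
    using E.act_one[OF pE] by (force simp: U_def)
  \<comment> \<open>The identity of U alone would not determine the extension; prescribing the value
    0 on W fixes it on an essential submodule.\<close>
  obtain W where W: "submodule W S E" and UW: "U \<inter> W = {\<zero>\<^bsub>E\<^esub>}"
    and ess: "E.essential {u \<oplus>\<^bsub>E\<^esub> w | u w. u \<in> U \<and> w \<in> W}"
    by (rule E.obtain_complement[OF U])
  note W' = E.submodule_act[OF W]
  define L where "L = {u \<oplus>\<^bsub>E\<^esub> w | u w. u \<in> U \<and> w \<in> W}"
  have L: "submodule L S E"
    unfolding L_def using U W by (rule E.submodule_act_sum)
  have LI: "u \<oplus>\<^bsub>E\<^esub> w \<in> L" if "u \<in> U" "w \<in> W" for u w
    using that by (auto simp: L_def)
  have unique: "u = u'"
    if u: "u \<in> U" "u' \<in> U" and w: "w \<in> W" "w' \<in> W" and eq: "u \<oplus>\<^bsub>E\<^esub> w = u' \<oplus>\<^bsub>E\<^esub> w'" for u u' w w'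
  proof -
    have carr: "u \<in> carrier E" "u' \<in> carrier E" "w \<in> carrier E" "w' \<in> carrier E"
      using u w U'(1) W'(1) by auto
    have "u \<ominus>\<^bsub>E\<^esub> u' = (u \<oplus>\<^bsub>E\<^esub> w) \<ominus>\<^bsub>E\<^esub> (u' \<oplus>\<^bsub>E\<^esub> w)"
      using carr by (simp add: a_minus_def E.M.minus_add E.M.a_ac E.M.r_neg E.M.r_neg2)
    also have "\<dots> = (u' \<oplus>\<^bsub>E\<^esub> w') \<ominus>\<^bsub>E\<^esub> (u' \<oplus>\<^bsub>E\<^esub> w)"
      using eq by simp
    also have "\<dots> = w' \<ominus>\<^bsub>E\<^esub> w"
      using carr by (simp add: a_minus_def E.M.minus_add E.M.a_assoc
          E.M.a_lcomm[of w' "\<ominus>\<^bsub>E\<^esub> u'" "\<ominus>\<^bsub>E\<^esub> w"] E.M.r_neg2)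
    finally have "u \<ominus>\<^bsub>E\<^esub> u' \<in> U \<inter> W"
      using u w U'(3,4) W'(3,4) by (metis IntI a_minus_def)
    then have "u \<ominus>\<^bsub>E\<^esub> u' = \<zero>\<^bsub>E\<^esub>"
      using UW by blast
    then show ?thesis
      using carr by (simp add: E.M.minus_eq_zero_iff)
  qed
  \<comment> \<open>The projection onto U; \<open>unique\<close> makes the description definite on
    \<open>L\<close>.\<close>
  define f where "f v = (THE u. u \<in> U \<and> (\<exists>w\<in>W. v = u \<oplus>\<^bsub>E\<^esub> w))" for v
  have f: "f (u \<oplus>\<^bsub>E\<^esub> w) = u" if "u \<in> U" "w \<in> W" for u w
    unfolding f_def
  proof (rule the_equality)
    show "u \<in> U \<and> (\<exists>w'\<in>W. u \<oplus>\<^bsub>E\<^esub> w = u \<oplus>\<^bsub>E\<^esub> w')"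
      using that by blast
    fix u' assume "u' \<in> U \<and> (\<exists>w'\<in>W. u \<oplus>\<^bsub>E\<^esub> w = u' \<oplus>\<^bsub>E\<^esub> w')"
    then obtain w' where "u' \<in> U" "w' \<in> W" "u \<oplus>\<^bsub>E\<^esub> w = u' \<oplus>\<^bsub>E\<^esub> w'"
      by blast
    then show "u' = u"
      using unique[of u u' w w'] that by simp
  qed
  have "f \<in> right_module_hom S (E\<lparr>carrier := L\<rparr>) E"
    unfolding right_module_hom_def
  proof (intro CollectI conjI ballI Pi_I)
    fix x assume "x \<in> carrier (E\<lparr>carrier := L\<rparr>)"
    then obtain u w where x: "u \<in> U" "w \<in> W" "x = u \<oplus>\<^bsub>E\<^esub> w"
      by (auto simp: L_def)
    then show "f x \<in> carrier E"
      using U'(1) by (simp add: f)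
    have carr: "u \<in> carrier E" "w \<in> carrier E"
      using x U'(1) W'(1) by auto
    fix y assume "y \<in> carrier (E\<lparr>carrier := L\<rparr>)"
    then obtain u' w' where y: "u' \<in> U" "w' \<in> W" "y = u' \<oplus>\<^bsub>E\<^esub> w'"
      by (auto simp: L_def)
    have carr': "u' \<in> carrier E" "w' \<in> carrier E"
      using y U'(1) W'(1) by auto
    have "x \<oplus>\<^bsub>E\<^esub> y = (u \<oplus>\<^bsub>E\<^esub> u') \<oplus>\<^bsub>E\<^esub> (w \<oplus>\<^bsub>E\<^esub> w')"
      using carr carr' x y by (simp add: E.M.a_ac)
    then show "f (x \<oplus>\<^bsub>E\<lparr>carrier := L\<rparr>\<^esub> y) = f x \<oplus>\<^bsub>E\<^esub> f y"
      using x y f[OF U'(3) W'(3)] by (simp add: f)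
  next
    fix s x assume s: "s \<in> carrier S" and "x \<in> carrier (E\<lparr>carrier := L\<rparr>)"
    then obtain u w where x: "u \<in> U" "w \<in> W" "x = u \<oplus>\<^bsub>E\<^esub> w"
      by (auto simp: L_def)
    have "s \<odot>\<^bsub>E\<^esub> x = s \<odot>\<^bsub>E\<^esub> u \<oplus>\<^bsub>E\<^esub> s \<odot>\<^bsub>E\<^esub> w"
      using s x U'(1) W'(1) by (simp add: E.act_add)
    then show "f (s \<odot>\<^bsub>E\<lparr>carrier := L\<rparr>\<^esub> x) = s \<odot>\<^bsub>E\<^esub> f x"
      using x f[OF U'(5)[OF s] W'(5)[OF s]] by (simp add: f)
  qed
  \<comment> \<open>Ring elements are maps of type \<open>'a \<Rightarrow> 'a\<close>, while hull
    elements have type \<open>'a\<close>; constant maps inject the latter into the former, as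
    \<open>injective_right_module_extend\<close> requires.\<close>
  moreover have "inj (\<lambda>x::'a. (\<lambda>_::'a. x))"
    by (rule injI) (rule fun_cong)
  ultimately obtain g where g: "g \<in> right_module_hom S E E" and gf: "\<And>v. v \<in> L \<Longrightarrow> g v = f v"
    using injective_right_module_extend[OF E_injective E_right_module L] by blast
  have guw: "g (u \<oplus>\<^bsub>E\<^esub> w) = u" if "u \<in> U" "w \<in> W" for u w
    using gf[OF LI[OF that]] f[OF that] by simp
  have gu: "g u = u" if "u \<in> U" for u
    using guw[OF that W'(2)] U'(1)[OF that] by simp
  define e where "e = (\<lambda>x\<in>carrier P. g x)"
  have e: "e \<in> carrier C"
    unfolding e_def using g by (rule restrict_hom)
  have ess: "E.essential L"
    using ess by (simp add: L_def)
  have eP: "e x = g x" if "x \<in> carrier P" for x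
    using that by (simp add: e_def)
  have "e \<otimes>\<^bsub>C\<^esub> e = e"
  proof (rule agree_essential[OF _ e L ess])
    show "e \<otimes>\<^bsub>C\<^esub> e \<in> carrier C"
      using e by simp
    fix x assume x: "x \<in> L" "x \<in> carrier P"
    then obtain u w where uw: "u \<in> U" "w \<in> W" "x = u \<oplus>\<^bsub>E\<^esub> w"
      by (auto simp: L_def)
    then have "e x = u"
      using x(2) by (simp add: eP guw)
    then show "(e \<otimes>\<^bsub>C\<^esub> e) x = e x"
      using x(2) uw(1) UP gu by (simp add: C_mult eP)
  qed
  then have ei: "e \<in> idempotents C"
    using e by (simp add: idempotents_def)
  have "e p = p"
    using p pU by (simp add: eP gu)
  then have enz: "e \<noteq> \<zero>\<^bsub>C\<^esub>"
    using p p0 C_zero_iff[OF e] by (auto simp: P_zero)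
  have "c \<otimes>\<^bsub>C\<^esub> e = \<zero>\<^bsub>C\<^esub>" if c: "c \<in> idempotents C" and kill: "(c \<otimes>\<^bsub>C\<^esub> e) \<odot>\<^bsub>P\<^esub> p = \<zero>\<^bsub>P\<^esub>" for c
  proof (rule vanish_essential[OF _ L ess])
    have cC: "c \<in> carrier C"
      using c by (simp add: idempotents_def)
    then show ce: "c \<otimes>\<^bsub>C\<^esub> e \<in> carrier C"
      using e by simp
    have cp: "c p = \<zero>\<^bsub>E\<^esub>"
      using kill p ce \<open>e p = p\<close> by (simp add: P_smult C_mult P_zero)
    fix x assume x: "x \<in> L" "x \<in> carrier P"
    then obtain u w where uw: "u \<in> U" "w \<in> W" "x = u \<oplus>\<^bsub>E\<^esub> w"
      by (auto simp: L_def)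
    obtain s where s: "s \<in> carrier S" "u = s \<odot>\<^bsub>E\<^esub> p"
      using uw(1) by (auto simp: U_def)
    have "(c \<otimes>\<^bsub>C\<^esub> e) x = c u"
      using x(2) uw by (simp add: C_mult eP guw)
    also have "\<dots> = s \<odot>\<^bsub>E\<^esub> c p"
      using C_hom(3)[OF cC s(1) p] s(2) by simp
    finally show "(c \<otimes>\<^bsub>C\<^esub> e) x = \<zero>\<^bsub>E\<^esub>"
      using s(1) by (simp add: cp E.act_zero)
  qed
  then show ?thesis
    using ei enz by blast
qed

end

theorem lemma3p13:
  fixes F :: "'f ring"
    and R :: "('f, 'a) module"
    and E P Q :: "('a \<Rightarrow> 'a, 'a) module"
  assumes "alternative_algebra F R"
    and "carrier R \<noteq> {\<zero>\<^bsub>R\<^esub>}"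
    and "semiprime_algebra F R"
    and "injective_hull (multiplication_ring F R) (multiplication_module R) E"
    and "is_central_closure F R E P"
    and "left_annihilator P (nucleus P) = {\<zero>\<^bsub>P\<^esub>}"
    and "maximal_right_quotient_algebra (CM F R E) P Q"
  shows "let C = CM F R E;
             O_P = Q\<lparr>carrier := orthogonal_completion C Q (carrier P)\<rparr>
         in orthogonally_complete C Q (carrier Q) \<and>
            right_quotient_algebra C O_P Q \<and>
            (\<forall>B. boolean_ultrafilter C B \<longrightarrow>
               (let Q_B = ultra_quotient C Q B;
                    O_P_B = ultra_quotient C O_P B;
                    h = ultra_map C Q B
                in algebra_embedding C O_P_B Q_B h \<and>
                   right_quotient_algebra C (Q_B\<lparr>carrier := h ` carrier O_P_B\<rparr>) Q_B))"
proof -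
  interpret closure: semiprime_central_closure F R E P
  proof (intro semiprime_central_closure.intro semiprime_central_closure_axioms.intro)
    show "plain_algebra F R"
      using assms(1) by (simp add: plain_algebra_def alternative_algebra_def)
    show "right_module (multiplication_ring F R) E"
      using assms(4) by (simp add: injective_hull_def injective_right_module_def)
    show "nonassoc_algebra (CM F R E) P"
      using assms(5) by (simp add: is_central_closure_def)
  qed (rule assms)+
  \<comment> \<open>The central closure is handed over to the general theory through its
    supports.\<close>
  interpret supported_max_quotient "CM F R E" P Q
    using assms(7) closure.support by (rule supported_max_quotient.intro)
  have O_P: "Q\<lparr>carrier := orthogonal_completion (CM F R E) Q (carrier P)\<rparr> = O_P"
    by (simp add: O_P_def completion_def)
  have "algebra_embedding (CM F R E) (ultra_quotient (CM F R E) O_P B)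
        (ultra_quotient (CM F R E) Q B) (ultra_map (CM F R E) Q B) \<and>
      right_quotient_algebra (CM F R E) (ultra_quotient (CM F R E) Q B
        \<lparr>carrier := ultra_map (CM F R E) Q B ` carrier (ultra_quotient (CM F R E) O_P B)\<rparr>)
        (ultra_quotient (CM F R E) Q B)"
    if B: "boolean_ultrafilter (CM F R E) B" for B
  proof -
    interpret ultra_max_quotient "CM F R E" P Q B
      by unfold_locales (rule B)
    show ?thesis
      using ultra_map_embedding O_image_right_quotient
      by (simp add: ultra_map_image flip: O_image_def)
  qed
  then show ?thesis
    unfolding Let_def O_P using orthogonally_complete O_P_right_quotient by blast
qed

end
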